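(* Let $n\ge2$, let $\mathfrak q=\mathfrak q(n)$ be the queer Lie superalgebra, let $A$ be a finitely generated commutative associative unital $\mathbb C$-algebra, and let $\psi\in\mathcal L(\mathfrak h\otimes A)$ be such that $\lambda=\psi|_{\mathfrak h_{\bar0}}\in\Lambda^+$. Then any finite-dimensional local Weyl module with highest map-weight $\psi$ in the category $\mathcal I_{\mathfrak q\otimes A,\mathfrak q_{\bar0}}$ is isomorphic to $W_A^{\mathrm{loc}}(\psi)$ or $\Pi(W_A^{\mathrm{loc}}(\psi))$. Furthermore, if a finite-dimensional object $V(\psi)\in\mathcal I_{\mathfrak q\otimes A,\mathfrak q_{\bar0}}$ is generated by an irreducible module $H(\psi)$ of map-weight $\psi$, then there exists a surjective homomorphism from $W_A^{\mathrm{loc}}(\psi)$ to $V(\psi)$ (up to $\Pi$).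
   Context: Everything is over $\mathbb C$; modules over superalgebras are $\mathbb Z_2$-graded, homomorphisms are even, and $\Pi$ is the parity change functor ($\Pi(V)_i=V_{i+\bar1}$). The queer Lie superalgebra $\mathfrak q=\mathfrak q(n)$ consists of the block matrices $\begin{pmatrix}X&Y\\ Y&X\end{pmatrix}$, $X,Y\in\mathfrak{gl}(n)$, inside $\mathfrak{gl}(n|n)$; the even part $\mathfrak q_{\bar0}\cong\mathfrak{gl}(n)$ is given by $Y=0$ and the odd part by $X=0$. $\mathfrak h=\mathfrak h_{\bar0}\oplus\mathfrak h_{\bar1}$ is the subalgebra where $X,Y$ are diagonal; $\mathfrak n^+$ is the subalgebra where $X,Y$ are strictly upper triangular; $\mathfrak b=\mathfrak h\oplus\mathfrak n^+$. Put $k_i=\mathrm{diag}(E_{i,i},E_{i,i})$, let $\{\epsilon_i\}$ be the basis of $\mathfrak h_{\bar0}^*$ dual to $\{k_i\}$, and for $i\in I=\{1,\dots,n-1\}$ let $h_i=k_i-k_{i+1}$ and $f_i=\mathrm{diag}(E_{i+1,i},E_{i+1,i})$. $\Lambda^+$ is the set of $\lambda=\sum\lambda_i\epsilon_i\in\mathfrak h_{\bar0}^*$ with $\lambda_i-\lambda_{i+1}\in\mathbb Z_{\ge0}$ for all $i\in I$ and such that $\lambda_i=\lambda_{i+1}$ implies $\lambda_i=\lambda_{i+1}=0$. $\mathfrak q\otimes A$ has bracket $[x\otimes a,y\otimes b]=[x,y]\otimes ab$ and contains $\mathfrak q=\mathfrak q\otimes\mathbb C$. $\mathcal I_{\mathfrak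 q\otimes A,\mathfrak q_{\bar0}}$ is the full subcategory of the category of $\mathfrak q\otimes A$-modules whose objects are the modules whose restriction to $\mathfrak q_{\bar0}$ is isomorphic to a direct sum of irreducible finite-dimensional $\mathfrak q_{\bar0}$-modules. $\mathcal L(\mathfrak h\otimes A)$ is the set of $\psi\in(\mathfrak h_{\bar0}\otimes A)^*$ such that $\psi(\mathfrak h_{\bar0}\otimes J)=0$ for some ideal $J\subseteq A$ of finite codimension. For $\psi\in\mathcal L(\mathfrak h\otimes A)$ there is (known fact) a unique, up to $\Pi$, simple finite-dimensional $\mathfrak h\otimes A$-module $H(\psi)$ such that $xv=\psi(x)v$ for all $x\in\mathfrak h_{\bar0}\otimes A$, $v\in H(\psi)$; an action of $\mathfrak b\otimes A$ on $H(\psi)$ is defined by letting $\mathfrak n^+\otimes A$ act by zero. A $\mathfrak q\otimes A$-module generated by $H(\psi)$ is called a highest map-weight module with highest map-weight $\psi$ if $(\mathfrak n^+\otimes A)w=0$ and $xw=\psi(x)w$ for all $w\in H(\psi)$, $x\in\mathfrak h_{\bar0}\otimes A$. For $\psi\in\mathcal L(\mathfrak h\otimes A)$ with $\lambda=\psi|_{\mathfrak h_{\bar0}}\in\Lambda^+$, the local Weyl module $W_A^{\mathrm{loc}}(\psi)$ associated to $\psi$ (defined up to $\Pi$) is the $\mathfrak q\otimes A$-module generated by $H(\psi)$ with defining relations $(\mathfrak n^+\otimes A)w=0$, $xw=\psi(x)w$, $f_i^{\lambda(h_i)+1}w=0$ for all $w\in H(\psi)$, $x\in\mathfrak h_{\bar0}\otimes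 A$, $i\in I$. *)

theory Defs
  imports
    "HOL-Analysis.Analysis"
    "HOL-Library.Z2"
    "HOL-Library.Poly_Mapping"
    "Jordan_Normal_Form.Missing_VectorSpace"
begin

section \<open>Commutative algebras over the complex numbers\<close>

class comm_complex_algebra_1 = comm_ring_1 +
  fixes scaleC :: "complex \<Rightarrow> 'a \<Rightarrow> 'a"  (infixr "*\<^sub>C" 75)
  assumes scaleC_add_right: "c *\<^sub>C (a + b) = c *\<^sub>C a + c *\<^sub>C b"
    and scaleC_add_left: "(c + d) *\<^sub>C a = c *\<^sub>C a + d *\<^sub>C a"
    and scaleC_scaleC: "c *\<^sub>C d *\<^sub>C a = (c * d) *\<^sub>C a"
    and scaleC_one: "1 *\<^sub>C a = a"
    and mult_scaleC_left: "(c *\<^sub>C a) * b = c *\<^sub>C (a * b)"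

instantiation complex :: comm_complex_algebra_1
begin

definition scaleC_complex :: "complex \<Rightarrow> complex \<Rightarrow> complex"
  where "scaleC_complex = (*)"

instance
  by standard (simp_all add: scaleC_complex_def algebra_simps)

end

definition complex_subalgebra :: "'a::comm_complex_algebra_1 set \<Rightarrow> bool" where
  "complex_subalgebra B \<longleftrightarrow> 1 \<in> B \<and>
     (\<forall>a\<in>B. \<forall>b\<in>B. a + b \<in> B \<and> a * b \<in> B) \<and> (\<forall>c. \<forall>a\<in>B. c *\<^sub>C a \<in> B)"

definition finitely_generated_algebra :: "'a::comm_complex_algebra_1 itself \<Rightarrow> bool" where
  "finitely_generated_algebra T \<longleftrightarrow>
     (\<exists>G::'a set. finite G \<and> (\<forall>B. complex_subalgebra B \<and> G \<subseteq> B \<longrightarrow> B = UNIV))"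

definition algebra_ideal :: "'a::comm_complex_algebra_1 set \<Rightarrow> bool" where
  "algebra_ideal J \<longleftrightarrow> 0 \<in> J \<and> (\<forall>a\<in>J. \<forall>b\<in>J. a + b \<in> J) \<and> (\<forall>r. \<forall>a\<in>J. r * a \<in> J)"

text \<open>The quotient by \<open>J\<close> is spanned by the classes of finitely many elements.\<close>

definition finite_codimension :: "'a::comm_complex_algebra_1 set \<Rightarrow> bool" where
  "finite_codimension J \<longleftrightarrow> (\<exists>B. finite B \<and> Modules.module.span (*\<^sub>C) (B \<union> J) = UNIV)"


section \<open>The Lie superalgebra $\mathfrak q(n) \otimes A$\<close>

text \<open>
  The type \<open>'n\<close>, finite and linearly ordered, plays the role of $\{1,\dots,n\}$. A pair \<open>(X, Y)\<close>
  of matrices over \<open>A\<close> stands for the block matrix with rows \<open>(X Y)\<close> and \<open>(Y X)\<close>, so that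
  $x \otimes a$ is the matrix \<open>x\<close> with all entries multiplied by \<open>a\<close>. Parities are elements
  of the two-element field \<^typ>\<open>bit\<close>.
\<close>

type_synonym ('a, 'n) queer = "('a^'n^'n) \<times> ('a^'n^'n)"

definition q_scale ::
  "complex \<Rightarrow> ('a::comm_complex_algebra_1, 'n::finite) queer \<Rightarrow> ('a, 'n) queer" where
  "q_scale c x = (map_matrix ((*\<^sub>C) c) (fst x), map_matrix ((*\<^sub>C) c) (snd x))"

definition q_part :: "bit \<Rightarrow> ('a::comm_complex_algebra_1, 'n::finite) queer set" where
  "q_part p = (if p = 0 then {x. snd x = 0} else {x. fst x = 0})"

definition super_sign :: "bit \<Rightarrow> bit \<Rightarrow> complex" where
  "super_sign p r = (if p = 1 \<and> r = 1 then -1 else 1)"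

text \<open>
  The supercommutator of block matrices; see \<open>block_q_bracket\<close> and \<open>q_bracket_tensor\<close> below.
\<close>

definition q_bracket ::
  "('a::comm_complex_algebra_1, 'n::finite) queer \<Rightarrow> ('a, 'n) queer \<Rightarrow> ('a, 'n) queer" where
  "q_bracket x y =
     (fst x ** fst y - fst y ** fst x + (snd x ** snd y + snd y ** snd x),
      (fst x ** snd y - snd y ** fst x) + (snd x ** fst y - fst y ** snd x))"

definition block :: "('a::comm_complex_algebra_1, 'n::finite) queer \<Rightarrow> 'a^('n + 'n)^('n + 'n)" where
  "block x = (\<chi> r c. case (r, c) of
     (Inl i, Inl j) \<Rightarrow> fst x $ i $ j | (Inl i, Inr j) \<Rightarrow> snd x $ i $ j
   | (Inr i, Inl j) \<Rightarrow> snd x $ i $ j | (Inr i, Inr j) \<Rightarrow> fst x $ i $ j)"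

definition q_tensor ::
  "(complex, 'n::finite) queer \<Rightarrow> 'a::comm_complex_algebra_1 \<Rightarrow> ('a, 'n) queer" where
  "q_tensor x a = (map_matrix (\<lambda>c. c *\<^sub>C a) (fst x), map_matrix (\<lambda>c. c *\<^sub>C a) (snd x))"

definition matrix_unit :: "'n::finite \<Rightarrow> 'n \<Rightarrow> complex^'n^'n" where
  "matrix_unit i j = (\<chi> r c. if r = i \<and> c = j then 1 else 0)"

definition hA :: "('a::comm_complex_algebra_1, 'n::finite) queer set" where
  "hA = {x. \<forall>i j. i \<noteq> j \<longrightarrow> fst x $ i $ j = 0 \<and> snd x $ i $ j = 0}"

definition h0A :: "('a::comm_complex_algebra_1, 'n::finite) queer set" where
  "h0A = hA \<inter> q_part 0"

definition nA :: "('a::comm_complex_algebra_1, 'n::{finite,linorder}) queer set" where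
  "nA = {x. \<forall>i j. \<not> i < j \<longrightarrow> fst x $ i $ j = 0 \<and> snd x $ i $ j = 0}"

text \<open>The copy $\mathfrak q_{\bar 0} \otimes 1$ of $\mathfrak q_{\bar 0}$ in $\mathfrak q \otimes A$.\<close>

definition q0 :: "('a::comm_complex_algebra_1, 'n::finite) queer set" where
  "q0 = (\<lambda>x. q_tensor x 1) ` q_part 0"

text \<open>
  Two indices with \<open>next_index i j\<close> are $i$ and $i+1$ with $i \in I$; the elements
  $k_i$, $h_i$, $f_i$ below are those of $\mathfrak q = \mathfrak q \otimes 1$.
\<close>

definition next_index :: "'n::linorder \<Rightarrow> 'n \<Rightarrow> bool" where
  "next_index i j \<longleftrightarrow> i < j \<and> \<not> (\<exists>l. i < l \<and> l < j)"

definition k_elem :: "'n::finite \<Rightarrow> ('a::comm_complex_algebra_1, 'n) queer" where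
  "k_elem i = q_tensor (matrix_unit i i, 0) 1"

definition h_elem :: "'n::finite \<Rightarrow> 'n \<Rightarrow> ('a::comm_complex_algebra_1, 'n) queer" where
  "h_elem i j = k_elem i - k_elem j"

definition f_elem :: "'n::finite \<Rightarrow> 'n \<Rightarrow> ('a::comm_complex_algebra_1, 'n) queer" where
  "f_elem i j = q_tensor (matrix_unit j i, 0) 1"


section \<open>Map-weights\<close>

text \<open>
  A functional on $\mathfrak h_{\bar 0} \otimes A$ is represented by a function on all of
  $\mathfrak q \otimes A$ of which only the values on \<^const>\<open>h0A\<close> are used.
\<close>

definition linear_on_h0A ::
  "(('a::comm_complex_algebra_1, 'n::finite) queer \<Rightarrow> complex) \<Rightarrow> bool" where
  "linear_on_h0A \<psi> \<longleftrightarrow>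
     (\<forall>x\<in>h0A. \<forall>y\<in>h0A. \<psi> (x + y) = \<psi> x + \<psi> y) \<and>
     (\<forall>c. \<forall>x\<in>h0A. \<psi> (q_scale c x) = c * \<psi> x)"

definition map_weights :: "(('a::comm_complex_algebra_1, 'n::finite) queer \<Rightarrow> complex) set" where
  "map_weights = {\<psi>. linear_on_h0A \<psi> \<and>
     (\<exists>J. algebra_ideal J \<and> finite_codimension J \<and>
          (\<forall>x\<in>h0A. (\<forall>i j. fst x $ i $ j \<in> J) \<longrightarrow> \<psi> x = 0))}"

text \<open>Coordinates of $\psi|_{\mathfrak h_{\bar 0}}$ in the basis $\epsilon_i$ dual to $k_i$.\<close>

definition restrict_h0 ::
  "(('a::comm_complex_algebra_1, 'n::finite) queer \<Rightarrow> complex) \<Rightarrow> 'n \<Rightarrow> complex" where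
  "restrict_h0 \<psi> i = \<psi> (k_elem i)"

definition dominant_weights :: "('n::linorder \<Rightarrow> complex) set" where
  "dominant_weights = {\<mu>. \<forall>i j. next_index i j \<longrightarrow>
     \<mu> i - \<mu> j \<in> \<nat> \<and> (\<mu> i = \<mu> j \<longrightarrow> \<mu> i = 0 \<and> \<mu> j = 0)}"


section \<open>Supermodules\<close>

abbreviation complex_field :: "complex ring" where
  "complex_field \<equiv> \<lparr>carrier = UNIV, mult = (*), one = 1, zero = 0, add = (+)\<rparr>"

text \<open>
  The inherited fields \<^term>\<open>mult\<close> and \<^term>\<open>one\<close> are irrelevant.
\<close>

record ('g, 'v) supermodule = "(complex, 'v) module" +
  part :: "bit \<Rightarrow> 'v set"
  act :: "'g \<Rightarrow> 'v \<Rightarrow> 'v"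

text \<open>
  \<open>S\<close> is a graded subalgebra of $\mathfrak q \otimes A$; restriction to a smaller subalgebra
  does not change the record.
\<close>

definition supermodule ::
  "('a::comm_complex_algebra_1, 'n::finite) queer set \<Rightarrow> (('a, 'n) queer, 'v) supermodule \<Rightarrow> bool" where
  "supermodule S M \<longleftrightarrow>
     vectorspace complex_field M \<and>
     (\<forall>p. VectorSpace.subspace complex_field (part M p) M) \<and>
     part M 0 \<inter> part M 1 = {\<zero>\<^bsub>M\<^esub>} \<and>
     (\<forall>v\<in>carrier M. \<exists>v0\<in>part M 0. \<exists>v1\<in>part M 1. v = v0 \<oplus>\<^bsub>M\<^esub> v1) \<and>
     (\<forall>x\<in>S. act M x \<in> LinearCombinations.module_hom complex_field M M) \<and>
     (\<forall>x\<in>S. \<forall>y\<in>S. \<forall>v\<in>carrier M. act M (x + y) v = act M x v \<oplus>\<^bsub>M\<^esub> act M y v) \<and>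
     (\<forall>c. \<forall>x\<in>S. \<forall>v\<in>carrier M. act M (q_scale c x) v = c \<odot>\<^bsub>M\<^esub> act M x v) \<and>
     (\<forall>p r. \<forall>x\<in>S \<inter> q_part p. \<forall>v\<in>part M r. act M x v \<in> part M (p + r)) \<and>
     (\<forall>p r. \<forall>x\<in>S \<inter> q_part p. \<forall>y\<in>S \<inter> q_part r. \<forall>v\<in>carrier M.
        act M (q_bracket x y) v =
          act M x (act M y v) \<ominus>\<^bsub>M\<^esub> super_sign p r \<odot>\<^bsub>M\<^esub> act M y (act M x v))"

definition fin_dim :: "('g, 'v) supermodule \<Rightarrow> bool" where
  "fin_dim M \<longleftrightarrow> vectorspace.fin_dim complex_field M"

definition graded_submodule :: "'g set \<Rightarrow> 'v set \<Rightarrow> ('g, 'v) supermodule \<Rightarrow> bool" where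
  "graded_submodule S N M \<longleftrightarrow>
     VectorSpace.subspace complex_field N M \<and>
     (\<forall>v\<in>N. \<exists>v0\<in>N \<inter> part M 0. \<exists>v1\<in>N \<inter> part M 1. v = v0 \<oplus>\<^bsub>M\<^esub> v1) \<and>
     (\<forall>x\<in>S. \<forall>v\<in>N. act M x v \<in> N)"

definition restrict_to :: "('g, 'v) supermodule \<Rightarrow> 'v set \<Rightarrow> ('g, 'v) supermodule" where
  "restrict_to M N = M\<lparr>carrier := N, part := (\<lambda>p. part M p \<inter> N)\<rparr>"

definition simple_module :: "'g set \<Rightarrow> ('g, 'v) supermodule \<Rightarrow> bool" where
  "simple_module S M \<longleftrightarrow> carrier M \<noteq> {\<zero>\<^bsub>M\<^esub>} \<and>
     (\<forall>N. graded_submodule S N M \<longrightarrow> N = {\<zero>\<^bsub>M\<^esub>} \<or> N = carrier M)"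

definition generated_by :: "'g set \<Rightarrow> ('g, 'v) supermodule \<Rightarrow> 'v set \<Rightarrow> bool" where
  "generated_by S M N \<longleftrightarrow> N \<subseteq> carrier M \<and>
     (\<forall>U. graded_submodule S U M \<and> N \<subseteq> U \<longrightarrow> U = carrier M)"

definition hom_super ::
  "'g set \<Rightarrow> ('g, 'v) supermodule \<Rightarrow> ('g, 'w) supermodule \<Rightarrow> ('v \<Rightarrow> 'w) set" where
  "hom_super S M N = {\<phi>. \<phi> \<in> LinearCombinations.module_hom complex_field M N \<and>
     (\<forall>p. \<phi> ` part M p \<subseteq> part N p) \<and>
     (\<forall>x\<in>S. \<forall>v\<in>carrier M. \<phi> (act M x v) = act N x (\<phi> v))}"

definition iso_super ::
  "'g set \<Rightarrow> ('g, 'v) supermodule \<Rightarrow> ('g, 'w) supermodule \<Rightarrow> bool" where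
  "iso_super S M N \<longleftrightarrow> (\<exists>\<phi>\<in>hom_super S M N. bij_betw \<phi> (carrier M) (carrier N))"

definition surjects_onto ::
  "'g set \<Rightarrow> ('g, 'v) supermodule \<Rightarrow> ('g, 'w) supermodule \<Rightarrow> bool" where
  "surjects_onto S M N \<longleftrightarrow> (\<exists>\<phi>\<in>hom_super S M N. \<phi> ` carrier M = carrier N)"

definition parity_change :: "('g, 'v) supermodule \<Rightarrow> ('g, 'v) supermodule" where
  "parity_change M = M\<lparr>part := (\<lambda>p. part M (p + 1))\<rparr>"

text \<open>
  The internal form of being isomorphic to a direct sum of irreducible finite-dimensional
  modules: a family of such submodules that spans \<open>M\<close> and whose sum is direct.
\<close>

definition direct_sum_of_fd_irreducibles ::
  "('a::comm_complex_algebra_1, 'n::finite) queer set \<Rightarrow> (('a, 'n) queer, 'v) supermodule \<Rightarrow> bool" where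
  "direct_sum_of_fd_irreducibles S M \<longleftrightarrow>
     (\<exists>F. (\<forall>N\<in>F. graded_submodule S N M \<and> simple_module S (restrict_to M N) \<and>
                  fin_dim (restrict_to M N)) \<and>
          LinearCombinations.module.span complex_field M (\<Union>F) = carrier M \<and>
          (\<forall>N\<in>F. N \<inter> LinearCombinations.module.span complex_field M (\<Union>(F - {N})) = {\<zero>\<^bsub>M\<^esub>}))"

definition in_category_I ::
  "(('a::comm_complex_algebra_1, 'n::finite) queer, 'v) supermodule \<Rightarrow> bool" where
  "in_category_I M \<longleftrightarrow> supermodule UNIV M \<and> direct_sum_of_fd_irreducibles q0 M"


section \<open>Highest map-weight modules\<close>

text \<open>\<open>is_H \<psi> M\<close> says that \<open>M\<close> is (a choice of) $H(\psi)$.\<close>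

definition is_H ::
  "(('a::comm_complex_algebra_1, 'n::finite) queer \<Rightarrow> complex) \<Rightarrow>
   (('a, 'n) queer, 'h) supermodule \<Rightarrow> bool" where
  "is_H \<psi> M \<longleftrightarrow> supermodule hA M \<and> fin_dim M \<and> simple_module hA M \<and>
     (\<forall>x\<in>h0A. \<forall>v\<in>carrier M. act M x v = \<psi> x \<odot>\<^bsub>M\<^esub> v)"

definition highest_map_weight_module ::
  "(('a::comm_complex_algebra_1, 'n::{finite,linorder}) queer \<Rightarrow> complex) \<Rightarrow>
   (('a, 'n) queer, 'v) supermodule \<Rightarrow> 'v set \<Rightarrow> bool" where
  "highest_map_weight_module \<psi> M N \<longleftrightarrow>
     supermodule UNIV M \<and> graded_submodule hA N M \<and> is_H \<psi> (restrict_to M N) \<and>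
     (\<forall>x\<in>nA. \<forall>w\<in>N. act M x w = \<zero>\<^bsub>M\<^esub>) \<and> generated_by UNIV M N"


section \<open>Local Weyl modules\<close>

text \<open>
  The module presented by generators and relations is constructed as a quotient of the complex
  vector space with basis the formal expressions \<open>x\<^sub>1 \<dots> x\<^sub>r w\<close>, represented as
  \<open>([x\<^sub>1, \<dots>, x\<^sub>r], w)\<close>, with each \<open>x\<^sub>s\<close> in $\mathfrak q \otimes A$ and \<open>w\<close> in the given module
  of generators. The relations contain those making the quotient a $\mathfrak q \otimes A$-module
  into which the generators map $\mathfrak h \otimes A$-linearly. Since they are imposed after an
  arbitrary prefix \<open>u\<close>, their linear span is stable under the action. The defining relations of
  the local Weyl module are \<open>rel_n\<close>, \<open>rel_h\<close> and \<open>rel_f\<close>.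
\<close>

type_synonym ('a, 'n, 'h) free_module = "(('a, 'n) queer list \<times> 'h) \<Rightarrow>\<^sub>0 complex"

definition word ::
  "('a, 'n) queer list \<Rightarrow> 'h \<Rightarrow> ('a::comm_complex_algebra_1, 'n::finite, 'h) free_module" where
  "word u w = Poly_Mapping.single (u, w) 1"

definition free_scale ::
  "complex \<Rightarrow> ('a::comm_complex_algebra_1, 'n::finite, 'h) free_module \<Rightarrow> ('a, 'n, 'h) free_module" where
  "free_scale c = Poly_Mapping.map ((*) c)"

definition free_act ::
  "('a, 'n) queer \<Rightarrow> ('a::comm_complex_algebra_1, 'n::finite, 'h) free_module
     \<Rightarrow> ('a, 'n, 'h) free_module" where
  "free_act x f = (\<Sum>b\<in>Poly_Mapping.keys f.
     free_scale (Poly_Mapping.lookup f b) (word (x # fst b) (snd b)))"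

inductive_set weyl_relators ::
  "(('a::comm_complex_algebra_1, 'n::{finite,linorder}) queer \<Rightarrow> complex) \<Rightarrow>
   (('a, 'n) queer, 'h) supermodule \<Rightarrow> ('a, 'n, 'h) free_module set"
  for \<psi> and H where
  act_add: "w \<in> carrier H \<Longrightarrow>
    word (u @ (x + y) # v) w - word (u @ x # v) w - word (u @ y # v) w \<in> weyl_relators \<psi> H"
| act_scale: "w \<in> carrier H \<Longrightarrow>
    word (u @ q_scale c x # v) w - free_scale c (word (u @ x # v) w) \<in> weyl_relators \<psi> H"
| act_bracket: "\<lbrakk>w \<in> carrier H; x \<in> q_part p; y \<in> q_part r\<rbrakk> \<Longrightarrow>
    word (u @ q_bracket x y # v) w
      - (word (u @ x # y # v) w - free_scale (super_sign p r) (word (u @ y # x # v) w))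
      \<in> weyl_relators \<psi> H"
| gen_add: "\<lbrakk>w \<in> carrier H; w' \<in> carrier H\<rbrakk> \<Longrightarrow>
    word u (w \<oplus>\<^bsub>H\<^esub> w') - word u w - word u w' \<in> weyl_relators \<psi> H"
| gen_scale: "w \<in> carrier H \<Longrightarrow>
    word u (c \<odot>\<^bsub>H\<^esub> w) - free_scale c (word u w) \<in> weyl_relators \<psi> H"
| gen_act: "\<lbrakk>w \<in> carrier H; x \<in> hA\<rbrakk> \<Longrightarrow>
    word (u @ [x]) w - word u (act H x w) \<in> weyl_relators \<psi> H"
| rel_n: "\<lbrakk>w \<in> carrier H; x \<in> nA\<rbrakk> \<Longrightarrow> word (u @ [x]) w \<in> weyl_relators \<psi> H"
| rel_h: "\<lbrakk>w \<in> carrier H; x \<in> h0A\<rbrakk> \<Longrightarrow>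
    word (u @ [x]) w - free_scale (\<psi> x) (word u w) \<in> weyl_relators \<psi> H"
| rel_f: "\<lbrakk>w \<in> carrier H; next_index i j; of_nat m = \<psi> (h_elem i j)\<rbrakk> \<Longrightarrow>
    word (u @ replicate (m + 1) (f_elem i j)) w \<in> weyl_relators \<psi> H"

definition weyl_relations ::
  "(('a::comm_complex_algebra_1, 'n::{finite,linorder}) queer \<Rightarrow> complex) \<Rightarrow>
   (('a, 'n) queer, 'h) supermodule \<Rightarrow> ('a, 'n, 'h) free_module set" where
  "weyl_relations \<psi> H = Modules.module.span free_scale (weyl_relators \<psi> H)"

definition weyl_class ::
  "(('a::comm_complex_algebra_1, 'n::{finite,linorder}) queer \<Rightarrow> complex) \<Rightarrow>
   (('a, 'n) queer, 'h) supermodule \<Rightarrow> ('a, 'n, 'h) free_module \<Rightarrow> ('a, 'n, 'h) free_module set" where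
  "weyl_class \<psi> H f = {g. g - f \<in> weyl_relations \<psi> H}"

text \<open>Spanning words of a given parity: all letters and the generator are homogeneous.\<close>

definition homogeneous_words ::
  "(('a::comm_complex_algebra_1, 'n::{finite,linorder}) queer, 'h) supermodule \<Rightarrow> bit
     \<Rightarrow> ('a, 'n, 'h) free_module set" where
  "homogeneous_words H p = {word u w | u w ps r.
     list_all2 (\<lambda>x s. x \<in> q_part s) u ps \<and> w \<in> part H r \<and> p = sum_list ps + r}"

definition local_weyl ::
  "(('a::comm_complex_algebra_1, 'n::{finite,linorder}) queer \<Rightarrow> complex) \<Rightarrow>
   (('a, 'n) queer, 'h) supermodule
     \<Rightarrow> (('a, 'n) queer, ('a, 'n, 'h) free_module set) supermodule" where
  "local_weyl \<psi> H =
     \<lparr>carrier = weyl_class \<psi> H ` Modules.module.span free_scale {word u w | u w. w \<in> carrier H},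
      mult = undefined,
      one = undefined,
      zero = weyl_class \<psi> H 0,
      add = (\<lambda>X Y. \<Union>f\<in>X. \<Union>g\<in>Y. weyl_class \<psi> H (f + g)),
      smult = (\<lambda>c X. \<Union>f\<in>X. weyl_class \<psi> H (free_scale c f)),
      part = (\<lambda>p. weyl_class \<psi> H ` Modules.module.span free_scale (homogeneous_words H p)),
      act = (\<lambda>x X. \<Union>f\<in>X. weyl_class \<psi> H (free_act x f))\<rparr>"

text \<open>
  \<open>M\<close> is a local Weyl module with highest map-weight \<open>\<psi>\<close>, for the choice \<open>H\<close> of $H(\psi)$.
\<close>

definition is_local_weyl_module ::
  "(('a::comm_complex_algebra_1, 'n::{finite,linorder}) queer \<Rightarrow> complex) \<Rightarrow>
   (('a, 'n) queer, 'h) supermodule \<Rightarrow> (('a, 'n) queer, 'v) supermodule \<Rightarrow> bool" where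
  "is_local_weyl_module \<psi> H M \<longleftrightarrow>
     is_H \<psi> H \<and> supermodule UNIV M \<and> iso_super UNIV M (local_weyl \<psi> H)"


section \<open>The block matrix and tensor product descriptions of \<open>queer\<close>\<close>

lemma scaleC_sum_left: "(\<Sum>i\<in>I. f i) *\<^sub>C (a::'a::comm_complex_algebra_1) = (\<Sum>i\<in>I. f i *\<^sub>C a)"
proof -
  have z: "(0::complex) *\<^sub>C a = 0"
    using scaleC_add_left[of 0 0 a] by simp
  show ?thesis
    by (induction I rule: infinite_finite_induct) (auto simp: z scaleC_add_left)
qed

lemma scaleC_zero_left: "(0::complex) *\<^sub>C (a::'a::comm_complex_algebra_1) = 0"
  using scaleC_add_left[of 0 0 a] by simp

lemma scaleC_minus_left: "(- c) *\<^sub>C (a::'a::comm_complex_algebra_1) = - (c *\<^sub>C a)"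
  using scaleC_add_left[of c "-c" a] by (simp add: scaleC_zero_left eq_neg_iff_add_eq_0 add.commute)

lemma scaleC_diff_left: "(c - d) *\<^sub>C (a::'a::comm_complex_algebra_1) = c *\<^sub>C a - d *\<^sub>C a"
  using scaleC_add_left[of c "-d" a] by (simp add: scaleC_minus_left)

lemma mult_scaleC_both:
  "(c *\<^sub>C a) * (d *\<^sub>C b) = (c * d) *\<^sub>C (a * (b::'a::comm_complex_algebra_1))"
  by (metis mult.commute mult_scaleC_left scaleC_scaleC)

lemma q_bracket_tensor:
  "q_bracket (q_tensor x a) (q_tensor y b) = q_tensor (q_bracket x y) (a * b)"
proof -
  have m: "map_matrix (\<lambda>c. c *\<^sub>C a) X ** map_matrix (\<lambda>c. c *\<^sub>C b) Y
        = map_matrix (\<lambda>c. c *\<^sub>C (a * b)) (X ** Y)" for X Y and a b :: 'a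
    by (simp add: vec_eq_iff matrix_matrix_mult_def map_matrix_def scaleC_sum_left mult_scaleC_both)
  have p: "map_matrix (\<lambda>c. c *\<^sub>C (a * b)) (X + Y)
        = map_matrix (\<lambda>c. c *\<^sub>C (a * b)) X + map_matrix (\<lambda>c. c *\<^sub>C (a * b)) Y" for X Y
    by (simp add: vec_eq_iff map_matrix_def scaleC_add_left)
  have d: "map_matrix (\<lambda>c. c *\<^sub>C (a * b)) (X - Y)
        = map_matrix (\<lambda>c. c *\<^sub>C (a * b)) X - map_matrix (\<lambda>c. c *\<^sub>C (a * b)) Y" for X Y
    by (simp add: vec_eq_iff map_matrix_def scaleC_diff_left)
  show ?thesis
    unfolding q_bracket_def q_tensor_def fst_conv snd_conv m p d
    by (simp only: m mult.commute[of b a])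
qed

lemma q_tensor_decomposition:
  "z = (\<Sum>i\<in>UNIV. \<Sum>j\<in>UNIV. q_tensor (matrix_unit i j, 0) (fst z $ i $ j)
                            + q_tensor (0, matrix_unit i j) (snd z $ i $ j))"
proof -
  have 1: "(\<Sum>i\<in>UNIV. \<Sum>j\<in>UNIV. map_matrix (\<lambda>c. c *\<^sub>C (X $ i $ j)) (matrix_unit i j)) = X"
    for X :: "'a::comm_complex_algebra_1^'n^'n"
  proof -
    have "(\<Sum>j\<in>UNIV. (if r = i \<and> c = j then 1 else 0) *\<^sub>C (X $ i $ j)) = (if i = r then X $ i $ c else 0)"
      for r c i
    proof -
      have "(if r = i \<and> c = j then 1 else 0) *\<^sub>C (X $ i $ j) = (if j = c then if i = r then X $ i $ j else 0 else 0)"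
        for j
        by (simp add: scaleC_zero_left scaleC_one)
      then show ?thesis by simp
    qed
    then have "(\<Sum>i\<in>UNIV. \<Sum>j\<in>UNIV. (if r = i \<and> c = j then 1 else 0) *\<^sub>C (X $ i $ j)) = X $ r $ c"
      for r c
      by simp
    then show ?thesis
      by (simp add: vec_eq_iff map_matrix_def matrix_unit_def)
  qed
  have 2: "map_matrix (\<lambda>c. c *\<^sub>C (a::'a)) 0 = 0" for a
    by (simp add: vec_eq_iff map_matrix_def scaleC_zero_left)
  show ?thesis
    by (simp add: prod_eq_iff fst_sum snd_sum q_tensor_def 1 2 sum.distrib)
qed

lemma sum_UNIV_sum: "(\<Sum>k\<in>(UNIV::('n::finite + 'n) set). f k) = (\<Sum>i\<in>UNIV. f (Inl i)) + (\<Sum>i\<in>UNIV. f (Inr i))"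
proof -
  have "range Inl \<inter> range Inr = ({} :: ('n + 'n) set)" by auto
  then show ?thesis
    unfolding UNIV_sum by (subst sum.union_disjoint) (auto simp: sum.reindex)
qed

lemma block_q_bracket:
  assumes "x \<in> q_part p" "y \<in> q_part r"
  shows "block (q_bracket x y) =
    block x ** block y - map_matrix ((*\<^sub>C) (super_sign p r)) (block y ** block x)"
proof -
  have m: "(- 1) *\<^sub>C a = - a" for a :: 'a
    by (simp add: scaleC_minus_left scaleC_one)
  show ?thesis
    using assms
    by (cases p; cases r)
       (auto simp: vec_eq_iff block_def q_bracket_def q_part_def super_sign_def matrix_matrix_mult_def
         map_matrix_def sum_UNIV_sum scaleC_one m split: sum.splits)
qed


section \<open>The local Weyl module is a supermodule generated by its generators\<close>

lemma lookup_free_scale: "Poly_Mapping.lookup (free_scale c f) b = c * Poly_Mapping.lookup f b"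
  by (simp add: free_scale_def Poly_Mapping.map.rep_eq when_def)

global_interpretation free: vector_space free_scale
  by standard (auto intro!: poly_mapping_eqI simp: lookup_free_scale lookup_add algebra_simps)

lemma free_act_superset:
  assumes "finite B" "Poly_Mapping.keys f \<subseteq> B"
  shows "free_act x f = (\<Sum>b\<in>B. free_scale (Poly_Mapping.lookup f b) (word (x # fst b) (snd b)))"
  unfolding free_act_def using assms
  by (intro sum.mono_neutral_left) (auto simp: in_keys_iff)

lemma free_act_add: "free_act x (f + g) = free_act x f + free_act x g"
  by (subst (1 2 3) free_act_superset[where B = "Poly_Mapping.keys f \<union> Poly_Mapping.keys g"])
     (use Poly_Mapping.keys_add[of f g] in \<open>auto simp: lookup_add free.scale_left_distrib sum.distrib\<close>)

lemma free_act_scale: "free_act x (free_scale c f) = free_scale c (free_act x f)"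
  by (subst (1 2) free_act_superset[where B = "Poly_Mapping.keys f"])
     (auto simp: lookup_free_scale free.scale_sum_right in_keys_iff)

lemma free_act_zero [simp]: "free_act x 0 = 0"
  by (simp add: free_act_def)

lemma free_act_word [simp]: "free_act x (word u w) = word (x # u) w"
  by (simp add: free_act_def word_def)

lemma free_act_diff: "free_act x (f - g) = free_act x f - free_act x g"
  by (metis add_diff_cancel diff_add_cancel free_act_add)

lemma free_act_weyl_relators:
  assumes "f \<in> weyl_relators \<psi> H"
  shows "free_act x f \<in> weyl_relators \<psi> H"
  using assms
proof cases
  case (act_add w u y z v)
  then show ?thesis
    using weyl_relators.act_add[of w H "x # u" y z v \<psi>] by (simp add: free_act_diff free_act_add)
next
  case (act_scale w u c y v)
  then show ?thesis
    using weyl_relators.act_scale[of w H "x # u" c y v \<psi>] by (simp add: free_act_diff free_act_scale)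
next
  case (act_bracket w y p z r u v)
  then show ?thesis
    using weyl_relators.act_bracket[of w H y p z r "x # u" v \<psi>]
    by (simp add: free_act_diff free_act_scale)
next
  case (gen_add w w' u)
  then show ?thesis
    using weyl_relators.gen_add[of w H w' "x # u" \<psi>] by (simp add: free_act_diff)
next
  case (gen_scale w u c)
  then show ?thesis
    using weyl_relators.gen_scale[of w H "x # u" c \<psi>] by (simp add: free_act_diff free_act_scale)
next
  case (gen_act w y u)
  then show ?thesis
    using weyl_relators.gen_act[of w H y "x # u" \<psi>] by (simp add: free_act_diff)
next
  case (rel_n w y u)
  then show ?thesis
    using weyl_relators.rel_n[of w H y "x # u" \<psi>] by simp
next
  case (rel_h w y u)
  then show ?thesis
    using weyl_relators.rel_h[of w H y "x # u" \<psi>] by (simp add: free_act_diff free_act_scale)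
next
  case (rel_f w i j m u)
  then show ?thesis
    using weyl_relators.rel_f[of w H i j m \<psi> "x # u"] by simp
qed

lemma free_act_span:
  assumes "f \<in> Modules.module.span free_scale S"
    and "\<And>s. s \<in> S \<Longrightarrow> free_act x s \<in> Modules.module.span free_scale T"
  shows "free_act x f \<in> Modules.module.span free_scale T"
  using assms(1)
proof (induction rule: free.span_induct_alt)
  case base
  then show ?case by (simp add: free.span_zero)
next
  case (step c s y)
  then show ?case
    by (simp add: free_act_add free_act_scale free.span_add free.span_scale assms(2))
qed

lemma free_act_weyl_relations:
  "f \<in> weyl_relations \<psi> H \<Longrightarrow> free_act x f \<in> weyl_relations \<psi> H"
  unfolding weyl_relations_def
  by (erule free_act_span) (simp add: free.span_base free_act_weyl_relators)

lemma weyl_relations_closed: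
  "0 \<in> weyl_relations \<psi> H"
  "f \<in> weyl_relations \<psi> H \<Longrightarrow> g \<in> weyl_relations \<psi> H \<Longrightarrow> f + g \<in> weyl_relations \<psi> H"
  "f \<in> weyl_relations \<psi> H \<Longrightarrow> g \<in> weyl_relations \<psi> H \<Longrightarrow> f - g \<in> weyl_relations \<psi> H"
  "f \<in> weyl_relations \<psi> H \<Longrightarrow> free_scale c f \<in> weyl_relations \<psi> H"
  unfolding weyl_relations_def
  by (auto intro: free.span_zero free.span_add free.span_diff free.span_scale)

lemma weyl_class_eq_iff: "weyl_class \<psi> H f = weyl_class \<psi> H g \<longleftrightarrow> f - g \<in> weyl_relations \<psi> H"
proof
  assume "weyl_class \<psi> H f = weyl_class \<psi> H g"
  moreover have "f \<in> weyl_class \<psi> H f" by (simp add: weyl_class_def weyl_relations_closed)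
  ultimately show "f - g \<in> weyl_relations \<psi> H" by (simp add: weyl_class_def)
next
  assume *: "f - g \<in> weyl_relations \<psi> H"
  have "h - f \<in> weyl_relations \<psi> H \<longleftrightarrow> h - g \<in> weyl_relations \<psi> H" for h
    using weyl_relations_closed(2)[OF _ *, of "h - f"] weyl_relations_closed(3)[OF _ *, of "h - g"]
    by (auto simp: algebra_simps)
  then show "weyl_class \<psi> H f = weyl_class \<psi> H g" by (simp add: weyl_class_def)
qed

lemma in_weyl_class: "g \<in> weyl_class \<psi> H f \<longleftrightarrow> weyl_class \<psi> H g = weyl_class \<psi> H f"
  by (simp add: weyl_class_eq_iff) (simp add: weyl_class_def)

lemma weyl_class_self: "f \<in> weyl_class \<psi> H f"
  by (simp add: in_weyl_class)

lemma local_weyl_add: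
  "add (local_weyl \<psi> H) (weyl_class \<psi> H f) (weyl_class \<psi> H g) = weyl_class \<psi> H (f + g)"
proof -
  have "weyl_class \<psi> H (f' + g') = weyl_class \<psi> H (f + g)"
    if "f' \<in> weyl_class \<psi> H f" "g' \<in> weyl_class \<psi> H g" for f' g'
    using that weyl_relations_closed(2)[of "f' - f" \<psi> H "g' - g"]
    by (simp add: weyl_class_eq_iff) (simp add: weyl_class_def algebra_simps)
  then have "(\<Union>f'\<in>weyl_class \<psi> H f. \<Union>g'\<in>weyl_class \<psi> H g. weyl_class \<psi> H (f' + g'))
      = (\<Union>f'\<in>weyl_class \<psi> H f. \<Union>g'\<in>weyl_class \<psi> H g. weyl_class \<psi> H (f + g))"
    by (intro SUP_cong refl)
  also have "\<dots> = weyl_class \<psi> H (f + g)"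
    using weyl_class_self by (metis SUP_const empty_iff)
  finally show ?thesis
    by (simp only: local_weyl_def ring.simps)
qed

lemma local_weyl_smult:
  "smult (local_weyl \<psi> H) c (weyl_class \<psi> H f) = weyl_class \<psi> H (free_scale c f)"
proof -
  have "weyl_class \<psi> H (free_scale c f') = weyl_class \<psi> H (free_scale c f)"
    if "f' \<in> weyl_class \<psi> H f" for f'
    using that weyl_relations_closed(4)[of "f' - f" \<psi> H c]
    by (simp add: weyl_class_eq_iff) (simp add: weyl_class_def free.scale_right_diff_distrib)
  then have "(\<Union>f'\<in>weyl_class \<psi> H f. weyl_class \<psi> H (free_scale c f'))
      = (\<Union>f'\<in>weyl_class \<psi> H f. weyl_class \<psi> H (free_scale c f))"
    by (intro SUP_cong refl)
  also have "\<dots> = weyl_class \<psi> H (free_scale c f)"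
    using weyl_class_self by (metis SUP_const empty_iff)
  finally show ?thesis
    by (simp only: local_weyl_def module.simps)
qed

lemma local_weyl_act:
  "act (local_weyl \<psi> H) x (weyl_class \<psi> H f) = weyl_class \<psi> H (free_act x f)"
proof -
  have "weyl_class \<psi> H (free_act x f') = weyl_class \<psi> H (free_act x f)"
    if "f' \<in> weyl_class \<psi> H f" for f'
    using that free_act_weyl_relations[of "f' - f" \<psi> H x]
    by (simp add: weyl_class_eq_iff) (simp add: weyl_class_def free_act_diff)
  then have "(\<Union>f'\<in>weyl_class \<psi> H f. weyl_class \<psi> H (free_act x f'))
      = (\<Union>f'\<in>weyl_class \<psi> H f. weyl_class \<psi> H (free_act x f))"
    by (intro SUP_cong refl)
  also have "\<dots> = weyl_class \<psi> H (free_act x f)"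
    using weyl_class_self by (metis SUP_const empty_iff)
  finally show ?thesis
    by (simp only: local_weyl_def supermodule.simps)
qed

lemma field_complex_field: "field complex_field"
  by (unfold_locales; auto simp: Units_def algebra_simps intro: exI[of _ "- _"])
   (metis left_inverse mult.commute add.right_inverse)+

lemma vectorspace_local_weyl: "vectorspace complex_field (local_weyl \<psi> H)"
proof -
  let ?W = "local_weyl \<psi> H"
  let ?F = "Modules.module.span free_scale {word u w | u w. w \<in> carrier H}"
  have car: "carrier ?W = weyl_class \<psi> H ` ?F" "zero ?W = weyl_class \<psi> H 0"
    by (simp_all add: local_weyl_def)
  interpret K: field complex_field by (rule field_complex_field)
  have ag: "abelian_group ?W"
  proof (rule abelian_groupI)
    fix X assume "X \<in> carrier ?W"
    then obtain f where f: "f \<in> ?F" "X = weyl_class \<psi> H f" by (auto simp: car)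
    then have "weyl_class \<psi> H (- f) \<oplus>\<^bsub>?W\<^esub> X = zero ?W" "weyl_class \<psi> H (- f) \<in> carrier ?W"
      by (auto simp: car local_weyl_add free.span_neg)
    then show "\<exists>Y\<in>carrier ?W. Y \<oplus>\<^bsub>?W\<^esub> X = zero ?W" by blast
  qed (auto simp: car local_weyl_add algebra_simps free.span_zero free.span_add)
  have "Module.module complex_field ?W"
    by (intro Module.moduleI ag K.is_cring)
       (auto simp: car local_weyl_add local_weyl_smult free.span_scale algebra_simps
          free.scale_right_distrib free.scale_left_distrib)
  then show ?thesis
    by (intro vectorspace.intro K.field_axioms)
qed

lemma weyl_relations_relator: "f \<in> weyl_relators \<psi> H \<Longrightarrow> f \<in> weyl_relations \<psi> H"
  by (simp add: weyl_relations_def free.span_base)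

lemma free_act_relation_induct:
  assumes f: "f \<in> Modules.module.span free_scale {word u w | u w. w \<in> carrier H}"
    and words: "\<And>u w. w \<in> carrier H \<Longrightarrow> \<Phi> (word u w) \<in> weyl_relations \<psi> H"
    and lin: "\<Phi> 0 = 0" "\<And>c g h. \<Phi> (free_scale c g + h) = free_scale c (\<Phi> g) + \<Phi> h"
  shows "\<Phi> f \<in> weyl_relations \<psi> H"
  using f
proof (induction rule: free.span_induct_alt)
  case base
  then show ?case by (simp add: lin weyl_relations_closed)
next
  case (step c s y)
  then show ?case
    by (auto simp: lin intro!: weyl_relations_closed words)
qed

lemma local_weyl_act_axioms:
  assumes "f \<in> Modules.module.span free_scale {word u w | u w. w \<in> carrier H}"
  shows "free_act (x + y) f - free_act x f - free_act y f \<in> weyl_relations \<psi> H"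
    and "free_act (q_scale c x) f - free_scale c (free_act x f) \<in> weyl_relations \<psi> H"
    and "x \<in> q_part p \<Longrightarrow> y \<in> q_part r \<Longrightarrow>
      free_act (q_bracket x y) f
        - (free_act x (free_act y f) - free_scale (super_sign p r) (free_act y (free_act x f)))
        \<in> weyl_relations \<psi> H"
proof -
  note s = free_act_add free_act_scale free.scale_right_diff_distrib free.scale_right_distrib mult.commute
  show "free_act (x + y) f - free_act x f - free_act y f \<in> weyl_relations \<psi> H"
    by (rule free_act_relation_induct[OF assms])
       (use weyl_relators.act_add[of _ H "[]" x y _ \<psi>] in \<open>auto simp: s intro!: weyl_relations_relator\<close>)
  show "free_act (q_scale c x) f - free_scale c (free_act x f) \<in> weyl_relations \<psi> H"
    by (rule free_act_relation_induct[OF assms])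
       (use weyl_relators.act_scale[of _ H "[]" c x _ \<psi>] in \<open>auto simp: s intro!: weyl_relations_relator\<close>)
  show "free_act (q_bracket x y) f
        - (free_act x (free_act y f) - free_scale (super_sign p r) (free_act y (free_act x f)))
        \<in> weyl_relations \<psi> H" if "x \<in> q_part p" "y \<in> q_part r"
    by (rule free_act_relation_induct[OF assms])
       (use weyl_relators.act_bracket[of _ H x p y r "[]" _ \<psi>, OF _ that]
         in \<open>auto simp: s intro!: weyl_relations_relator\<close>)
qed

lemma free_act_homogeneous:
  assumes "x \<in> q_part p" "f \<in> Modules.module.span free_scale (homogeneous_words H r)"
  shows "free_act x f \<in> Modules.module.span free_scale (homogeneous_words H (p + r))"
proof (rule free_act_span[OF assms(2)])
  fix s assume "s \<in> homogeneous_words H r"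
  then obtain u w ps q where "s = word u w" "list_all2 (\<lambda>x s. x \<in> q_part s) u ps"
      "w \<in> part H q" "r = sum_list ps + q"
    by (auto simp: homogeneous_words_def)
  then have "free_act x s \<in> homogeneous_words H (p + r)"
    unfolding homogeneous_words_def using assms(1)
    by (auto intro!: exI[of _ "x # u"] exI[of _ w] exI[of _ "p # ps"] exI[of _ q] simp: add.assoc)
  then show "free_act x s \<in> Modules.module.span free_scale (homogeneous_words H (p + r))"
    by (rule free.span_base)
qed

lemma homogeneous_words_subset:
  assumes "\<And>p. part H p \<subseteq> carrier H"
  shows "Modules.module.span free_scale (homogeneous_words H p)
    \<subseteq> Modules.module.span free_scale {word u w | u w. w \<in> carrier H}"
  by (rule free.span_mono) (use assms in \<open>auto simp: homogeneous_words_def\<close>)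

lemma bit_add_self [simp]: "(p::bit) + p = 0" by (cases p) auto

lemma word_decomposition:
  fixes H :: "(('a::comm_complex_algebra_1, 'n::{finite,linorder}) queer, 'h) supermodule"
  assumes H: "\<And>p. part H p \<subseteq> carrier H"
    and dec: "\<forall>v\<in>carrier H. \<exists>v0\<in>part H 0. \<exists>v1\<in>part H 1. v = v0 \<oplus>\<^bsub>H\<^esub> v1"
    and w: "w \<in> carrier H"
  shows "\<exists>f0\<in>Modules.module.span free_scale (homogeneous_words H 0).
         \<exists>f1\<in>Modules.module.span free_scale (homogeneous_words H 1).
           word u w - (f0 + f1) \<in> weyl_relations \<psi> H"
proof (induction u)
  case Nil
  obtain w0 w1 where w01: "w0 \<in> part H 0" "w1 \<in> part H 1" "w = w0 \<oplus>\<^bsub>H\<^esub> w1"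
    using dec w by blast
  have "word [] w0 \<in> homogeneous_words H 0"
    unfolding homogeneous_words_def using w01 by (auto intro!: exI[of _ "[]"] exI[of _ w0] exI[of _ 0])
  moreover have "word [] w1 \<in> homogeneous_words H 1"
    unfolding homogeneous_words_def using w01 by (auto intro!: exI[of _ "[]"] exI[of _ w1] exI[of _ 1])
  moreover have "word [] w - (word [] w0 + word [] w1) \<in> weyl_relations \<psi> H"
    using weyl_relators.gen_add[of w0 H w1 "[]" \<psi>] w01 H
    by (auto simp: diff_diff_eq intro!: weyl_relations_relator)
  ultimately show ?case by (meson free.span_base)
next
  case (Cons x u)
  then obtain f0 f1 where f0: "f0 \<in> Modules.module.span free_scale (homogeneous_words H 0)"
      and f1: "f1 \<in> Modules.module.span free_scale (homogeneous_words H 1)"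
      and f: "word u w - (f0 + f1) \<in> weyl_relations \<psi> H"
    by blast
  define x0 x1 where "x0 = (fst x, 0 :: (('a, 'n) vec, 'n) vec)" and "x1 = (0 :: (('a, 'n) vec, 'n) vec, snd x)"
  have x: "x = x0 + x1" "x0 \<in> q_part 0" "x1 \<in> q_part 1"
    by (auto simp: x0_def x1_def q_part_def)
  define g0 g1 where "g0 = free_act x0 f0 + free_act x1 f1" and "g1 = free_act x0 f1 + free_act x1 f0"
  have "g0 \<in> Modules.module.span free_scale (homogeneous_words H 0)"
    unfolding g0_def
    using free_act_homogeneous[OF x(2) f0] free_act_homogeneous[OF x(3) f1]
    by (auto intro: free.span_add)
  moreover have "g1 \<in> Modules.module.span free_scale (homogeneous_words H 1)"
    unfolding g1_def
    using free_act_homogeneous[OF x(2) f1] free_act_homogeneous[OF x(3) f0]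
    by (auto intro: free.span_add)
  moreover have "word (x # u) w - (g0 + g1) \<in> weyl_relations \<psi> H"
  proof -
    have "f0 + f1 \<in> Modules.module.span free_scale {word u w | u w. w \<in> carrier H}"
      using homogeneous_words_subset[OF H] f0 f1 by (meson free.span_add subsetD)
    from local_weyl_act_axioms(1)[OF this, of x0 x1 \<psi>] free_act_weyl_relations[OF f, of x]
    have "(free_act x (word u w - (f0 + f1)))
        + (free_act (x0 + x1) (f0 + f1) - free_act x0 (f0 + f1) - free_act x1 (f0 + f1)) \<in> weyl_relations \<psi> H"
      by (rule weyl_relations_closed(2)[rotated])
    moreover have "(free_act x (word u w - (f0 + f1)))
        + (free_act (x0 + x1) (f0 + f1) - free_act x0 (f0 + f1) - free_act x1 (f0 + f1))
        = word (x # u) w - (g0 + g1)"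
      unfolding x(1)[symmetric] g0_def g1_def by (simp add: free_act_diff free_act_add)
    ultimately show ?thesis by simp
  qed
  ultimately show ?case by blast
qed

lemma free_decomposition:
  assumes H: "\<And>p. part H p \<subseteq> carrier H"
    and dec: "\<forall>v\<in>carrier H. \<exists>v0\<in>part H 0. \<exists>v1\<in>part H 1. v = v0 \<oplus>\<^bsub>H\<^esub> v1"
    and f: "f \<in> Modules.module.span free_scale {word u w | u w. w \<in> carrier H}"
  shows "\<exists>f0\<in>Modules.module.span free_scale (homogeneous_words H 0).
         \<exists>f1\<in>Modules.module.span free_scale (homogeneous_words H 1).
           f - (f0 + f1) \<in> weyl_relations \<psi> H"
  using f
proof (induction rule: free.span_induct_alt)
  case base
  then show ?case
    by (auto intro!: bexI[of _ 0] simp: free.span_zero weyl_relations_closed)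
next
  case (step c s y)
  then obtain u w where s: "s = word u w" "w \<in> carrier H" by blast
  obtain f0 f1 where f0: "f0 \<in> Modules.module.span free_scale (homogeneous_words H 0)"
      and f1: "f1 \<in> Modules.module.span free_scale (homogeneous_words H 1)"
      and f: "s - (f0 + f1) \<in> weyl_relations \<psi> H"
    using word_decomposition[OF H dec s(2)] s(1) by blast
  obtain g0 g1 where g0: "g0 \<in> Modules.module.span free_scale (homogeneous_words H 0)"
      and g1: "g1 \<in> Modules.module.span free_scale (homogeneous_words H 1)"
      and g: "y - (g0 + g1) \<in> weyl_relations \<psi> H"
    using step by blast
  have "free_scale c s + y - ((free_scale c f0 + g0) + (free_scale c f1 + g1)) \<in> weyl_relations \<psi> H"
    using weyl_relations_closed(2)[OF weyl_relations_closed(4)[OF f, of c] g]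
    by (simp add: algebra_simps free.scale_right_diff_distrib free.scale_right_distrib)
  moreover have "free_scale c f0 + g0 \<in> Modules.module.span free_scale (homogeneous_words H 0)"
      "free_scale c f1 + g1 \<in> Modules.module.span free_scale (homogeneous_words H 1)"
    using f0 f1 g0 g1 by (auto intro: free.span_add free.span_scale)
  ultimately show ?case by blast
qed

text \<open>
  The parity involution of the free module preserves the relations; it separates the even
  part of the quotient from the odd part.
\<close>

definition q_inv :: "('a::comm_complex_algebra_1, 'n::finite) queer \<Rightarrow> ('a, 'n) queer" where
  "q_inv x = (fst x, - snd x)"

definition free_inv ::
  "('h \<Rightarrow> 'h) \<Rightarrow> ('a::comm_complex_algebra_1, 'n::finite, 'h) free_module \<Rightarrow> ('a, 'n, 'h) free_module" where
  "free_inv s f = (\<Sum>b\<in>Poly_Mapping.keys f.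
     free_scale (Poly_Mapping.lookup f b) (word (map q_inv (fst b)) (s (snd b))))"

lemma free_inv_superset:
  assumes "finite B" "Poly_Mapping.keys f \<subseteq> B"
  shows "free_inv s f = (\<Sum>b\<in>B. free_scale (Poly_Mapping.lookup f b) (word (map q_inv (fst b)) (s (snd b))))"
  unfolding free_inv_def using assms
  by (intro sum.mono_neutral_left) (auto simp: in_keys_iff)

lemma free_inv_add: "free_inv s (f + g) = free_inv s f + free_inv s g"
  by (subst (1 2 3) free_inv_superset[where B = "Poly_Mapping.keys f \<union> Poly_Mapping.keys g"])
     (use Poly_Mapping.keys_add[of f g] in \<open>auto simp: lookup_add free.scale_left_distrib sum.distrib\<close>)

lemma free_inv_scale: "free_inv s (free_scale c f) = free_scale c (free_inv s f)"
  by (subst (1 2) free_inv_superset[where B = "Poly_Mapping.keys f"])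
     (auto simp: lookup_free_scale free.scale_sum_right in_keys_iff)

lemma free_inv_zero [simp]: "free_inv s 0 = 0"
  by (simp add: free_inv_def)

lemma free_inv_diff: "free_inv s (f - g) = free_inv s f - free_inv s g"
  by (metis add_diff_cancel diff_add_cancel free_inv_add)

lemma free_inv_word [simp]: "free_inv s (word u w) = word (map q_inv u) (s w)"
  by (simp add: free_inv_def word_def)

lemma matrix_minus: "(- X) ** Y = - (X ** Y)" "X ** (- Y) = - (X ** Y)"
  for X Y :: "'a::comm_ring_1^'n::finite^'n"
  by (simp_all add: vec_eq_iff matrix_matrix_mult_def sum_negf)

lemma scaleC_zero_right: "c *\<^sub>C (0::'a::comm_complex_algebra_1) = 0"
  using scaleC_add_right[of c 0 0] by simp

lemma scaleC_minus_right: "c *\<^sub>C (- a) = - (c *\<^sub>C (a::'a::comm_complex_algebra_1))"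
  using scaleC_add_right[of c "-a" a] by (simp add: scaleC_zero_right eq_neg_iff_add_eq_0)

lemma q_inv_simps:
  "q_inv (x + y) = q_inv x + q_inv y"
  "q_inv (q_scale c x) = q_scale c (q_inv x)"
  "q_inv (q_bracket x y) = q_bracket (q_inv x) (q_inv y)"
  "q_inv x \<in> q_part p \<longleftrightarrow> x \<in> q_part p"
  "q_inv x \<in> hA \<longleftrightarrow> x \<in> hA"
  "q_inv x \<in> nA \<longleftrightarrow> x \<in> nA"
  "q_inv (f_elem i j) = f_elem i j"
  by (auto simp: q_inv_def prod_eq_iff q_scale_def q_bracket_def q_part_def hA_def nA_def f_elem_def
    q_tensor_def matrix_minus map_matrix_def vec_eq_iff scaleC_minus_right scaleC_zero_left)

lemma q_inv_h0A: "x \<in> h0A \<Longrightarrow> q_inv x = x"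
  by (auto simp: h0A_def q_inv_def q_part_def prod_eq_iff)

lemma q_inv_part: "x \<in> q_part p \<Longrightarrow> q_inv x = q_scale (if p = 0 then 1 else -1) x"
  by (auto simp: q_part_def q_inv_def q_scale_def prod_eq_iff map_matrix_def vec_eq_iff scaleC_one
    scaleC_minus_left scaleC_zero_right split: if_splits)

lemma free_inv_weyl_relators:
  assumes f: "f \<in> weyl_relators \<psi> H"
    and s: "\<And>w. w \<in> carrier H \<Longrightarrow> s w \<in> carrier H"
      "\<And>w w'. w \<in> carrier H \<Longrightarrow> w' \<in> carrier H \<Longrightarrow> s (w \<oplus>\<^bsub>H\<^esub> w') = s w \<oplus>\<^bsub>H\<^esub> s w'"
      "\<And>c w. w \<in> carrier H \<Longrightarrow> s (c \<odot>\<^bsub>H\<^esub> w) = c \<odot>\<^bsub>H\<^esub> s w"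
      "\<And>x w. x \<in> hA \<Longrightarrow> w \<in> carrier H \<Longrightarrow> s (act H x w) = act H (q_inv x) (s w)"
  shows "free_inv s f \<in> weyl_relators \<psi> H"
  using f
proof cases
  case (act_add w u y z v)
  then show ?thesis
    using weyl_relators.act_add[of "s w" H "map q_inv u" "q_inv y" "q_inv z" "map q_inv v" \<psi>] s
    by (simp add: free_inv_diff q_inv_simps)
next
  case (act_scale w u c y v)
  then show ?thesis
    using weyl_relators.act_scale[of "s w" H "map q_inv u" c "q_inv y" "map q_inv v" \<psi>] s
    by (simp add: free_inv_diff free_inv_scale q_inv_simps)
next
  case (act_bracket w y p z r u v)
  then show ?thesis
    using weyl_relators.act_bracket[of "s w" H "q_inv y" p "q_inv z" r "map q_inv u" "map q_inv v" \<psi>] s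
    by (simp add: free_inv_diff free_inv_scale q_inv_simps)
next
  case (gen_add w w' u)
  then show ?thesis
    using weyl_relators.gen_add[of "s w" H "s w'" "map q_inv u" \<psi>] s by (simp add: free_inv_diff)
next
  case (gen_scale w u c)
  then show ?thesis
    using weyl_relators.gen_scale[of "s w" H "map q_inv u" c \<psi>] s
    by (simp add: free_inv_diff free_inv_scale)
next
  case (gen_act w y u)
  then show ?thesis
    using weyl_relators.gen_act[of "s w" H "q_inv y" "map q_inv u" \<psi>] s
    by (simp add: free_inv_diff q_inv_simps)
next
  case (rel_n w y u)
  then show ?thesis
    using weyl_relators.rel_n[of "s w" H "q_inv y" "map q_inv u" \<psi>] s by (simp add: q_inv_simps)
next
  case (rel_h w y u)
  then show ?thesis
    using weyl_relators.rel_h[of "s w" H y "map q_inv u" \<psi>] s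
    by (simp add: free_inv_diff free_inv_scale q_inv_h0A)
next
  case (rel_f w i j m u)
  then show ?thesis
    using weyl_relators.rel_f[of "s w" H i j m \<psi> "map q_inv u"] s
    by (simp add: q_inv_simps map_replicate_const)
qed

lemma free_inv_weyl_relations:
  assumes "f \<in> weyl_relations \<psi> H"
    and "\<And>w. w \<in> carrier H \<Longrightarrow> s w \<in> carrier H"
      "\<And>w w'. w \<in> carrier H \<Longrightarrow> w' \<in> carrier H \<Longrightarrow> s (w \<oplus>\<^bsub>H\<^esub> w') = s w \<oplus>\<^bsub>H\<^esub> s w'"
      "\<And>c w. w \<in> carrier H \<Longrightarrow> s (c \<odot>\<^bsub>H\<^esub> w) = c \<odot>\<^bsub>H\<^esub> s w"
      "\<And>x w. x \<in> hA \<Longrightarrow> w \<in> carrier H \<Longrightarrow> s (act H x w) = act H (q_inv x) (s w)"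
  shows "free_inv s f \<in> weyl_relations \<psi> H"
  using assms(1) unfolding weyl_relations_def
proof (induction rule: free.span_induct_alt)
  case base
  then show ?case by (simp add: free.span_zero)
next
  case (step c r y)
  then show ?case
    using free_inv_weyl_relators[OF step(1) assms(2-5)]
    by (simp add: free_inv_add free_inv_scale free.span_add free.span_scale free.span_base)
qed

lemma free_inv_homogeneous:
  assumes f: "f \<in> Modules.module.span free_scale (homogeneous_words H p)"
    and H: "\<And>p. part H p \<subseteq> carrier H"
    and s: "\<And>w r. w \<in> part H r \<Longrightarrow> s w = (if r = 0 then 1 else -1) \<odot>\<^bsub>H\<^esub> w"
  shows "free_inv s f - free_scale (if p = 0 then 1 else -1) f \<in> weyl_relations \<psi> H"
proof -
  define sg :: "bit \<Rightarrow> complex" where "sg r = (if r = 0 then 1 else -1)" for r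
  have sg: "sg (p + r) = sg p * sg r" for p r by (cases p; cases r) (auto simp: sg_def)
  have hom: "word (map q_inv u) (s w) - free_scale (sg (sum_list ps + r)) (word u w) \<in> weyl_relations \<psi> H"
    if "list_all2 (\<lambda>x s. x \<in> q_part s) u ps" "w \<in> part H r" for u ps w r
    using that(1)
  proof (induction u ps rule: list_all2_induct)
    case Nil
    have "w \<in> carrier H" using that(2) H by blast
    then show ?case
      using weyl_relators.gen_scale[of w H "[]" "sg r" \<psi>] s[OF that(2)]
      by (auto simp: sg_def intro!: weyl_relations_relator)
  next
    case (Cons x u p ps)
    let ?w = "word u w"
    have w: "?w \<in> Modules.module.span free_scale {word u w | u w. w \<in> carrier H}"
      using that(2) H by (intro free.span_base) auto
    have x: "q_inv x = q_scale (sg p) x"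
      using q_inv_part[OF Cons(1)] by (simp add: sg_def)
    have "free_act (q_inv x) (word (map q_inv u) (s w) - free_scale (sg (sum_list ps + r)) ?w)
        + free_scale (sg (sum_list ps + r)) (free_act (q_scale (sg p) x) ?w - free_scale (sg p) (free_act x ?w))
        \<in> weyl_relations \<psi> H"
      by (intro weyl_relations_closed(2,4) free_act_weyl_relations Cons local_weyl_act_axioms(2)[OF w])
    moreover have "sg (sum_list (p # ps) + r) = sg (sum_list ps + r) * sg p"
      using sg[of p "sum_list ps + r"] by (simp only: sum_list.Cons add.assoc mult.commute)
    ultimately show ?case
      by (simp only: list.map x free_act_diff free_act_scale free_act_word free.scale_right_diff_distrib
          free.scale_scale diff_add_cancel add_diff_eq)
  qed
  have "free_inv s f - free_scale (sg p) f \<in> weyl_relations \<psi> H"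
    using f
  proof (induction rule: free.span_induct_alt)
    case base
    then show ?case by (simp add: weyl_relations_closed)
  next
    case (step c t y)
    then have t: "free_inv s t - free_scale (sg p) t \<in> weyl_relations \<psi> H"
      using hom by (auto simp: homogeneous_words_def)
    from weyl_relations_closed(2)[OF weyl_relations_closed(4)[OF t, of c] step(2)]
    show ?case
      by (simp add: free_inv_add free_inv_scale free.scale_right_diff_distrib free.scale_right_distrib
        algebra_simps)
  qed
  then show ?thesis by (simp add: sg_def)
qed

lemma subspaceI_complex:
  assumes "vectorspace complex_field M" "N \<subseteq> carrier M" "\<zero>\<^bsub>M\<^esub> \<in> N"
    and "\<And>v w. v \<in> N \<Longrightarrow> w \<in> N \<Longrightarrow> v \<oplus>\<^bsub>M\<^esub> w \<in> N"
    and "\<And>c v. v \<in> N \<Longrightarrow> c \<odot>\<^bsub>M\<^esub> v \<in> N"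
  shows "VectorSpace.subspace complex_field N M"
  using assms
  by (auto intro!: VectorSpace.subspace.intro LinearCombinations.submodule.intro
    simp: vectorspace_def)

lemma supermodule_involution:
  fixes H :: "(('a::comm_complex_algebra_1, 'n::finite) queer, 'h) supermodule"
  assumes "supermodule hA H"
  obtains s where
    "\<And>w. w \<in> carrier H \<Longrightarrow> s w \<in> carrier H"
    "\<And>w w'. w \<in> carrier H \<Longrightarrow> w' \<in> carrier H \<Longrightarrow> s (w \<oplus>\<^bsub>H\<^esub> w') = s w \<oplus>\<^bsub>H\<^esub> s w'"
    "\<And>c w. w \<in> carrier H \<Longrightarrow> s (c \<odot>\<^bsub>H\<^esub> w) = c \<odot>\<^bsub>H\<^esub> s w"
    "\<And>x w. x \<in> hA \<Longrightarrow> w \<in> carrier H \<Longrightarrow> s (act H x w) = act H (q_inv x) (s w)"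
    "\<And>w r. w \<in> part H r \<Longrightarrow> s w = (if r = 0 then 1 else -1) \<odot>\<^bsub>H\<^esub> w"
proof -
  have vs: "vectorspace complex_field H"
    and sub: "\<And>p. VectorSpace.subspace complex_field (part H p) H"
    and int: "part H 0 \<inter> part H 1 = {\<zero>\<^bsub>H\<^esub>}"
    and dec: "\<forall>v\<in>carrier H. \<exists>v0\<in>part H 0. \<exists>v1\<in>part H 1. v = v0 \<oplus>\<^bsub>H\<^esub> v1"
    and lin: "\<And>x. x \<in> hA \<Longrightarrow> act H x \<in> LinearCombinations.module_hom complex_field H H"
    and add: "\<And>x y v. x \<in> hA \<Longrightarrow> y \<in> hA \<Longrightarrow> v \<in> carrier H \<Longrightarrow> act H (x + y) v = act H x v \<oplus>\<^bsub>H\<^esub> act H y v"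
    and scale: "\<And>c x v. x \<in> hA \<Longrightarrow> v \<in> carrier H \<Longrightarrow> act H (q_scale c x) v = c \<odot>\<^bsub>H\<^esub> act H x v"
    and par: "\<And>p r x v. x \<in> hA \<inter> q_part p \<Longrightarrow> v \<in> part H r \<Longrightarrow> act H x v \<in> part H (p + r)"
    using assms unfolding supermodule_def by blast+
  interpret V: vectorspace complex_field H by (rule vs)
  have pc: "part H p \<subseteq> carrier H" and p_add: "v \<in> part H p \<Longrightarrow> w \<in> part H p \<Longrightarrow> v \<oplus>\<^bsub>H\<^esub> w \<in> part H p"
    and p_sc: "v \<in> part H p \<Longrightarrow> c \<odot>\<^bsub>H\<^esub> v \<in> part H p" and p0: "\<zero>\<^bsub>H\<^esub> \<in> part H p" for p v w c
    using VectorSpace.subspace.submod[OF sub] by (auto simp: LinearCombinations.submodule_def)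
  have pcD: "v \<in> part H p \<Longrightarrow> v \<in> carrier H" for v p using pc by auto
  have smc: "v \<in> carrier H \<Longrightarrow> c \<odot>\<^bsub>H\<^esub> v \<in> carrier H" for v c using V.smult_closed[of c v] by simp
  have sm_r: "v \<in> carrier H \<Longrightarrow> w \<in> carrier H \<Longrightarrow> c \<odot>\<^bsub>H\<^esub> (v \<oplus>\<^bsub>H\<^esub> w) = c \<odot>\<^bsub>H\<^esub> v \<oplus>\<^bsub>H\<^esub> c \<odot>\<^bsub>H\<^esub> w" for v w c
    using V.smult_r_distr[of c v w] by simp
  have sm_a: "v \<in> carrier H \<Longrightarrow> (c * d) \<odot>\<^bsub>H\<^esub> v = c \<odot>\<^bsub>H\<^esub> (d \<odot>\<^bsub>H\<^esub> v)" for v c d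
    using V.smult_assoc1[of c d v] by simp
  have sm1: "v \<in> carrier H \<Longrightarrow> 1 \<odot>\<^bsub>H\<^esub> v = v" for v
    using V.smult_one[of v] by simp
  have sm_l: "v \<in> carrier H \<Longrightarrow> (c + d) \<odot>\<^bsub>H\<^esub> v = c \<odot>\<^bsub>H\<^esub> v \<oplus>\<^bsub>H\<^esub> d \<odot>\<^bsub>H\<^esub> v" for v c d
    using V.smult_l_distr[of c d v] by simp
  have sm0: "v \<in> carrier H \<Longrightarrow> 0 \<odot>\<^bsub>H\<^esub> v = \<zero>\<^bsub>H\<^esub>" for v
    using V.smult_l_null[of v] by simp
  define m where "m v = (-1) \<odot>\<^bsub>H\<^esub> v" for v
  have m_neg: "v \<in> carrier H \<Longrightarrow> v \<oplus>\<^bsub>H\<^esub> m v = \<zero>\<^bsub>H\<^esub>" for v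
    using sm_l[of v 1 "-1"] by (simp add: m_def sm1 sm0)
  have uniq: "a0 = b0 \<and> a1 = b1"
    if "a0 \<in> part H 0" "b0 \<in> part H 0" "a1 \<in> part H 1" "b1 \<in> part H 1" "a0 \<oplus>\<^bsub>H\<^esub> a1 = b0 \<oplus>\<^bsub>H\<^esub> b1"
    for a0 a1 b0 b1
  proof -
    have c: "a0 \<in> carrier H" "b0 \<in> carrier H" "a1 \<in> carrier H" "b1 \<in> carrier H"
        "m b0 \<in> carrier H" "m a1 \<in> carrier H"
      using that pcD by (auto simp: m_def smc)
    have "(a0 \<oplus>\<^bsub>H\<^esub> m b0) \<oplus>\<^bsub>H\<^esub> (a1 \<oplus>\<^bsub>H\<^esub> m a1) = (b0 \<oplus>\<^bsub>H\<^esub> m b0) \<oplus>\<^bsub>H\<^esub> (b1 \<oplus>\<^bsub>H\<^esub> m a1)"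
    proof -
      have "(a0 \<oplus>\<^bsub>H\<^esub> m b0) \<oplus>\<^bsub>H\<^esub> (a1 \<oplus>\<^bsub>H\<^esub> m a1) = (a0 \<oplus>\<^bsub>H\<^esub> a1) \<oplus>\<^bsub>H\<^esub> (m b0 \<oplus>\<^bsub>H\<^esub> m a1)"
        using c by (simp add: V.M.a_ac)
      also have "\<dots> = (b0 \<oplus>\<^bsub>H\<^esub> m b0) \<oplus>\<^bsub>H\<^esub> (b1 \<oplus>\<^bsub>H\<^esub> m a1)"
        unfolding that(5) using c by (simp add: V.M.a_ac)
      finally show ?thesis .
    qed
    then have e: "a0 \<oplus>\<^bsub>H\<^esub> m b0 = b1 \<oplus>\<^bsub>H\<^esub> m a1"
      using c by (simp add: m_neg)
    have "a0 \<oplus>\<^bsub>H\<^esub> m b0 \<in> part H 0" "b1 \<oplus>\<^bsub>H\<^esub> m a1 \<in> part H 1"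
      using that by (auto intro!: p_add simp: m_def p_sc)
    then have z: "a0 \<oplus>\<^bsub>H\<^esub> m b0 = \<zero>\<^bsub>H\<^esub>" "b1 \<oplus>\<^bsub>H\<^esub> m a1 = \<zero>\<^bsub>H\<^esub>"
      using int e by auto
    have "a0 = a0 \<oplus>\<^bsub>H\<^esub> (b0 \<oplus>\<^bsub>H\<^esub> m b0)" using c by (simp add: m_neg)
    also have "\<dots> = (a0 \<oplus>\<^bsub>H\<^esub> m b0) \<oplus>\<^bsub>H\<^esub> b0" using c by (simp add: V.M.a_ac)
    finally have "a0 = b0" using z c by simp
    have "b1 = b1 \<oplus>\<^bsub>H\<^esub> (a1 \<oplus>\<^bsub>H\<^esub> m a1)" using c by (simp add: m_neg)
    also have "\<dots> = (b1 \<oplus>\<^bsub>H\<^esub> m a1) \<oplus>\<^bsub>H\<^esub> a1" using c by (simp add: V.M.a_ac)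
    finally show ?thesis using z c \<open>a0 = b0\<close> by simp
  qed
  obtain d0 d1 where d: "\<And>v. v \<in> carrier H \<Longrightarrow> d0 v \<in> part H 0 \<and> d1 v \<in> part H 1 \<and> v = d0 v \<oplus>\<^bsub>H\<^esub> d1 v"
    using dec by metis
  define s where "s v = d0 v \<oplus>\<^bsub>H\<^esub> m (d1 v)" for v
  have s: "s (a0 \<oplus>\<^bsub>H\<^esub> a1) = a0 \<oplus>\<^bsub>H\<^esub> m a1" if "a0 \<in> part H 0" "a1 \<in> part H 1" for a0 a1
  proof -
    have "a0 \<oplus>\<^bsub>H\<^esub> a1 \<in> carrier H" using that pcD by auto
    from d[OF this] uniq[OF that(1) _ that(2)] show ?thesis unfolding s_def by metis
  qed
  have m_lin: "m (v \<oplus>\<^bsub>H\<^esub> w) = m v \<oplus>\<^bsub>H\<^esub> m w" "m (c \<odot>\<^bsub>H\<^esub> v) = c \<odot>\<^bsub>H\<^esub> m v" "m v \<in> carrier H"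
    if "v \<in> carrier H" "w \<in> carrier H" for v w c
    using that by (auto simp: m_def sm_r smc mult.commute simp flip: sm_a)
  have act_lin: "act H x (v \<oplus>\<^bsub>H\<^esub> w) = act H x v \<oplus>\<^bsub>H\<^esub> act H x w" "act H x (c \<odot>\<^bsub>H\<^esub> v) = c \<odot>\<^bsub>H\<^esub> act H x v"
    "act H x v \<in> carrier H"
    if "x \<in> hA" "v \<in> carrier H" "w \<in> carrier H" for x v w c
    using lin[OF that(1)] that by (auto simp: LinearCombinations.module_hom_def)
  show thesis
  proof (rule that)
    fix w assume w: "w \<in> carrier H"
    have dw: "d0 w \<in> part H 0" "d1 w \<in> part H 1" "w = d0 w \<oplus>\<^bsub>H\<^esub> d1 w" using d[OF w] by auto
    then have dc: "d0 w \<in> carrier H" "d1 w \<in> carrier H" using pcD by auto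
    then show sw: "s w \<in> carrier H" by (simp add: s_def m_lin)
    show "s (c \<odot>\<^bsub>H\<^esub> w) = c \<odot>\<^bsub>H\<^esub> s w" for c
    proof -
      have "c \<odot>\<^bsub>H\<^esub> w = c \<odot>\<^bsub>H\<^esub> d0 w \<oplus>\<^bsub>H\<^esub> c \<odot>\<^bsub>H\<^esub> d1 w"
        by (subst dw(3)) (simp add: sm_r dc)
      then have "s (c \<odot>\<^bsub>H\<^esub> w) = c \<odot>\<^bsub>H\<^esub> d0 w \<oplus>\<^bsub>H\<^esub> m (c \<odot>\<^bsub>H\<^esub> d1 w)"
        using s[of "c \<odot>\<^bsub>H\<^esub> d0 w" "c \<odot>\<^bsub>H\<^esub> d1 w"] dw by (simp add: p_sc)
      then show ?thesis using dc by (simp add: s_def m_lin sm_r)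
    qed
    show "s (w \<oplus>\<^bsub>H\<^esub> w') = s w \<oplus>\<^bsub>H\<^esub> s w'" if w': "w' \<in> carrier H" for w'
    proof -
      have dw': "d0 w' \<in> part H 0" "d1 w' \<in> part H 1" "w' = d0 w' \<oplus>\<^bsub>H\<^esub> d1 w'" using d[OF w'] by auto
      then have dc': "d0 w' \<in> carrier H" "d1 w' \<in> carrier H" using pcD by auto
      have "w \<oplus>\<^bsub>H\<^esub> w' = (d0 w \<oplus>\<^bsub>H\<^esub> d1 w) \<oplus>\<^bsub>H\<^esub> (d0 w' \<oplus>\<^bsub>H\<^esub> d1 w')"
        using dw(3) dw'(3) by metis
      also have "\<dots> = (d0 w \<oplus>\<^bsub>H\<^esub> d0 w') \<oplus>\<^bsub>H\<^esub> (d1 w \<oplus>\<^bsub>H\<^esub> d1 w')"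
        using dc dc' by (simp add: V.M.a_ac)
      finally have "s (w \<oplus>\<^bsub>H\<^esub> w') = (d0 w \<oplus>\<^bsub>H\<^esub> d0 w') \<oplus>\<^bsub>H\<^esub> m (d1 w \<oplus>\<^bsub>H\<^esub> d1 w')"
        using s[of "d0 w \<oplus>\<^bsub>H\<^esub> d0 w'" "d1 w \<oplus>\<^bsub>H\<^esub> d1 w'"] dw dw' by (simp add: p_add)
      then show ?thesis using dc dc' by (simp add: s_def m_lin V.M.a_ac)
    qed
    show "s (act H x w) = act H (q_inv x) (s w)" if x: "x \<in> hA" for x
    proof -
      define x0 x1 where "x0 = (fst x, 0 :: 'a^'n^'n)" and "x1 = (0 :: 'a^'n^'n, snd x)"
      have h: "x0 \<in> hA" "x1 \<in> hA" "q_scale (-1) x1 \<in> hA"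
        using x by (auto simp: x0_def x1_def hA_def q_scale_def map_matrix_def scaleC_zero_right)
      have xs: "x = x0 + x1" "x0 \<in> q_part 0" "x1 \<in> q_part 1"
        by (auto simp: x0_def x1_def q_part_def)
      have qx: "q_inv x = x0 + q_scale (-1) x1"
        by (auto simp: x0_def x1_def q_inv_def q_scale_def map_matrix_def vec_eq_iff prod_eq_iff
            scaleC_minus_left scaleC_one)
      let ?a = "act H x0 (d0 w)" and ?b = "act H x0 (d1 w)" and ?c = "act H x1 (d0 w)" and ?d = "act H x1 (d1 w)"
      have P: "?a \<in> part H 0" "?b \<in> part H 1" "?c \<in> part H 1" "?d \<in> part H 0"
        using par[of x0 0 "d0 w" 0] par[of x0 0 "d1 w" 1] par[of x1 1 "d0 w" 0] par[of x1 1 "d1 w" 1] dw h xs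
        by auto
      then have C: "?a \<in> carrier H" "?b \<in> carrier H" "?c \<in> carrier H" "?d \<in> carrier H"
        using pcD by auto
      have "act H x w = (?a \<oplus>\<^bsub>H\<^esub> ?d) \<oplus>\<^bsub>H\<^esub> (?b \<oplus>\<^bsub>H\<^esub> ?c)"
      proof -
        have "act H x w = act H x0 (d0 w \<oplus>\<^bsub>H\<^esub> d1 w) \<oplus>\<^bsub>H\<^esub> act H x1 (d0 w \<oplus>\<^bsub>H\<^esub> d1 w)"
          using add[OF h(1,2) w] xs(1) dw(3) by metis
        then show ?thesis using C dc h by (simp add: act_lin V.M.a_ac)
      qed
      then have 1: "s (act H x w) = (?a \<oplus>\<^bsub>H\<^esub> ?d) \<oplus>\<^bsub>H\<^esub> (m ?b \<oplus>\<^bsub>H\<^esub> m ?c)"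
        using s[of "?a \<oplus>\<^bsub>H\<^esub> ?d" "?b \<oplus>\<^bsub>H\<^esub> ?c"] P C by (simp add: p_add m_lin)
      have mm: "m (m ?d) = ?d" using C by (simp add: m_def sm1 flip: sm_a)
      have am: "act H y (m v) = m (act H y v)" if "y \<in> hA" "v \<in> carrier H" for y v
        using act_lin(2)[OF that that(2)] by (simp add: m_def)
      have "act H (q_inv x) (s w) = act H x0 (s w) \<oplus>\<^bsub>H\<^esub> m (act H x1 (s w))"
        unfolding qx using add[OF h(1,3) sw] scale[OF h(2) sw] by (simp add: m_def)
      also have "\<dots> = (?a \<oplus>\<^bsub>H\<^esub> m ?b) \<oplus>\<^bsub>H\<^esub> (m ?c \<oplus>\<^bsub>H\<^esub> ?d)"
        unfolding s_def using C dc h by (simp add: act_lin am m_lin mm)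
      finally show ?thesis using 1 C by (simp add: V.M.a_ac m_lin)
    qed
  next
    fix w r assume w: "w \<in> part H r"
    have wc: "w \<in> carrier H" using w pcD by auto
    have m0: "m \<zero>\<^bsub>H\<^esub> = \<zero>\<^bsub>H\<^esub>" using m_neg[of "\<zero>\<^bsub>H\<^esub>"] m_lin(3)[of "\<zero>\<^bsub>H\<^esub>" "\<zero>\<^bsub>H\<^esub>"] by simp
    show "s w = (if r = 0 then 1 else -1) \<odot>\<^bsub>H\<^esub> w"
    proof (cases "r = 0")
      case True
      then show ?thesis using s[of w "\<zero>\<^bsub>H\<^esub>"] w wc by (simp add: p0 m0 sm1)
    next
      case False
      then have "r = 1" by simp
      then show ?thesis using s[of "\<zero>\<^bsub>H\<^esub>" w] w wc by (simp add: p0) (simp add: m_def smc)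
    qed
  qed
qed

theorem supermodule_local_weyl:
  fixes H :: "(('a::comm_complex_algebra_1, 'n::{finite,linorder}) queer, 'h) supermodule"
  assumes H: "supermodule hA H"
  shows "supermodule UNIV (local_weyl \<psi> H)"
proof -
  let ?W = "local_weyl \<psi> H"
  let ?F = "Modules.module.span free_scale {word u w | u w. w \<in> carrier H} :: ('a, 'n, 'h) free_module set"
  let ?P = "\<lambda>p. Modules.module.span free_scale (homogeneous_words H p) :: ('a, 'n, 'h) free_module set"
  have W: "carrier ?W = weyl_class \<psi> H ` ?F" "zero ?W = weyl_class \<psi> H 0"
    "\<And>p. part ?W p = weyl_class \<psi> H ` ?P p"
    by (simp_all add: local_weyl_def)
  have "\<And>p. VectorSpace.subspace complex_field (part H p) H"
    and dec: "\<forall>v\<in>carrier H. \<exists>v0\<in>part H 0. \<exists>v1\<in>part H 1. v = v0 \<oplus>\<^bsub>H\<^esub> v1"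
    using H by (auto simp: supermodule_def)
  then have pc: "part H p \<subseteq> carrier H" for p
    using VectorSpace.subspace.submod LinearCombinations.submodule.subset by blast
  have PF: "?P p \<subseteq> ?F" for p by (rule homogeneous_words_subset[OF pc])
  have vs: "vectorspace complex_field ?W" by (rule vectorspace_local_weyl)
  then interpret V: vectorspace complex_field ?W .
  have aF: "free_act x f \<in> ?F" if "f \<in> ?F" for x f
    using that
  proof (rule free_act_span)
    fix g :: "('a, 'n, 'h) free_module" assume "g \<in> {word u w | u w. w \<in> carrier H}"
    then obtain u w where "g = word u w" "w \<in> carrier H" by blast
    then show "free_act x g \<in> ?F" by (intro free.span_base) auto
  qed
  have minus: "weyl_class \<psi> H f \<ominus>\<^bsub>?W\<^esub> weyl_class \<psi> H g = weyl_class \<psi> H (f - g)"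
    if "f \<in> ?F" "g \<in> ?F" for f g
  proof -
    have c: "weyl_class \<psi> H f \<in> carrier ?W" "weyl_class \<psi> H g \<in> carrier ?W" "weyl_class \<psi> H (- g) \<in> carrier ?W"
      using that by (auto simp: W free.span_neg)
    have "weyl_class \<psi> H (- g) \<oplus>\<^bsub>?W\<^esub> weyl_class \<psi> H g = \<zero>\<^bsub>?W\<^esub>"
      by (simp add: local_weyl_add W)
    then have "\<ominus>\<^bsub>?W\<^esub> weyl_class \<psi> H g = weyl_class \<psi> H (- g)"
      using c V.M.minus_equality by blast
    then show ?thesis by (simp add: V.M.minus_eq local_weyl_add)
  qed
  have int: "part ?W 0 \<inter> part ?W 1 = {\<zero>\<^bsub>?W\<^esub>}"
  proof -
    obtain s where s:
      "\<And>w. w \<in> carrier H \<Longrightarrow> s w \<in> carrier H"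
      "\<And>w w'. w \<in> carrier H \<Longrightarrow> w' \<in> carrier H \<Longrightarrow> s (w \<oplus>\<^bsub>H\<^esub> w') = s w \<oplus>\<^bsub>H\<^esub> s w'"
      "\<And>c w. w \<in> carrier H \<Longrightarrow> s (c \<odot>\<^bsub>H\<^esub> w) = c \<odot>\<^bsub>H\<^esub> s w"
      "\<And>x w. x \<in> hA \<Longrightarrow> w \<in> carrier H \<Longrightarrow> s (act H x w) = act H (q_inv x) (s w)"
      and sp: "\<And>w r. w \<in> part H r \<Longrightarrow> s w = (if r = 0 then 1 else -1) \<odot>\<^bsub>H\<^esub> w"
      by (rule supermodule_involution[OF H]) (rule that, assumption+)
    have "X = \<zero>\<^bsub>?W\<^esub>" if X: "X \<in> part ?W 0" "X \<in> part ?W 1" for X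
    proof -
      obtain f g where f: "f \<in> ?P 0" "X = weyl_class \<psi> H f" and g: "g \<in> ?P 1" "X = weyl_class \<psi> H g"
        using X unfolding W by blast
      then have fg: "f - g \<in> weyl_relations \<psi> H" by (metis weyl_class_eq_iff)
      have 1: "free_inv s f - f \<in> weyl_relations \<psi> H"
        using free_inv_homogeneous[OF f(1) pc sp, of \<psi>] by simp
      have 2: "free_inv s g + g \<in> weyl_relations \<psi> H"
        using free_inv_homogeneous[OF g(1) pc sp, of \<psi>] by simp
      have 3: "free_inv s f - free_inv s g \<in> weyl_relations \<psi> H"
        using free_inv_weyl_relations[OF fg s] by (simp add: free_inv_diff)
      have "(free_inv s f - free_inv s g) - (free_inv s f - f) + (free_inv s g + g) + (f - g) \<in> weyl_relations \<psi> H"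
        by (intro weyl_relations_closed 1 2 3 fg)
      then have "f + f \<in> weyl_relations \<psi> H" by (simp add: algebra_simps)
      then have "free_scale (1/2) (f + f) \<in> weyl_relations \<psi> H" by (rule weyl_relations_closed)
      moreover have "free_scale (1/2) (f + f) = f"
        by (intro poly_mapping_eqI) (simp add: lookup_free_scale lookup_add)
      ultimately show ?thesis by (simp add: f(2) W weyl_class_eq_iff)
    qed
    moreover have "\<zero>\<^bsub>?W\<^esub> \<in> part ?W p" for p by (simp add: W free.span_zero)
    ultimately show ?thesis by blast
  qed
  show ?thesis
    unfolding supermodule_def
  proof (intro conjI ballI allI)
    show "VectorSpace.subspace complex_field (part ?W p) ?W" for p
      by (rule subspaceI_complex[OF vs])
         (use PF[of p] in \<open>auto simp: W local_weyl_add local_weyl_smult free.span_zero free.span_add free.span_scale\<close>)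
    show "\<exists>v0\<in>part ?W 0. \<exists>v1\<in>part ?W 1. v = v0 \<oplus>\<^bsub>?W\<^esub> v1" if v: "v \<in> carrier ?W" for v
    proof -
      obtain f where f: "f \<in> ?F" "v = weyl_class \<psi> H f" using v by (auto simp: W)
      obtain f0 f1 where "f0 \<in> ?P 0" "f1 \<in> ?P 1" "f - (f0 + f1) \<in> weyl_relations \<psi> H"
        using free_decomposition[OF pc dec f(1)] by blast
      then show ?thesis
        by (intro bexI[of _ "weyl_class \<psi> H f0"] bexI[of _ "weyl_class \<psi> H f1"])
           (auto simp: W f(2) local_weyl_add weyl_class_eq_iff)
    qed
    show "act ?W x \<in> LinearCombinations.module_hom complex_field ?W ?W" for x
      by (auto simp: LinearCombinations.module_hom_def W local_weyl_act local_weyl_add local_weyl_smult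
          aF free_act_add free_act_scale)
    show "act ?W (x + y) v = act ?W x v \<oplus>\<^bsub>?W\<^esub> act ?W y v" if v: "v \<in> carrier ?W" for x y v
    proof -
      obtain f where f: "f \<in> ?F" "v = weyl_class \<psi> H f" using v by (auto simp: W)
      then show ?thesis
        using local_weyl_act_axioms(1)[OF f(1), of x y \<psi>]
        by (simp add: local_weyl_act local_weyl_add weyl_class_eq_iff diff_diff_eq)
    qed
    show "act ?W (q_scale c x) v = c \<odot>\<^bsub>?W\<^esub> act ?W x v" if v: "v \<in> carrier ?W" for c x v
    proof -
      obtain f where f: "f \<in> ?F" "v = weyl_class \<psi> H f" using v by (auto simp: W)
      then show ?thesis
        using local_weyl_act_axioms(2)[OF f(1), of c x \<psi>]
        by (simp add: local_weyl_act local_weyl_smult weyl_class_eq_iff)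
    qed
    show "act ?W x v \<in> part ?W (p + r)" if "x \<in> UNIV \<inter> q_part p" "v \<in> part ?W r" for p r x v
      using that free_act_homogeneous[of x p _ H r] by (auto simp: W local_weyl_act)
    show "act ?W (q_bracket x y) v =
          act ?W x (act ?W y v) \<ominus>\<^bsub>?W\<^esub> super_sign p r \<odot>\<^bsub>?W\<^esub> act ?W y (act ?W x v)"
      if "x \<in> UNIV \<inter> q_part p" "y \<in> UNIV \<inter> q_part r" and v: "v \<in> carrier ?W" for p r x y v
    proof -
      obtain f where f: "f \<in> ?F" "v = weyl_class \<psi> H f" using v by (auto simp: W)
      have "free_act x (free_act y f) \<in> ?F" "free_scale (super_sign p r) (free_act y (free_act x f)) \<in> ?F"
        using f by (auto intro!: aF free.span_scale)
      then show ?thesis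
        using local_weyl_act_axioms(3)[OF f(1), of x p y r \<psi>] that
        by (simp add: f(2) local_weyl_act local_weyl_smult minus weyl_class_eq_iff)
    qed
  qed (use vs int in auto)
qed


theorem local_weyl_generated:
  fixes H :: "(('a::comm_complex_algebra_1, 'n::{finite,linorder}) queer, 'h) supermodule"
  shows "generated_by UNIV (local_weyl \<psi> H) ((\<lambda>w. weyl_class \<psi> H (word [] w)) ` carrier H)"
proof -
  let ?W = "local_weyl \<psi> H"
  let ?F = "Modules.module.span free_scale {word u w | u w. w \<in> carrier H} :: ('a, 'n, 'h) free_module set"
  have W: "carrier ?W = weyl_class \<psi> H ` ?F" "zero ?W = weyl_class \<psi> H 0"
    by (simp_all add: local_weyl_def)
  have "U = carrier ?W"
    if U: "graded_submodule UNIV U ?W" "(\<lambda>w. weyl_class \<psi> H (word [] w)) ` carrier H \<subseteq> U" for U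
  proof
    have sub: "LinearCombinations.submodule complex_field U ?W"
      and act: "\<And>x v. v \<in> U \<Longrightarrow> act ?W x v \<in> U"
      using U(1) by (auto simp: graded_submodule_def VectorSpace.subspace_def)
    show "U \<subseteq> carrier ?W" using sub by (rule LinearCombinations.submodule.subset)
    have word: "weyl_class \<psi> H (word u w) \<in> U" if "w \<in> carrier H" for u w
    proof (induction u)
      case Nil
      then show ?case using U(2) that by blast
    next
      case (Cons x u)
      from act[OF this, of x] show ?case by (simp add: local_weyl_act)
    qed
    have "weyl_class \<psi> H f \<in> U" if "f \<in> ?F" for f
      using that
    proof (induction rule: free.span_induct_alt)
      case base
      then show ?case using sub by (simp add: LinearCombinations.submodule_def W)
    next
      case (step c s y)
      then obtain u w where s: "s = word u w" "w \<in> carrier H" by blast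
      have "c \<odot>\<^bsub>?W\<^esub> weyl_class \<psi> H s \<oplus>\<^bsub>?W\<^esub> weyl_class \<psi> H y \<in> U"
        using sub word[OF s(2), of u] step(2) s(1) by (simp add: LinearCombinations.submodule_def)
      then show ?case by (simp add: local_weyl_add local_weyl_smult)
    qed
    then show "carrier ?W \<subseteq> U" by (auto simp: W)
  qed
  moreover have "weyl_class \<psi> H (word [] w) \<in> carrier ?W" if "w \<in> carrier H" for w
    using that by (auto simp: W intro!: imageI free.span_base)
  ultimately show ?thesis by (auto simp: generated_by_def)
qed

end

theory Submission
  imports Defs
begin

text \<open>
  The local Weyl module is functorial in $H(\psi)$ and is universal among highest map-weight modules
  in which $f_i^{\lambda(h_i)+1}$ kills the generators, so two facts remain. In a finite-dimensional
  module the last relation is automatic: $\mathfrak{sl}_2$ theory gives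
  $e_i f_i^{k} w = k(\lambda(h_i)-k+1) f_i^{k-1} w$, and some power of $f_i$ kills \<open>w\<close> because the
  nonzero $f_i^k w$ are $h_i$-eigenvectors with distinct eigenvalues. And $H(\psi)$ is unique up to
  parity change: $\mathfrak h_{\bar 1} \otimes A$ acts through the Clifford algebra of a symmetric
  bilinear form of finite rank, whose radical acts by zero. Starting with any nonzero linear map
  between two choices of $H(\psi)$, one makes it commute with the elements of a finite orthogonal
  system one after the other, never letting it become zero, and concludes by Schur's lemma.
\<close>

section \<open>Complex vector spaces and supermodules\<close>

text \<open>Uniqueness of H(\<psi>) needs no classification of Clifford modules: one nonzero
  intertwiner is enough. The rank of the form is finite because of the ideal \<open>J\<close> in
  \<open>map_weights\<close>: the value of \<psi> on a bracket of two odd diagonal elements depends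
  on each of them only modulo \<open>J\<close>, so representatives spanning A/J, put in each
  diagonal place, determine it. The orthogonal vectors are normalised to act as involutions. This
  makes averaging over one of them possible, and their mutual anticommutation preserves the
  commutation relations already gained. The ambiguity up to parity arises in this argument alone:
  the initial map may need a shift to become even, and a later step may reverse parity. Odd maps are
  never introduced as such; each is an even map into a parity change. The relators of the local Weyl
  module do not see the grading of H(\<psi>), so the construction commutes with the parity shift and
  passes the ambiguity on unchanged.\<close>

locale complex_vectorspace =
  fixes M :: "(complex, 'v, 'm) module_scheme" (structure)
  assumes vectorspace: "vectorspace complex_field M"
begin

sublocale V: vectorspace complex_field M
  by (rule vectorspace)

lemma smult_in [simp]: "v \<in> carrier M \<Longrightarrow> c \<odot> v \<in> carrier M"
  using V.smult_closed[of c v] by simp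

lemma smult_add: "v \<in> carrier M \<Longrightarrow> w \<in> carrier M \<Longrightarrow> c \<odot> (v \<oplus> w) = c \<odot> v \<oplus> c \<odot> w"
  using V.smult_r_distr[of c v w] by simp

lemma add_smult: "v \<in> carrier M \<Longrightarrow> (c + d) \<odot> v = c \<odot> v \<oplus> d \<odot> v"
  using V.smult_l_distr[of c d v] by simp

lemma smult_smult: "v \<in> carrier M \<Longrightarrow> c \<odot> (d \<odot> v) = (c * d) \<odot> v"
  using V.smult_assoc1[of c d v] by simp

lemma one_smult [simp]: "v \<in> carrier M \<Longrightarrow> 1 \<odot> v = v"
  using V.smult_one[of v] by simp

lemma zero_smult [simp]: "v \<in> carrier M \<Longrightarrow> 0 \<odot> v = \<zero>"
  using V.smult_l_null[of v] by simp

lemma smult_zero [simp]: "c \<odot> \<zero> = \<zero>"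
  using V.smult_r_null[of c] by simp

lemma smult_minus: "v \<in> carrier M \<Longrightarrow> (- c) \<odot> v = \<ominus> (c \<odot> v)"
  using add_smult[of v "- c" c] by (simp add: V.M.minus_equality)

lemma minus_eq_smult: "v \<in> carrier M \<Longrightarrow> \<ominus> v = (-1) \<odot> v"
  by (simp add: smult_minus)

lemma diff_eq_smult: "w \<in> carrier M \<Longrightarrow> v \<ominus> w = v \<oplus> (-1) \<odot> w"
  by (simp add: V.M.minus_eq minus_eq_smult)

lemma smult_diff: "v \<in> carrier M \<Longrightarrow> w \<in> carrier M \<Longrightarrow> c \<odot> (v \<ominus> w) = c \<odot> v \<ominus> c \<odot> w"
  by (simp add: diff_eq_smult smult_add smult_smult)

lemma diff_smult: "v \<in> carrier M \<Longrightarrow> (c - d) \<odot> v = c \<odot> v \<ominus> d \<odot> v"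
  using add_smult[of v c "- d"] by (simp add: V.M.minus_eq smult_minus)

lemma smult_eq_zero_iff: "v \<in> carrier M \<Longrightarrow> c \<odot> v = \<zero> \<longleftrightarrow> c = 0 \<or> v = \<zero>"
proof
  assume v: "v \<in> carrier M" and c: "c \<odot> v = \<zero>"
  show "c = 0 \<or> v = \<zero>"
  proof (cases "c = 0")
    case False
    then have "v = inverse c \<odot> (c \<odot> v)" using v by (simp add: smult_smult)
    then show ?thesis using c by simp
  qed simp
qed auto

lemma diff_eq_zero_iff: "v \<in> carrier M \<Longrightarrow> w \<in> carrier M \<Longrightarrow> v \<ominus> w = \<zero> \<longleftrightarrow> v = w"
  by (metis V.M.minus_equality V.M.minus_eq V.M.minus_minus V.M.r_neg V.M.a_inv_closed)

lemma add_diff_cancel [simp]: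
  assumes "v \<in> carrier M" "w \<in> carrier M"
  shows "(v \<oplus> w) \<ominus> v = w" "(v \<oplus> w) \<ominus> w = v" "v \<ominus> v = \<zero>"
proof -
  show "(v \<oplus> w) \<ominus> v = w"
    using assms by (simp add: V.M.minus_eq V.M.a_comm[of "v \<oplus> w"] V.M.r_neg1)
  show "(v \<oplus> w) \<ominus> w = v" "v \<ominus> v = \<zero>"
    using assms by (simp_all add: V.M.minus_eq V.M.a_assoc V.M.r_neg)
qed

lemma subspace_closed:
  assumes "VectorSpace.subspace complex_field U M"
  shows "U \<subseteq> carrier M" "\<zero> \<in> U" "v \<in> U \<Longrightarrow> w \<in> U \<Longrightarrow> v \<oplus> w \<in> U" "v \<in> U \<Longrightarrow> c \<odot> v \<in> U"
    "v \<in> U \<Longrightarrow> w \<in> U \<Longrightarrow> v \<ominus> w \<in> U"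
proof -
  show *: "U \<subseteq> carrier M" "\<zero> \<in> U" "\<And>v w. v \<in> U \<Longrightarrow> w \<in> U \<Longrightarrow> v \<oplus> w \<in> U" "\<And>v c. v \<in> U \<Longrightarrow> c \<odot> v \<in> U"
    using VectorSpace.subspace.submod[OF assms] by (auto simp: LinearCombinations.submodule_def)
  then show "v \<in> U \<Longrightarrow> w \<in> U \<Longrightarrow> v \<ominus> w \<in> U"
    by (simp add: diff_eq_smult subsetD)
qed

lemmas subspaceI = subspaceI_complex[OF vectorspace]

text \<open>Applying \<open>h\<close> minus the scalar \<open>\<mu> x\<close> to a linear relation
  removes the term of \<open>x\<close> and multiplies every other coefficient by the nonzero number
  \<open>\<mu> v - \<mu> x\<close>, so induction on the support applies. The coefficients have to
  vary in this induction.\<close>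

lemma eigenvectors_lin_indpt:
  assumes h: "h \<in> LinearCombinations.module_hom complex_field M M"
    and B: "B \<subseteq> carrier M" "\<zero> \<notin> B"
    and eig: "\<And>v. v \<in> B \<Longrightarrow> h v = \<mu> v \<odot> v" and inj: "inj_on \<mu> B"
  shows "V.lin_indpt B"
proof -
  have h_in: "h v \<in> carrier M" and h_add: "h (v \<oplus> w) = h v \<oplus> h w" and h_smult: "h (c \<odot> v) = c \<odot> h v"
    if "v \<in> carrier M" "w \<in> carrier M" for v w c
    using h that by (auto simp: LinearCombinations.module_hom_def)
  have h0: "h \<zero> = \<zero>" using h_smult[of \<zero> \<zero> 0] h_in[of \<zero> \<zero>] by simp
  have sum: "a v = 0"
    if "finite F" "F \<subseteq> B" "(\<Oplus>v\<in>F. a v \<odot> v) = \<zero>" "v \<in> F" for F a v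
    using that
  proof (induction F arbitrary: a v rule: finite_induct)
    case (insert x F)
    have FB: "F \<subseteq> carrier M" "x \<in> carrier M" "x \<in> B" "x \<noteq> \<zero>" using insert.prems B by auto
    have h_sum: "h (\<Oplus>v\<in>G. a v \<odot> v) = (\<Oplus>v\<in>G. (a v * \<mu> v) \<odot> v)" if "finite G" "G \<subseteq> insert x F" for G
      using that
    proof (induction G rule: finite_induct)
      case (insert y G)
      then have "y \<in> carrier M" "G \<subseteq> carrier M" "y \<in> B" using FB \<open>insert x F \<subseteq> B\<close> by auto
      then show ?case using insert eig
        by (simp add: Pi_iff subset_iff V.M.finsum_insert h_add h_smult smult_smult)
    qed (simp add: h0)
    have smul_sum: "c \<odot> (\<Oplus>v\<in>G. b v \<odot> v) = (\<Oplus>v\<in>G. (c * b v) \<odot> v)" if "finite G" "G \<subseteq> carrier M" for c b G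
      using that by (induction G rule: finite_induct)
        (auto simp: Pi_iff subset_iff V.M.finsum_insert smult_add smult_smult)
    have add_sum: "(\<Oplus>v\<in>G. b v \<odot> v) \<oplus> (\<Oplus>v\<in>G. b' v \<odot> v) = (\<Oplus>v\<in>G. (b v + b' v) \<odot> v)"
      if "finite G" "G \<subseteq> carrier M" for b b' G
      using that by (induction G rule: finite_induct)
        (auto simp: Pi_iff subset_iff V.M.finsum_insert add_smult V.M.a_ac)
    have "(\<Oplus>v\<in>insert x F. (a v * (\<mu> v - \<mu> x)) \<odot> v)
        = h (\<Oplus>v\<in>insert x F. a v \<odot> v) \<oplus> (- \<mu> x) \<odot> (\<Oplus>v\<in>insert x F. a v \<odot> v)"
    proof -
      have i: "finite (insert x F)" "insert x F \<subseteq> carrier M" using insert.hyps FB by auto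
      show ?thesis
        unfolding h_sum[OF i(1) subset_refl] smul_sum[OF i] add_sum[OF i] by (simp add: algebra_simps)
    qed
    also have "\<dots> = \<zero>" unfolding insert.prems(2) by (simp add: h0)
    finally have "(a x * (\<mu> x - \<mu> x)) \<odot> x \<oplus> (\<Oplus>v\<in>F. (a v * (\<mu> v - \<mu> x)) \<odot> v) = \<zero>"
      using insert.hyps FB by (subst (asm) V.M.finsum_insert) auto
    then have s: "(\<Oplus>v\<in>F. (a v * (\<mu> v - \<mu> x)) \<odot> v) = \<zero>"
      using FB by (simp add: V.M.finsum_closed Pi_iff subset_iff)
    have aF: "a u = 0" if "u \<in> F" for u
    proof -
      have "a u * (\<mu> u - \<mu> x) = 0"
        using insert.IH[OF _ s that] insert.prems by blast
      moreover have "\<mu> u \<noteq> \<mu> x"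
        using inj that insert.hyps insert.prems by (auto dest: inj_onD)
      ultimately show ?thesis by simp
    qed
    have "(\<Oplus>v\<in>F. a v \<odot> v) = (\<Oplus>v\<in>F. \<zero>)"
      using aF FB by (intro V.M.finsum_cong') auto
    then have "a x \<odot> x = \<zero>"
      using insert.prems(2) insert.hyps FB by (simp add: V.M.finsum_insert Pi_iff subset_iff)
    then have "a x = 0" using FB by (simp add: smult_eq_zero_iff)
    then show ?case using aF insert.prems by auto
  qed simp
  show ?thesis
    unfolding V.lin_dep_def V.lincomb_def using sum by fastforce
qed

end

section \<open>Supermodules over a set of elements of the superalgebra\<close>

locale supermodule_over = complex_vectorspace M
  for S :: "('a::comm_complex_algebra_1, 'n::finite) queer set"
    and M :: "(('a, 'n) queer, 'v) supermodule" (structure) +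
  assumes supermodule: "supermodule S M"

lemma supermodule_overI: "supermodule S M \<Longrightarrow> supermodule_over S M"
  by (simp add: supermodule_over_def supermodule_over_axioms_def complex_vectorspace_def supermodule_def)

context supermodule_over
begin

lemma part_subspace: "VectorSpace.subspace complex_field (part M p) M"
  using supermodule by (auto simp: supermodule_def)

lemmas part_closed = subspace_closed[OF part_subspace]

lemma part_carrier: "v \<in> part M p \<Longrightarrow> v \<in> carrier M"
  using part_closed(1) by blast

lemma part_int: "v \<in> part M p \<Longrightarrow> v \<in> part M r \<Longrightarrow> p \<noteq> r \<Longrightarrow> v = \<zero>"
  using supermodule by (cases p; cases r) (auto simp: supermodule_def)

lemma part_decomposition:
  assumes "v \<in> carrier M"
  obtains v0 v1 where "v0 \<in> part M 0" "v1 \<in> part M 1" "v = v0 \<oplus> v1"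
proof -
  have "\<exists>v0\<in>part M 0. \<exists>v1\<in>part M 1. v = v0 \<oplus> v1"
    using supermodule assms by (simp add: supermodule_def)
  then show ?thesis using that by blast
qed

lemma part_sum_eq_zero:
  assumes "v \<in> part M 0" "w \<in> part M 1" "v \<oplus> w = \<zero>"
  shows "v = \<zero>" "w = \<zero>"
proof -
  have c: "v \<in> carrier M" "w \<in> carrier M" using assms part_carrier by auto
  then have "v = \<ominus> w" using assms(3) V.M.minus_equality by metis
  then have "v \<in> part M 1" using assms(2) c part_closed(4) by (simp add: minus_eq_smult)
  then show "v = \<zero>" using assms(1) part_int by force
  then show "w = \<zero>" using assms(3) c by simp
qed

lemma act_hom: "x \<in> S \<Longrightarrow> act M x \<in> LinearCombinations.module_hom complex_field M M"
  using supermodule by (simp add: supermodule_def)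

lemma act_in [simp]: "x \<in> S \<Longrightarrow> v \<in> carrier M \<Longrightarrow> act M x v \<in> carrier M"
  using act_hom[of x] by (auto simp: LinearCombinations.module_hom_def)

lemma act_add: "x \<in> S \<Longrightarrow> v \<in> carrier M \<Longrightarrow> w \<in> carrier M \<Longrightarrow> act M x (v \<oplus> w) = act M x v \<oplus> act M x w"
  using act_hom[of x] by (auto simp: LinearCombinations.module_hom_def)

lemma act_smult: "x \<in> S \<Longrightarrow> v \<in> carrier M \<Longrightarrow> act M x (c \<odot> v) = c \<odot> act M x v"
  using act_hom[of x] by (auto simp: LinearCombinations.module_hom_def)

lemma act_zero [simp]: "x \<in> S \<Longrightarrow> act M x \<zero> = \<zero>"
  using act_smult[of x \<zero> 0] by simp

lemma add_act: "x \<in> S \<Longrightarrow> y \<in> S \<Longrightarrow> v \<in> carrier M \<Longrightarrow> act M (x + y) v = act M x v \<oplus> act M y v"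
  using supermodule by (simp add: supermodule_def)

lemma scale_act: "x \<in> S \<Longrightarrow> v \<in> carrier M \<Longrightarrow> act M (q_scale c x) v = c \<odot> act M x v"
  using supermodule by (simp add: supermodule_def)

lemma act_part: "x \<in> S \<Longrightarrow> x \<in> q_part p \<Longrightarrow> v \<in> part M r \<Longrightarrow> act M x v \<in> part M (p + r)"
  using supermodule by (simp add: supermodule_def)

lemma act_bracket:
  "x \<in> S \<Longrightarrow> y \<in> S \<Longrightarrow> x \<in> q_part p \<Longrightarrow> y \<in> q_part r \<Longrightarrow> v \<in> carrier M \<Longrightarrow>
    act M (q_bracket x y) v = act M x (act M y v) \<ominus> super_sign p r \<odot> act M y (act M x v)"
  using supermodule by (simp add: supermodule_def)

end

section \<open>Homomorphisms\<close>

lemma hom_superD: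
  assumes "\<phi> \<in> hom_super S M N"
  shows "v \<in> carrier M \<Longrightarrow> \<phi> v \<in> carrier N"
    and "v \<in> carrier M \<Longrightarrow> w \<in> carrier M \<Longrightarrow> \<phi> (v \<oplus>\<^bsub>M\<^esub> w) = \<phi> v \<oplus>\<^bsub>N\<^esub> \<phi> w"
    and "v \<in> carrier M \<Longrightarrow> \<phi> (c \<odot>\<^bsub>M\<^esub> v) = c \<odot>\<^bsub>N\<^esub> \<phi> v"
    and "v \<in> part M p \<Longrightarrow> \<phi> v \<in> part N p"
    and "x \<in> S \<Longrightarrow> v \<in> carrier M \<Longrightarrow> \<phi> (act M x v) = act N x (\<phi> v)"
  using assms by (force simp: hom_super_def LinearCombinations.module_hom_def)+

lemma hom_superI:
  assumes "\<And>v. v \<in> carrier M \<Longrightarrow> \<phi> v \<in> carrier N"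
    and "\<And>v w. v \<in> carrier M \<Longrightarrow> w \<in> carrier M \<Longrightarrow> \<phi> (v \<oplus>\<^bsub>M\<^esub> w) = \<phi> v \<oplus>\<^bsub>N\<^esub> \<phi> w"
    and "\<And>c v. v \<in> carrier M \<Longrightarrow> \<phi> (c \<odot>\<^bsub>M\<^esub> v) = c \<odot>\<^bsub>N\<^esub> \<phi> v"
    and "\<And>p v. v \<in> part M p \<Longrightarrow> \<phi> v \<in> part N p"
    and "\<And>x v. x \<in> S \<Longrightarrow> v \<in> carrier M \<Longrightarrow> \<phi> (act M x v) = act N x (\<phi> v)"
  shows "\<phi> \<in> hom_super S M N"
  using assms by (auto simp: hom_super_def LinearCombinations.module_hom_def)

lemma hom_super_comp:
  assumes \<phi>: "\<phi> \<in> hom_super S M N" and \<theta>: "\<theta> \<in> hom_super S N P"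
  shows "\<theta> \<circ> \<phi> \<in> hom_super S M P"
  by (rule hom_superI) (simp_all add: hom_superD[OF \<phi>] hom_superD[OF \<theta>])

lemma hom_super_zero:
  assumes "supermodule S M" "supermodule S N" "\<phi> \<in> hom_super S M N"
  shows "\<phi> \<zero>\<^bsub>M\<^esub> = \<zero>\<^bsub>N\<^esub>"
proof -
  interpret M: supermodule_over S M by (rule supermodule_overI) fact
  interpret N: supermodule_over S N by (rule supermodule_overI) fact
  show ?thesis
    using hom_superD(3)[OF assms(3), of "\<zero>\<^bsub>M\<^esub>" 0] hom_superD(1)[OF assms(3), of "\<zero>\<^bsub>M\<^esub>"] by simp
qed

lemma iso_super_trans: "iso_super S M N \<Longrightarrow> iso_super S N P \<Longrightarrow> iso_super S M P"
  unfolding iso_super_def by (meson bij_betw_trans hom_super_comp)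

text \<open>The point is parity. If \<open>w\<close> is homogeneous, then the component of its
  preimage of the wrong parity is mapped into both parts of \<open>N\<close>, hence to zero, and
  vanishes by injectivity.\<close>

lemma hom_super_inv_into:
  assumes M: "supermodule S M" and N: "supermodule S N"
    and \<phi>: "\<phi> \<in> hom_super S M N" and bij: "bij_betw \<phi> (carrier M) (carrier N)"
  shows "inv_into (carrier M) \<phi> \<in> hom_super S N M"
proof -
  interpret M: supermodule_over S M by (rule supermodule_overI) fact
  interpret N: supermodule_over S N by (rule supermodule_overI) fact
  note D = hom_superD[OF \<phi>]
  let ?\<theta> = "inv_into (carrier M) \<phi>"
  have \<theta>: "?\<theta> w \<in> carrier M" "\<phi> (?\<theta> w) = w" if "w \<in> carrier N" for w
    using bij_betw_inv_into_right[OF bij that] bij_betw_apply[OF bij_betw_inv_into[OF bij] that] by auto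
  have \<theta>I: "?\<theta> w = v" if "v \<in> carrier M" "\<phi> v = w" for v w
    using bij_betw_inv_into_left[OF bij] that by auto
  have inj: "v = \<zero>\<^bsub>M\<^esub>" if "v \<in> carrier M" "\<phi> v = \<zero>\<^bsub>N\<^esub>" for v
    using that \<theta>I[OF that] \<theta>I[OF _ hom_super_zero[OF M N \<phi>]] by simp
  show ?thesis
  proof (rule hom_superI)
    fix p w assume w: "w \<in> part N p"
    then have wc: "w \<in> carrier N" by (rule N.part_carrier)
    obtain v0 v1 where v: "v0 \<in> part M 0" "v1 \<in> part M 1" "?\<theta> w = v0 \<oplus>\<^bsub>M\<^esub> v1"
      using M.part_decomposition[OF \<theta>(1)[OF wc]] by blast
    then have vc: "v0 \<in> carrier M" "v1 \<in> carrier M" using M.part_carrier by auto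
    have w_eq: "w = \<phi> v0 \<oplus>\<^bsub>N\<^esub> \<phi> v1" using \<theta>(2)[OF wc] v(3) vc D(2) by simp
    have \<phi>v: "\<phi> v0 \<in> part N 0" "\<phi> v1 \<in> part N 1" using v D(4) by auto
    then have \<phi>vc: "\<phi> v0 \<in> carrier N" "\<phi> v1 \<in> carrier N" using N.part_carrier by auto
    show "?\<theta> w \<in> part M p"
    proof (cases "p = 0")
      case True
      have "(w \<ominus>\<^bsub>N\<^esub> \<phi> v0) = \<phi> v1"
        unfolding w_eq using \<phi>vc by (simp add: N.V.M.minus_eq N.V.M.a_comm[of "\<phi> v0 \<oplus>\<^bsub>N\<^esub> \<phi> v1"] N.V.M.r_neg1)
      moreover have "w \<ominus>\<^bsub>N\<^esub> \<phi> v0 \<in> part N 0" using w \<phi>v True N.part_closed(5) by simp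
      ultimately have "\<phi> v1 = \<zero>\<^bsub>N\<^esub>" using \<phi>v N.part_int by force
      then have "v1 = \<zero>\<^bsub>M\<^esub>" using inj vc by simp
      then show ?thesis using vc v True by simp
    next
      case False
      then have p: "p = 1" by simp
      have "(w \<ominus>\<^bsub>N\<^esub> \<phi> v1) = \<phi> v0"
        unfolding w_eq using \<phi>vc by (simp add: N.V.M.minus_eq N.V.M.a_assoc N.V.M.r_neg)
      moreover have "w \<ominus>\<^bsub>N\<^esub> \<phi> v1 \<in> part N 1" using w \<phi>v p N.part_closed(5) by simp
      ultimately have "\<phi> v0 = \<zero>\<^bsub>N\<^esub>" using \<phi>v N.part_int by force
      then have "v0 = \<zero>\<^bsub>M\<^esub>" using inj vc by simp
      then show ?thesis using vc v p by simp
    qed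
  qed (auto simp: \<theta> D intro!: \<theta>I)
qed

lemma graded_submodule_hom_image:
  assumes "supermodule S M" "supermodule S N" and \<phi>: "\<phi> \<in> hom_super S M N"
  shows "graded_submodule S (\<phi> ` carrier M) N"
proof -
  interpret M: supermodule_over S M by (rule supermodule_overI) fact
  interpret N: supermodule_over S N by (rule supermodule_overI) fact
  note D = hom_superD[OF \<phi>]
  have "VectorSpace.subspace complex_field (\<phi> ` carrier M) N"
  proof (rule N.subspaceI)
    show "\<zero>\<^bsub>N\<^esub> \<in> \<phi> ` carrier M"
      using hom_super_zero[OF assms] M.V.M.zero_closed by (metis image_eqI)
  qed (auto simp: D simp flip: D(2,3))
  moreover have "\<exists>v0\<in>\<phi> ` carrier M \<inter> part N 0. \<exists>v1\<in>\<phi> ` carrier M \<inter> part N 1. \<phi> v = v0 \<oplus>\<^bsub>N\<^esub> v1"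
    if v: "v \<in> carrier M" for v
  proof -
    obtain v0 v1 where v: "v0 \<in> part M 0" "v1 \<in> part M 1" "v = v0 \<oplus>\<^bsub>M\<^esub> v1"
      using M.part_decomposition[OF v] by blast
    then have "v0 \<in> carrier M" "v1 \<in> carrier M" using M.part_carrier by auto
    then show ?thesis using v D
      by (intro bexI[of _ "\<phi> v0"] bexI[of _ "\<phi> v1"]) auto
  qed
  moreover have "act N x (\<phi> v) \<in> \<phi> ` carrier M" if "x \<in> S" "v \<in> carrier M" for x v
    using that D(5)[OF that] by (auto simp flip: D(5))
  ultimately show ?thesis by (auto simp: graded_submodule_def)
qed

text \<open>The kernel is graded because the two components of a kernel vector have images of
  different parity with sum zero, so both images vanish.\<close>

lemma graded_submodule_hom_kernel:
  assumes "supermodule S M" "supermodule S N" and \<phi>: "\<phi> \<in> hom_super S M N"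
  shows "graded_submodule S {v \<in> carrier M. \<phi> v = \<zero>\<^bsub>N\<^esub>} M"
proof -
  interpret M: supermodule_over S M by (rule supermodule_overI) fact
  interpret N: supermodule_over S N by (rule supermodule_overI) fact
  note D = hom_superD[OF \<phi>]
  have "VectorSpace.subspace complex_field {v \<in> carrier M. \<phi> v = \<zero>\<^bsub>N\<^esub>} M"
    by (rule M.subspaceI) (auto simp: D hom_super_zero[OF assms])
  moreover have "\<exists>v0\<in>{v \<in> carrier M. \<phi> v = \<zero>\<^bsub>N\<^esub>} \<inter> part M 0.
      \<exists>v1\<in>{v \<in> carrier M. \<phi> v = \<zero>\<^bsub>N\<^esub>} \<inter> part M 1. v = v0 \<oplus>\<^bsub>M\<^esub> v1"
    if v: "v \<in> carrier M" "\<phi> v = \<zero>\<^bsub>N\<^esub>" for v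
  proof -
    obtain v0 v1 where v': "v0 \<in> part M 0" "v1 \<in> part M 1" "v = v0 \<oplus>\<^bsub>M\<^esub> v1"
      using M.part_decomposition[OF v(1)] by blast
    then have c: "v0 \<in> carrier M" "v1 \<in> carrier M" using M.part_carrier by auto
    then have "\<phi> v0 \<oplus>\<^bsub>N\<^esub> \<phi> v1 = \<zero>\<^bsub>N\<^esub>" using v(2) v'(3) D(2) by simp
    then have "\<phi> v0 = \<zero>\<^bsub>N\<^esub>" "\<phi> v1 = \<zero>\<^bsub>N\<^esub>"
      using N.part_sum_eq_zero D(4)[OF v'(1)] D(4)[OF v'(2)] by blast+
    then show ?thesis using v' c by blast
  qed
  ultimately show ?thesis
    by (auto simp: graded_submodule_def D)
qed

text \<open>Image and kernel are graded submodules, and simplicity leaves only the bijective case.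
  The even version suffices, since parity-reversing maps occur as even maps into a parity
  change.\<close>

lemma Schur_iso_super:
  assumes M: "supermodule S M" "simple_module S M" and N: "supermodule S N" "simple_module S N"
    and \<phi>: "\<phi> \<in> hom_super S M N" and v: "v \<in> carrier M" "\<phi> v \<noteq> \<zero>\<^bsub>N\<^esub>"
  shows "iso_super S M N"
proof -
  interpret M: supermodule_over S M by (rule supermodule_overI) fact
  interpret N: supermodule_over S N by (rule supermodule_overI) fact
  note D = hom_superD[OF \<phi>]
  have img: "\<phi> ` carrier M = carrier N"
    using N(2) graded_submodule_hom_image[OF M(1) N(1) \<phi>] v unfolding simple_module_def by blast
  have ker: "{v \<in> carrier M. \<phi> v = \<zero>\<^bsub>N\<^esub>} = {\<zero>\<^bsub>M\<^esub>}"
    using M(2) graded_submodule_hom_kernel[OF M(1) N(1) \<phi>] v unfolding simple_module_def by blast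
  have "inj_on \<phi> (carrier M)"
  proof (rule inj_onI)
    fix u w assume *: "u \<in> carrier M" "w \<in> carrier M" "\<phi> u = \<phi> w"
    then have "\<phi> (u \<ominus>\<^bsub>M\<^esub> w) = \<phi> w \<ominus>\<^bsub>N\<^esub> \<phi> w"
      by (simp add: M.diff_eq_smult N.diff_eq_smult D)
    then have "\<phi> (u \<ominus>\<^bsub>M\<^esub> w) = \<zero>\<^bsub>N\<^esub>" using * D by (simp add: N.diff_eq_zero_iff)
    then have "u \<ominus>\<^bsub>M\<^esub> w = \<zero>\<^bsub>M\<^esub>" using ker * by blast
    then show "u = w" using * by (simp add: M.diff_eq_zero_iff)
  qed
  then show ?thesis using \<phi> img unfolding iso_super_def bij_betw_def by blast
qed

lemma hom_super_surj_generated: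
  assumes "supermodule S M" "supermodule S N" "\<phi> \<in> hom_super S M N"
    and "generated_by S N X" "X \<subseteq> \<phi> ` carrier M"
  shows "\<phi> ` carrier M = carrier N"
  using assms graded_submodule_hom_image unfolding generated_by_def by blast

section \<open>Parity change\<close>

lemma parity_change_simps [simp]:
  "carrier (parity_change M) = carrier M" "\<zero>\<^bsub>parity_change M\<^esub> = \<zero>\<^bsub>M\<^esub>"
  "v \<oplus>\<^bsub>parity_change M\<^esub> w = v \<oplus>\<^bsub>M\<^esub> w" "c \<odot>\<^bsub>parity_change M\<^esub> v = c \<odot>\<^bsub>M\<^esub> v"
  "part (parity_change M) p = part M (p + 1)" "act (parity_change M) = act M"
  by (simp_all add: parity_change_def)

lemma vectorspace_parity_change:
  "vectorspace complex_field (parity_change M) \<longleftrightarrow> vectorspace complex_field M"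
  by (simp add: vectorspace_def Module.module_def Module.module_axioms_def abelian_group_def
    abelian_monoid_def abelian_group_axioms_def parity_change_def comm_group_def comm_monoid_def monoid_def)


lemma subspace_parity_change:
  assumes "vectorspace complex_field M"
  shows "VectorSpace.subspace complex_field N (parity_change M) \<longleftrightarrow> VectorSpace.subspace complex_field N M"
proof -
  interpret M: complex_vectorspace M using assms by (rule complex_vectorspace.intro)
  interpret P: complex_vectorspace "parity_change M"
    using assms by (simp add: complex_vectorspace_def vectorspace_parity_change)
  show ?thesis
  proof
    assume N: "VectorSpace.subspace complex_field N (parity_change M)"
    show "VectorSpace.subspace complex_field N M"
      by (rule M.subspaceI) (use P.subspace_closed(1-4)[OF N] in simp_all)
  next
    assume N: "VectorSpace.subspace complex_field N M"
    show "VectorSpace.subspace complex_field N (parity_change M)"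
      by (rule P.subspaceI) (use M.subspace_closed(1-4)[OF N] in simp_all)
  qed
qed

lemma supermodule_parity_change:
  assumes "supermodule S M"
  shows "supermodule S (parity_change M)"
proof -
  interpret M: supermodule_over S M by (rule supermodule_overI) fact
  interpret P: complex_vectorspace "parity_change M"
    using M.vectorspace by (simp add: complex_vectorspace_def vectorspace_parity_change)
  have dec: "\<exists>v1\<in>part M 1. \<exists>v0\<in>part M 0. v = v1 \<oplus>\<^bsub>M\<^esub> v0" if v: "v \<in> carrier M" for v
  proof -
    obtain v0 v1 where "v0 \<in> part M 0" "v1 \<in> part M 1" "v = v0 \<oplus>\<^bsub>M\<^esub> v1"
      using M.part_decomposition[OF v] by blast
    then show ?thesis using M.part_carrier M.V.M.a_comm by blast
  qed
  have m: "LinearCombinations.module_hom complex_field (parity_change M) (parity_change M)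
      = LinearCombinations.module_hom complex_field M M"
    by (simp add: LinearCombinations.module_hom_def)
  show ?thesis
    unfolding supermodule_def m parity_change_simps
  proof (intro conjI allI ballI)
    fix p r x v assume "x \<in> S \<inter> q_part p" "v \<in> part M (r + 1)"
    then show "act M x v \<in> part M (p + r + 1)"
      using M.act_part[of x p v "r + 1"] by (metis IntE add.assoc)
  next
    fix p r x y v assume "x \<in> S \<inter> q_part p" "y \<in> S \<inter> q_part r" "v \<in> carrier M"
    then show "act M (q_bracket x y) v = act M x (act M y v) \<ominus>\<^bsub>parity_change M\<^esub> super_sign p r \<odot>\<^bsub>M\<^esub> act M y (act M x v)"
      using M.act_bracket[of x y p r v] by (simp add: M.diff_eq_smult P.diff_eq_smult)
  next
    show "part M (0 + 1) \<inter> part M (1 + 1) = {\<zero>\<^bsub>M\<^esub>}"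
      using M.part_int[of _ 0 1] M.part_closed(2) by auto
    show "\<exists>v0\<in>part M (0 + 1). \<exists>v1\<in>part M (1 + 1). v = v0 \<oplus>\<^bsub>M\<^esub> v1" if "v \<in> carrier M" for v
      using dec[OF that] by simp
    show "VectorSpace.subspace complex_field (part M (p + 1)) (parity_change M)" for p
      using M.part_subspace subspace_parity_change[OF M.vectorspace] by blast
  qed (simp_all add: P.vectorspace M.act_hom M.add_act M.scale_act)
qed

lemma simple_module_parity_change:
  assumes M: "supermodule S M" and "simple_module S M"
  shows "simple_module S (parity_change M)"
proof -
  interpret M: supermodule_over S M by (rule supermodule_overI) fact
  have "graded_submodule S N M" if N: "graded_submodule S N (parity_change M)" for N
  proof -
    have "\<exists>v0\<in>N \<inter> part M 0. \<exists>v1\<in>N \<inter> part M 1. v = v0 \<oplus>\<^bsub>M\<^esub> v1" if "v \<in> N" for v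
    proof -
      have "\<exists>v1\<in>N \<inter> part M (0 + 1). \<exists>v0\<in>N \<inter> part M (1 + 1). v = v1 \<oplus>\<^bsub>M\<^esub> v0"
        using N \<open>v \<in> N\<close> unfolding graded_submodule_def parity_change_simps by (elim conjE bspec)
      then obtain v1 v0 where v: "v1 \<in> N \<inter> part M 1" "v0 \<in> N \<inter> part M 0" "v = v1 \<oplus>\<^bsub>M\<^esub> v0"
        unfolding add_0 bit_add_self by (elim bexE)
      then have "v = v0 \<oplus>\<^bsub>M\<^esub> v1"
        using M.V.M.a_comm[of v1 v0] M.part_carrier[of v1 1] M.part_carrier[of v0 0] by simp
      with v show ?thesis by blast
    qed
    then show ?thesis using N by (simp add: graded_submodule_def subspace_parity_change[OF M.vectorspace])
  qed
  then show ?thesis using assms(2) by (auto simp: simple_module_def)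
qed

text \<open>Both sides consist of the parity-reversing homomorphisms from \<open>M\<close> to
  \<open>N\<close>, because shifting twice is the identity. This lets the shift be moved to the side
  where it is wanted.\<close>

lemma hom_super_parity_change:
  "hom_super S (parity_change M) N = hom_super S M (parity_change N)"
proof -
  have "(\<forall>p. \<phi> ` part M (p + 1) \<subseteq> part N p) \<longleftrightarrow> (\<forall>p. \<phi> ` part M p \<subseteq> part N (p + 1))" (is "?L \<longleftrightarrow> ?R") for \<phi>
  proof
    show ?R if ?L
    proof
      fix p show "\<phi> ` part M p \<subseteq> part N (p + 1)"
        using that[rule_format, of "p + 1"] by (simp only: add.assoc bit_add_self add_0_right)
    qed
    show ?L if ?R
    proof
      fix p show "\<phi> ` part M (p + 1) \<subseteq> part N p"
        using that[rule_format, of "p + 1"] by (simp only: add.assoc bit_add_self add_0_right)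
    qed
  qed
  then show ?thesis
    unfolding hom_super_def LinearCombinations.module_hom_def parity_change_simps by simp
qed

lemma iso_super_parity_change:
  "iso_super S (parity_change M) N \<longleftrightarrow> iso_super S M (parity_change N)"
  by (simp add: iso_super_def hom_super_parity_change)

lemma weyl_relators_parity_change: "weyl_relators \<psi> (parity_change H) = weyl_relators \<psi> H"
proof (intro equalityI subsetI)
  show "f \<in> weyl_relators \<psi> H" if "f \<in> weyl_relators \<psi> (parity_change H)" for f
    using that
  proof cases
    case (rel_f w i j m u)
    then show ?thesis using weyl_relators.rel_f[of w H i j m \<psi> u] by simp
  qed (auto intro: weyl_relators.intros)
  show "f \<in> weyl_relators \<psi> (parity_change H)" if "f \<in> weyl_relators \<psi> H" for f
    using that
  proof cases
    case (gen_add w w' u)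
    then show ?thesis using weyl_relators.gen_add[of w "parity_change H" w' u \<psi>] by simp
  next
    case (gen_scale w u c)
    then show ?thesis using weyl_relators.gen_scale[of w "parity_change H" u c \<psi>] by simp
  next
    case (gen_act w x u)
    then show ?thesis using weyl_relators.gen_act[of w "parity_change H" x u \<psi>] by simp
  next
    case (rel_f w i j m u)
    then show ?thesis using weyl_relators.rel_f[of w "parity_change H" i j m \<psi> u] by simp
  qed (auto intro: weyl_relators.intros)
qed

text \<open>Relators involve the carrier and the operations of \<open>H\<close> but not its grading,
  so the quotient is the same space. Only the parity of the generator in each word is
  shifted.\<close>

lemma local_weyl_parity_change: "local_weyl \<psi> (parity_change H) = parity_change (local_weyl \<psi> H)"
proof -
  have 1: "weyl_class \<psi> (parity_change H) = weyl_class \<psi> H"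
    by (intro ext) (simp add: weyl_class_def weyl_relations_def weyl_relators_parity_change)
  have 2: "homogeneous_words (parity_change H) p = homogeneous_words H (p + 1)" for p
  proof (intro equalityI subsetI)
    fix f assume "f \<in> homogeneous_words (parity_change H) p"
    then obtain u w ps r where "f = word u w" "list_all2 (\<lambda>x s. x \<in> q_part s) u ps"
        "w \<in> part H (r + 1)" "p = sum_list ps + r"
      unfolding homogeneous_words_def parity_change_simps by blast
    moreover from this have "p + 1 = sum_list ps + (r + 1)" by (simp only: add.assoc)
    ultimately show "f \<in> homogeneous_words H (p + 1)"
      unfolding homogeneous_words_def by blast
  next
    fix f assume "f \<in> homogeneous_words H (p + 1)"
    then obtain u w ps r where f: "f = word u w" "list_all2 (\<lambda>x s. x \<in> q_part s) u ps"
        "w \<in> part H r" "p + 1 = sum_list ps + r"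
      unfolding homogeneous_words_def by blast
    from arg_cong[OF f(4), of "\<lambda>q. q + 1"] have "p = sum_list ps + (r + 1)"
      by (simp only: add.assoc bit_add_self add_0_right)
    moreover have "w \<in> part H (r + 1 + 1)"
      using f(3) by (simp only: add.assoc bit_add_self add_0_right)
    ultimately show "f \<in> homogeneous_words (parity_change H) p"
      using f(1,2) unfolding homogeneous_words_def parity_change_simps by blast
  qed
  show ?thesis
    unfolding local_weyl_def 1 2 parity_change_simps by (simp only: parity_change_def supermodule.simps)
qed

section \<open>The universal property of the local Weyl module\<close>

definition free_eval ::
  "(complex, 'v, 'm) module_scheme \<Rightarrow> (('a, 'n) queer list \<times> 'h \<Rightarrow> 'v) \<Rightarrow>
    ('a::comm_complex_algebra_1, 'n::finite, 'h) free_module \<Rightarrow> 'v" where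
  "free_eval M val f = (\<Oplus>\<^bsub>M\<^esub>b\<in>Poly_Mapping.keys f. Poly_Mapping.lookup f b \<odot>\<^bsub>M\<^esub> val b)"

context complex_vectorspace
begin

context
  fixes val :: "('a::comm_complex_algebra_1, 'n::finite) queer list \<times> 'h \<Rightarrow> 'v"
  assumes val [simp]: "\<And>b. val b \<in> carrier M"
begin

text \<open>The support changes under addition and scaling; summing over a fixed finite superset
  makes linearity of the evaluation a termwise matter.\<close>

lemma free_eval_superset:
  assumes "finite B" "Poly_Mapping.keys f \<subseteq> B"
  shows "free_eval M val f = (\<Oplus>b\<in>B. Poly_Mapping.lookup f b \<odot> val b)"
  unfolding free_eval_def using assms
  by (intro V.M.add.finprod_mono_neutral_cong_left) (auto simp: in_keys_iff)

lemma free_eval_in [simp]: "free_eval M val f \<in> carrier M"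
  unfolding free_eval_def by (intro V.M.finsum_closed) simp

lemma free_eval_zero [simp]: "free_eval M val 0 = \<zero>"
  by (simp add: free_eval_def)

lemma free_eval_word [simp]: "free_eval M val (word u w) = val (u, w)"
  by (simp add: free_eval_def word_def)

lemma free_eval_add: "free_eval M val (f + g) = free_eval M val f \<oplus> free_eval M val g"
proof -
  let ?B = "Poly_Mapping.keys f \<union> Poly_Mapping.keys g"
  have *: "finite ?B" "Poly_Mapping.keys (f + g) \<subseteq> ?B" "Poly_Mapping.keys f \<subseteq> ?B" "Poly_Mapping.keys g \<subseteq> ?B"
    using Poly_Mapping.keys_add[of f g] by auto
  show ?thesis
    unfolding *(2-4)[THEN free_eval_superset[OF *(1)]]
    by (simp add: lookup_add add_smult V.M.finsum_addf)
qed

lemma free_eval_scale: "free_eval M val (free_scale c f) = c \<odot> free_eval M val f"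
proof -
  have "Poly_Mapping.keys (free_scale c f) \<subseteq> Poly_Mapping.keys f"
    by (auto simp: in_keys_iff lookup_free_scale)
  from free_eval_superset[OF finite_keys this] show ?thesis
    by (simp add: free_eval_def lookup_free_scale V.finsum_smult smult_smult)
qed

lemma free_eval_diff: "free_eval M val (f - g) = free_eval M val f \<ominus> free_eval M val g"
proof -
  have "f - g = f + free_scale (-1) g"
    by (intro poly_mapping_eqI) (simp add: lookup_add lookup_minus lookup_free_scale)
  then show ?thesis by (simp only: free_eval_add free_eval_scale diff_eq_smult free_eval_in)
qed

end

end

context supermodule_over
begin

lemma foldr_act_in [simp]: "set u \<subseteq> S \<Longrightarrow> v \<in> carrier M \<Longrightarrow> foldr (act M) u v \<in> carrier M"
  by (induction u) auto

lemma foldr_act_add: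
  "set u \<subseteq> S \<Longrightarrow> v \<in> carrier M \<Longrightarrow> w \<in> carrier M \<Longrightarrow>
    foldr (act M) u (v \<oplus> w) = foldr (act M) u v \<oplus> foldr (act M) u w"
  by (induction u) (auto simp: act_add)

lemma foldr_act_smult:
  "set u \<subseteq> S \<Longrightarrow> v \<in> carrier M \<Longrightarrow> foldr (act M) u (c \<odot> v) = c \<odot> foldr (act M) u v"
  by (induction u) (auto simp: act_smult)

lemma foldr_act_zero [simp]: "set u \<subseteq> S \<Longrightarrow> foldr (act M) u \<zero> = \<zero>"
  by (induction u) auto

lemma foldr_act_diff:
  "set u \<subseteq> S \<Longrightarrow> v \<in> carrier M \<Longrightarrow> w \<in> carrier M \<Longrightarrow>
    foldr (act M) u (v \<ominus> w) = foldr (act M) u v \<ominus> foldr (act M) u w"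
  by (simp add: diff_eq_smult foldr_act_add foldr_act_smult)

lemma foldr_act_part:
  assumes "set u \<subseteq> S" "list_all2 (\<lambda>x s. x \<in> q_part s) u ps" "v \<in> part M r"
  shows "foldr (act M) u v \<in> part M (sum_list ps + r)"
  using assms(2,1)
proof (induction rule: list_all2_induct)
  case (Cons x u p ps)
  then have "act M x (foldr (act M) u v) \<in> part M (p + (sum_list ps + r))"
    by (intro act_part) auto
  then show ?case by (simp only: foldr.simps comp_apply sum_list.Cons add.assoc)
qed (use assms(3) in \<open>simp only: foldr.simps id_apply sum_list.Nil add_0\<close>)

end

text \<open>A word is sent to the successive action of its letters on \<open>\<phi> w\<close>. Every
  relator evaluates to zero: the prefix \<open>u\<close> acts linearly, and what follows it is
  either a module axiom of \<open>M\<close>, a property of \<open>\<phi>\<close>, or one of the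
  assumptions \<open>n\<close>, \<open>h\<close>, \<open>f\<close>.\<close>

theorem local_weyl_universal:
  fixes H :: "(('a::comm_complex_algebra_1, 'n::{finite,linorder}) queer, 'h) supermodule"
    and M :: "(('a, 'n) queer, 'v) supermodule"
  assumes H: "supermodule hA H" and M: "supermodule UNIV M"
    and \<phi>: "\<phi> \<in> hom_super hA H M"
    and n: "\<And>x w. x \<in> nA \<Longrightarrow> w \<in> carrier H \<Longrightarrow> act M x (\<phi> w) = \<zero>\<^bsub>M\<^esub>"
    and h: "\<And>x w. x \<in> h0A \<Longrightarrow> w \<in> carrier H \<Longrightarrow> act M x (\<phi> w) = \<psi> x \<odot>\<^bsub>M\<^esub> \<phi> w"
    and f: "\<And>i j m w. next_index i j \<Longrightarrow> of_nat m = \<psi> (h_elem i j) \<Longrightarrow> w \<in> carrier H \<Longrightarrow>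
      (act M (f_elem i j) ^^ (m + 1)) (\<phi> w) = \<zero>\<^bsub>M\<^esub>"
  obtains \<Phi> where "\<Phi> \<in> hom_super UNIV (local_weyl \<psi> H) M"
    "\<And>u w. w \<in> carrier H \<Longrightarrow> \<Phi> (weyl_class \<psi> H (word u w)) = foldr (act M) u (\<phi> w)"
proof -
  interpret H: supermodule_over hA H by (rule supermodule_overI) fact
  interpret M: supermodule_over UNIV M by (rule supermodule_overI) fact
  note \<phi>D = hom_superD[OF \<phi>]
  let ?W = "local_weyl \<psi> H"
  let ?F = "Modules.module.span free_scale {word u w | u w. w \<in> carrier H} :: ('a, 'n, 'h) free_module set"
  let ?P = "\<lambda>p. Modules.module.span free_scale (homogeneous_words H p) :: ('a, 'n, 'h) free_module set"
  have W: "carrier ?W = weyl_class \<psi> H ` ?F" "\<And>p. part ?W p = weyl_class \<psi> H ` ?P p"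
    by (simp_all add: local_weyl_def)
  \<comment> \<open>Words over elements outside the carrier are sent to zero, so that evaluation is defined on the whole
    free module and needs no side condition.\<close>
  define val where "val = (\<lambda>(u, w). if w \<in> carrier H then foldr (act M) u (\<phi> w) else \<zero>\<^bsub>M\<^esub>)"
  have val_in [simp]: "val b \<in> carrier M" for b
    by (auto simp: val_def \<phi>D split: prod.splits)
  have val [simp]: "val (u, w) = foldr (act M) u (\<phi> w)" if "w \<in> carrier H" for u w
    using that by (simp add: val_def)
  let ?e = "free_eval M val"
  note e = M.free_eval_add[OF val_in] M.free_eval_scale[OF val_in] M.free_eval_diff[OF val_in]
    M.free_eval_word[OF val_in] M.free_eval_in[OF val_in] M.free_eval_zero[OF val_in]
  note L = M.foldr_act_add M.foldr_act_smult M.foldr_act_diff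
  have relator: "?e g = \<zero>\<^bsub>M\<^esub>" if "g \<in> weyl_relators \<psi> H" for g
    using that
  proof cases
    case (act_add w u x y v)
    then show ?thesis by (simp add: e L \<phi>D M.add_act)
  next
    case (act_scale w u c x v)
    then show ?thesis by (simp add: e L \<phi>D M.scale_act)
  next
    case (act_bracket w x p y r u v)
    then show ?thesis by (simp add: e L \<phi>D M.act_bracket[of x y p r] M.act_smult)
  next
    case (gen_add w w' u)
    then show ?thesis by (simp add: e L \<phi>D)
  next
    case (gen_scale w u c)
    then show ?thesis by (simp add: e L \<phi>D)
  next
    case (gen_act w x u)
    then show ?thesis by (simp add: e L \<phi>D flip: \<phi>D(5))
  next
    case (rel_n w x u)
    then show ?thesis by (simp add: e L \<phi>D n)
  next
    case (rel_h w x u)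
    then show ?thesis by (simp add: e L \<phi>D h)
  next
    case (rel_f w i j m u)
    then have "foldr (act M) (replicate (m + 1) (f_elem i j)) (\<phi> w) = \<zero>\<^bsub>M\<^esub>"
      using f by (simp only: foldr_replicate)
    then show ?thesis using rel_f by (simp add: e del: replicate.simps foldr.simps)
  qed
  have relation: "?e g = \<zero>\<^bsub>M\<^esub>" if "g \<in> weyl_relations \<psi> H" for g
    using that unfolding weyl_relations_def
    by (induction rule: free.span_induct_alt) (simp_all add: e relator)
  have eval_cong: "?e g = ?e g'" if "g \<in> weyl_class \<psi> H g'" for g g'
    using relation[of "g - g'"] that by (simp add: weyl_class_def e M.diff_eq_zero_iff)
  \<comment> \<open>Elements of the quotient are sets of representatives; \<open>eval_cong\<close>
    makes the chosen representative irrelevant.\<close>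
  define \<Phi> where "\<Phi> X = ?e (SOME g. g \<in> X)" for X
  have \<Phi> [simp]: "\<Phi> (weyl_class \<psi> H g) = ?e g" for g
    unfolding \<Phi>_def by (rule eval_cong) (metis someI weyl_class_self)
  have "\<Phi> \<in> hom_super UNIV ?W M"
  proof (rule hom_superI)
    show "\<Phi> X \<in> part M p" if X: "X \<in> part ?W p" for X p
    proof -
      obtain g where g: "g \<in> ?P p" "X = weyl_class \<psi> H g" using X by (auto simp: W)
      from g(1) have "?e g \<in> part M p"
      proof (induction rule: free.span_induct_alt)
        case (step c s y)
        then obtain u w ps r where s: "s = word u w" "list_all2 (\<lambda>x s. x \<in> q_part s) u ps"
            "w \<in> part H r" "p = sum_list ps + r"
          by (auto simp: homogeneous_words_def)
        have "?e s \<in> part M p"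
          unfolding s(4) using M.foldr_act_part[OF _ s(2) \<phi>D(4)[OF s(3)]] H.part_carrier[OF s(3)] s(1)
          by (simp add: e)
        then show ?case using step by (simp add: e M.part_closed)
      qed (simp add: e M.part_closed)
      then show ?thesis by (simp add: g)
    qed
    show "\<Phi> (act ?W x X) = act M x (\<Phi> X)" if X: "X \<in> carrier ?W" for x X
    proof -
      obtain g where g: "g \<in> ?F" "X = weyl_class \<psi> H g" using X by (auto simp: W)
      from g(1) have "?e (free_act x g) = act M x (?e g)"
      proof (induction rule: free.span_induct_alt)
        case (step c s y)
        then obtain u w where "s = word u w" "w \<in> carrier H" by blast
        then show ?case using step
          by (simp add: e \<phi>D free_act_add free_act_scale M.act_add M.act_smult)
      qed (simp add: e)
      then show ?thesis by (simp add: g local_weyl_act)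
    qed
  qed (auto simp: W local_weyl_add local_weyl_smult e)
  moreover have "\<Phi> (weyl_class \<psi> H (word u w)) = foldr (act M) u (\<phi> w)" if "w \<in> carrier H" for u w
    using that by (simp add: e)
  ultimately show ?thesis by (rule that)
qed

section \<open>Vanishing of powers of $f_i$ in finite-dimensional modules\<close>

lemma matrix_unit_mult: "matrix_unit i j ** matrix_unit k l = (if j = k then matrix_unit i l else 0)"
proof -
  have "(\<Sum>m\<in>UNIV. (if r = i \<and> m = j then 1 else 0) * (if m = k \<and> c = l then 1 else (0::complex)))
      = (\<Sum>m\<in>UNIV. if m = j then (if r = i \<and> j = k \<and> c = l then 1 else 0) else 0)" for r c
    by (rule sum.cong) auto
  then show ?thesis
    by (auto simp: vec_eq_iff matrix_matrix_mult_def matrix_unit_def)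
qed

lemma matrix_diff_mult:
  fixes A B C :: "'a::comm_ring_1^'n::finite^'n"
  shows "(A - B) ** C = A ** C - B ** C" "C ** (A - B) = C ** A - C ** B"
  by (simp_all add: vec_eq_iff matrix_matrix_mult_def left_diff_distrib right_diff_distrib sum_subtractf)

lemma h_elem_q_tensor: "h_elem i j = q_tensor (matrix_unit i i - matrix_unit j j, 0) 1"
  by (simp add: h_elem_def k_elem_def q_tensor_def prod_eq_iff vec_eq_iff map_matrix_def scaleC_diff_left scaleC_zero_left)

text \<open>With its indices exchanged, \<open>f_elem j i\<close> is the matrix unit in place (i,
  j), so for consecutive \<open>i < j\<close> it is the raising element e_i of the triple.\<close>

lemma q_bracket_f_elem:
  "q_bracket (f_elem j i) (f_elem i j :: ('a::comm_complex_algebra_1, 'n::finite) queer) = h_elem i j"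
  by (simp add: f_elem_def h_elem_q_tensor q_bracket_tensor)
     (simp add: q_bracket_def matrix_unit_mult)

lemma q_bracket_h_elem:
  assumes "i \<noteq> j"
  shows "q_bracket (h_elem i j) (f_elem i j :: ('a::comm_complex_algebra_1, 'n::finite) queer)
    = q_scale (-2) (f_elem i j)"
proof -
  have "q_bracket (matrix_unit i i - matrix_unit j j, 0) (matrix_unit j i, 0)
      = (map_matrix ((*) (-2)) (matrix_unit j i), 0 :: complex^'n^'n)"
    using assms
    by (simp add: q_bracket_def matrix_diff_mult matrix_unit_mult)
       (simp add: vec_eq_iff map_matrix_def matrix_unit_def)
  then show ?thesis
    by (simp add: f_elem_def h_elem_q_tensor q_bracket_tensor)
       (simp add: q_scale_def q_tensor_def map_matrix_def vec_eq_iff scaleC_scaleC scaleC_zero_left scaleC_zero_right)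
qed

lemma f_elem_even: "f_elem i j \<in> q_part 0" and h_elem_even: "h_elem i j \<in> q_part 0"
  by (simp_all add: f_elem_def h_elem_q_tensor q_part_def q_tensor_def map_matrix_def vec_eq_iff scaleC_zero_left)

lemma f_elem_in_nA: "j < i \<Longrightarrow> f_elem i j \<in> nA"
  by (auto simp: nA_def f_elem_def q_tensor_def map_matrix_def matrix_unit_def scaleC_zero_left)

lemma h_elem_in_h0A: "h_elem i j \<in> h0A"
  using h_elem_even[of i j]
  by (auto simp: h0A_def hA_def h_elem_q_tensor q_tensor_def map_matrix_def matrix_unit_def scaleC_zero_left)

lemma f_elem_power_eq_zero:
  fixes M :: "(('a::comm_complex_algebra_1, 'n::finite) queer, 'v) supermodule" (structure)
  assumes M: "supermodule UNIV M" and fd: "fin_dim M" and ij: "i \<noteq> j" and w: "w \<in> carrier M"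
    and e: "act M (f_elem j i) w = \<zero>" and h: "act M (h_elem i j) w = of_nat m \<odot> w"
  shows "(act M (f_elem i j) ^^ (m + 1)) w = \<zero>"
proof -
  interpret supermodule_over UNIV M by (rule supermodule_overI) fact
  define F where "F k = (act M (f_elem i j) ^^ k) w" for k
  have F_in [simp]: "F k \<in> carrier M" for k by (induction k) (simp_all add: F_def w)
  have F_Suc: "F (Suc k) = act M (f_elem i j) (F k)" for k by (simp add: F_def)
  have comm: "act M x (act M y v) = act M (q_bracket x y) v \<oplus> act M y (act M x v)"
    if "x \<in> q_part 0" "y \<in> q_part 0" "v \<in> carrier M" for x y v
    using act_bracket[of x y 0 0 v] that
    by (simp add: super_sign_def V.M.minus_eq V.M.a_assoc V.M.l_neg)
  have hF: "act M (h_elem i j) (F k) = (of_nat m - 2 * of_nat k) \<odot> F k" for k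
  proof (induction k)
    case (Suc k)
    have "act M (h_elem i j) (F (Suc k)) = (-2) \<odot> F (Suc k) \<oplus> act M (f_elem i j) (act M (h_elem i j) (F k))"
      unfolding F_Suc using comm[OF h_elem_even f_elem_even, of "F k"]
      by (simp add: q_bracket_h_elem[OF ij] scale_act)
    also have "\<dots> = (-2) \<odot> F (Suc k) \<oplus> (of_nat m - 2 * of_nat k) \<odot> F (Suc k)"
      by (simp only: Suc act_smult[OF UNIV_I F_in] F_Suc)
    also have "\<dots> = (of_nat m - 2 * of_nat (Suc k)) \<odot> F (Suc k)"
      by (simp only: add_smult[OF F_in, symmetric]) (simp add: algebra_simps)
    finally show ?case .
  qed (simp add: F_def h)
  \<comment> \<open>At \<open>k = 0\<close> the coefficient vanishes, so the truncated subtraction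
    in \<open>F (k - 1)\<close> does no harm.\<close>
  have eF: "act M (f_elem j i) (F k) = (of_nat k * (of_nat m - of_nat k + 1)) \<odot> F (k - 1)" for k
  proof (induction k)
    case (Suc k)
    have "act M (f_elem j i) (F (Suc k)) = act M (h_elem i j) (F k) \<oplus> act M (f_elem i j) (act M (f_elem j i) (F k))"
      using comm[of "f_elem j i" "f_elem i j" "F k"] by (simp only: f_elem_even F_in F_Suc q_bracket_f_elem)
    also have "act M (f_elem i j) (act M (f_elem j i) (F k)) = (of_nat k * (of_nat m - of_nat k + 1)) \<odot> F k"
      unfolding Suc by (cases k) (simp_all add: act_smult F_Suc)
    also have "act M (h_elem i j) (F k) \<oplus> \<dots> = (of_nat (Suc k) * (of_nat m - of_nat (Suc k) + 1)) \<odot> F k"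
      unfolding hF by (simp only: add_smult[OF F_in, symmetric]) (simp add: algebra_simps)
    finally show ?case by (simp only: diff_Suc_1)
  qed (simp add: F_def e w)
  have F_mono: "F (k + l) = \<zero>" if "F k = \<zero>" for k l
    by (induction l) (simp_all add: that F_Suc)
  have "\<exists>k. F k = \<zero>"
  proof (rule ccontr)
    assume "\<not> ?thesis"
    then have nz: "F k \<noteq> \<zero>" for k by simp
    have "inj F"
    proof (rule injI)
      fix k l assume kl: "F k = F l"
      have "((of_nat m - 2 * of_nat k) - (of_nat m - 2 * of_nat l)) \<odot> F k = \<zero>"
        using hF[of k] hF[of l] kl by (simp only: diff_smult[OF F_in]) (simp add: diff_eq_zero_iff)
      then have "of_nat l = (of_nat k :: complex)" using nz by (simp add: smult_eq_zero_iff)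
      then show "k = l" by simp
    qed
    \<comment> \<open>\<open>eigenvectors_lin_indpt\<close> attaches eigenvalues to vectors rather
      than to indices, so the exponent is recovered from the vector by injectivity of
      \<open>F\<close>.\<close>
    define \<mu> :: "_ \<Rightarrow> complex" where "\<mu> v = of_nat m - 2 * of_nat (the_inv F v)" for v
    have "V.lin_indpt (range F)"
    proof (rule eigenvectors_lin_indpt)
      show "act M (h_elem i j) v = \<mu> v \<odot> v" if "v \<in> range F" for v
        using that \<open>inj F\<close> hF by (auto simp: \<mu>_def the_inv_f_f)
      show "inj_on \<mu> (range F)"
        using \<open>inj F\<close> by (intro inj_onI) (auto simp: \<mu>_def the_inv_f_f)
      show "\<zero> \<notin> range F" using nz by (metis rangeE)
    qed (auto simp: act_hom)
    then have "finite (range F)"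
      using fd by (intro V.fin_dim_li_fin) (auto simp: fin_dim_def)
    then show False using \<open>inj F\<close> finite_imageD infinite_UNIV_nat by blast
  qed
  define k where "k = (LEAST k. F k = \<zero>)"
  have k: "F k = \<zero>" "\<And>l. l < k \<Longrightarrow> F l \<noteq> \<zero>"
    unfolding k_def using LeastI_ex[OF \<open>\<exists>k. F k = \<zero>\<close>] not_less_Least by auto
  \<comment> \<open>For nonzero \<open>w\<close> the least exponent is exactly \<open>m + 1\<close>:
    applying e to \<open>F k = \<zero>\<close> gives \<open>k * (m - k + 1) = 0\<close>. An
    inequality is claimed because \<open>w\<close> may be zero, and then
    \<open>k = 0\<close>.\<close>
  have "k \<le> m + 1"
  proof (rule ccontr)
    assume *: "\<not> k \<le> m + 1"
    have "(of_nat k * (of_nat m - of_nat k + 1)) \<odot> F (k - 1) = \<zero>"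
      using eF[of k] k(1) by simp
    moreover have "F (k - 1) \<noteq> \<zero>" using k(2)[of "k - 1"] * by simp
    ultimately have "of_nat k * (of_nat m - of_nat k + 1) = (0 :: complex)"
      by (simp add: smult_eq_zero_iff)
    then have "of_nat m - of_nat k + 1 = (0 :: complex)" using * by auto
    then have "of_nat (m + 1) - of_nat k = (0 :: complex)" by (simp only: of_nat_add of_nat_1) (simp add: diff_add_eq)
    then have "of_nat (m + 1) = (of_nat k :: complex)" by (simp only: right_minus_eq)
    then have "m + 1 = k" by (simp only: of_nat_eq_iff)
    then show False using * by simp
  qed
  then show ?thesis
    using F_mono[OF k(1), of "m + 1 - k"] by (simp add: F_def)
qed

section \<open>Uniqueness of $H(\psi)$\<close>

text \<open>\<open>X\<close> spans the space modulo the radical of \<open>B\<close>. A largest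
  orthogonal system inside the span of \<open>X\<close> has a complement on which \<open>B\<close>
  vanishes, so it also spans modulo the radical. The value 2 is chosen because the bracket of an odd
  element with itself acts as twice its square: a vector with \<open>B g g = 2\<close> will act as
  an involution.\<close>

lemma orthogonal_system_exists:
  fixes scale :: "complex \<Rightarrow> 'e::ab_group_add \<Rightarrow> 'e" and B :: "'e \<Rightarrow> 'e \<Rightarrow> complex"
  assumes "vector_space scale"
    and sym: "\<And>x y. B x y = B y x" and add: "\<And>x y z. B (x + y) z = B x z + B y z"
    and scale: "\<And>c x y. B (scale c x) y = c * B x y"
    and X: "finite X" "\<And>x. \<exists>y\<in>Modules.module.span scale X. \<forall>z. B (x - y) z = 0"
  obtains G where "finite G" "\<And>g. g \<in> G \<Longrightarrow> B g g = 2"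
    "\<And>g h. g \<in> G \<Longrightarrow> h \<in> G \<Longrightarrow> g \<noteq> h \<Longrightarrow> B g h = 0"
    "\<And>x. \<exists>y\<in>Modules.module.span scale G. \<forall>z. B (x - y) z = 0"
proof -
  interpret vector_space scale by fact
  have zero: "B 0 z = 0" for z using scale[of 0 0 z] by simp
  have diff: "B (x - y) z = B x z - B y z" for x y z
    using add[of "x - y" y z] by simp
  have add': "B z (x + y) = B z x + B z y" and scale': "B z (scale c x) = c * B z x"
    and diff': "B z (x - y) = B z x - B z y" for x y z c
    by (simp_all add: sym[of z] add scale diff)
  have sum: "B (\<Sum>g\<in>A. f g) z = (\<Sum>g\<in>A. B (f g) z)" if "finite A" for A :: "'e set" and f z
    using that by (induction A rule: finite_induct) (simp_all add: zero add)
  define orth where "orth G \<longleftrightarrow> finite G \<and> G \<subseteq> span X \<and> (\<forall>g\<in>G. B g g = 2) \<and>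
      (\<forall>g\<in>G. \<forall>h\<in>G. g \<noteq> h \<longrightarrow> B g h = 0)" for G
  \<comment> \<open>Pairing with \<open>g\<close> kills the span of the other members but not
    \<open>g\<close> itself. Hence orthogonal systems are independent, their size is at most
    \<open>card X\<close>, and one of largest size exists.\<close>
  have bound: "card G \<le> card X" if G: "orth G" for G
  proof -
    have "g \<notin> span (G - {g})" if g: "g \<in> G" for g
    proof
      have "B y g = 0" if "y \<in> span (G - {g})" for y
        using that
      proof (induction rule: span_induct_alt)
        case (step c x y)
        then show ?case using G g by (auto simp: orth_def add scale)
      qed (simp add: zero)
      moreover assume "g \<in> span (G - {g})"
      ultimately show False using G g by (auto simp: orth_def)
    qed
    then have "independent G" by (auto simp: dependent_def)
    then show ?thesis using independent_span_bound X(1) G by (auto simp: orth_def)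
  qed
  have "orth {}" by (simp add: orth_def)
  then obtain G where G: "orth G" and max: "\<And>G'. orth G' \<Longrightarrow> card G' \<le> card G"
    using ex_has_greatest_nat[of orth "{}" card "Suc (card X)"] bound by (auto simp: less_Suc_eq_le)
  \<comment> \<open>The orthogonal projection onto the span of \<open>G\<close>; the denominator is
    \<open>B g g = 2\<close>.\<close>
  define p where "p x = (\<Sum>g\<in>G. scale (B x g / 2) g)" for x
  have p_span: "p x \<in> span G" for x
    unfolding p_def by (intro span_sum span_scale span_base)
  have "span G \<subseteq> span X" using G by (intro span_minimal) (auto simp: orth_def)
  have Bp: "B (p x) g = B x g" if g: "g \<in> G" for x g
  proof -
    have "B (p x) g = (\<Sum>h\<in>G. B x h / 2 * B h g)"
      unfolding p_def using G by (simp add: orth_def sum scale)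
    also have "\<dots> = (\<Sum>h\<in>G. if h = g then B x g else 0)"
      using G g by (intro sum.cong) (auto simp: orth_def)
    finally show ?thesis using G g by (simp add: orth_def)
  qed
  let ?U = "{u \<in> span X. \<forall>g\<in>G. B u g = 0}"
  \<comment> \<open>By maximality of \<open>G\<close>, its orthogonal complement in the span of \<open>X\<close> is totally isotropic.\<close>
  have iso: "B u u = 0" if u: "u \<in> ?U" for u
  proof (rule ccontr)
    assume nz: "B u u \<noteq> 0"
    \<comment> \<open>A non-isotropic vector of the complement can be rescaled to
      \<open>B g g = 2\<close>, since complex square roots exist, and would then enlarge
      \<open>G\<close>.\<close>
    define g where "g = scale (csqrt (2 / B u u)) u"
    have "B g g = (csqrt (2 / B u u))\<^sup>2 * B u u"
      by (simp add: g_def scale scale' power2_eq_square)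
    then have gg: "B g g = 2" using nz by simp
    have gG: "B g h = 0" "B h g = 0" if "h \<in> G" for h
      using u that by (simp_all add: g_def scale scale' sym[of h])
    have "g \<notin> G" using gG gg by force
    moreover have "orth (insert g G)"
      using G u gg gG by (auto simp: orth_def g_def span_scale)
    ultimately show False using max[of "insert g G"] G by (auto simp: orth_def)
  qed
  \<comment> \<open>Polarization: \<open>u\<close>, \<open>v\<close> and \<open>u + v\<close> are
    all isotropic, so \<open>2 * B u v = 0\<close>.\<close>
  have iso2: "B u v = 0" if "u \<in> ?U" "v \<in> ?U" for u v
  proof -
    have "u + v \<in> ?U" using that by (auto simp: span_add add)
    then have "B (u + v) (u + v) = 0" by (rule iso)
    then show ?thesis using iso[OF that(1)] iso[OF that(2)] by (simp add: add add' sym[of v u])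
  qed
  have U: "y - p y \<in> ?U" if "y \<in> span X" for y
    using that p_span \<open>span G \<subseteq> span X\<close> by (auto simp: Bp diff intro!: span_diff)
  have perp: "B u y = 0" if "u \<in> ?U" "y \<in> span G" for u y
    using that(2)
  proof (induction rule: span_induct_alt)
    case (step c x y)
    then show ?case using that(1) by (simp add: add' scale')
  qed (simp add: zero sym[of u])
  show ?thesis
  proof
    fix x
    obtain y where y: "y \<in> span X" "\<And>z. B (x - y) z = 0" using X(2) by blast
    \<comment> \<open>Both arguments are first moved into the span of \<open>X\<close>, modulo the
      radical. There \<open>z'\<close> splits into its projection, orthogonal to
      \<open>y - p y\<close>, and a vector of the totally isotropic complement.\<close>
    have "B (x - p y) z = 0" for z
    proof -
      obtain z' where z': "z' \<in> span X" "\<And>u. B (z - z') u = 0" using X(2) by blast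
      have "B (x - p y) z = B (y - p y) z" using y(2)[of z] by (simp add: diff)
      also have "\<dots> = B (y - p y) z'" using z'(2)[of "y - p y"]
        unfolding sym[of "z - z'" "y - p y"] diff'[of "y - p y" z z'] by simp
      also have "\<dots> = B (y - p y) (z' - p z') + B (y - p y) (p z')" by (simp add: diff')
      also have "\<dots> = 0" using iso2[OF U U] perp[OF U p_span] y z' by simp
      finally show ?thesis .
    qed
    then show "\<exists>y\<in>span G. \<forall>z. B (x - y) z = 0" using p_span by blast
  qed (use G in \<open>auto simp: orth_def\<close>)
qed

text \<open>By Zorn's lemma there is a maximal subspace \<open>N\<close> that contains
  \<open>U\<close> and avoids \<open>v\<close>. It is a hyperplane complementary to the line of
  \<open>v\<close>, and the functional is the coordinate along \<open>v\<close>.\<close>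

lemma (in complex_vectorspace) functional_exists:
  assumes U: "VectorSpace.subspace complex_field U M" and v: "v \<in> carrier M" "v \<notin> U"
  obtains l :: "'v \<Rightarrow> complex" where "\<And>x y. x \<in> carrier M \<Longrightarrow> y \<in> carrier M \<Longrightarrow> l (x \<oplus> y) = l x + l y"
    "\<And>c x. x \<in> carrier M \<Longrightarrow> l (c \<odot> x) = c * l x" "\<And>x. x \<in> U \<Longrightarrow> l x = 0" "l v = 1"
proof -
  let ?A = "{N. VectorSpace.subspace complex_field N M \<and> U \<subseteq> N \<and> v \<notin> N}"
  have chain: "\<Union>C \<in> ?A" if C: "C \<noteq> {}" "subset.chain ?A C" for C
  proof -
    have sub: "VectorSpace.subspace complex_field N M" "U \<subseteq> N" "v \<notin> N" if "N \<in> C" for N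
      using C(2) that by (auto simp: subset.chain_def)
    have "VectorSpace.subspace complex_field (\<Union>C) M"
    proof (rule subspaceI)
      fix x y assume "x \<in> \<Union>C" "y \<in> \<Union>C"
      then obtain N N' where N: "N \<in> C" "N' \<in> C" "x \<in> N" "y \<in> N'" by blast
      then have "N \<subseteq> N' \<or> N' \<subseteq> N" using C(2) by (auto simp: subset.chain_def)
      then show "x \<oplus> y \<in> \<Union>C"
      proof
        assume "N \<subseteq> N'"
        then have "x \<oplus> y \<in> N'" using N subspace_closed(3)[OF sub(1)] by blast
        then show ?thesis using N by blast
      next
        assume "N' \<subseteq> N"
        then have "x \<oplus> y \<in> N" using N subspace_closed(3)[OF sub(1)] by blast
        then show ?thesis using N by blast
      qed
    next
      show "\<Union>C \<subseteq> carrier M" using sub subspace_closed(1) by blast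
      show "\<zero> \<in> \<Union>C" using C(1) sub subspace_closed(2) by blast
      show "c \<odot> x \<in> \<Union>C" if "x \<in> \<Union>C" for c x using that sub subspace_closed(4) by blast
    qed
    then show ?thesis using C(1) sub by blast
  qed
  have "?A \<noteq> {}" using U v by blast
  then have "\<exists>N\<in>?A. \<forall>N'\<in>?A. N \<subseteq> N' \<longrightarrow> N' = N"
    by (rule subset_Zorn_nonempty) (rule chain)
  then obtain N where N: "N \<in> ?A" and max': "\<forall>N'\<in>?A. N \<subseteq> N' \<longrightarrow> N' = N"
    by (elim bexE)
  have max: "N' = N" if "N' \<in> ?A" "N \<subseteq> N'" for N'
    using bspec[OF max' that(1)] that(2) by (rule mp)
  have NS: "VectorSpace.subspace complex_field N M" using N by blast
  note N_closed = subspace_closed[OF NS]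
  have ex: "\<exists>c. x \<ominus> c \<odot> v \<in> N" if x: "x \<in> carrier M" for x
  proof (cases "x \<in> N")
    case True
    then show ?thesis using x v by (intro exI[of _ 0]) (simp add: diff_eq_smult)
  next
    case False
    let ?N = "{y \<oplus> c \<odot> x | y c. y \<in> N}"
    have "VectorSpace.subspace complex_field ?N M"
    proof (rule subspaceI)
      show "?N \<subseteq> carrier M" using x N_closed(1) by auto
      have "\<zero> = \<zero> \<oplus> 0 \<odot> x" using x by simp
      then show "\<zero> \<in> ?N" using N_closed(2) by blast
      fix a b c assume "a \<in> ?N"
      then obtain y d where a: "a = y \<oplus> d \<odot> x" "y \<in> N" by blast
      have "c \<odot> a = c \<odot> y \<oplus> (c * d) \<odot> x"
        using a x N_closed(1) by (auto simp: smult_add smult_smult)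
      then show "c \<odot> a \<in> ?N" using N_closed(4) a(2) by blast
      assume "b \<in> ?N"
      then obtain y' d' where b: "b = y' \<oplus> d' \<odot> x" "y' \<in> N" by blast
      have c: "y \<in> carrier M" "y' \<in> carrier M" using N_closed(1) a b by auto
      then have "a \<oplus> b = (y \<oplus> y') \<oplus> (d + d') \<odot> x"
        using x by (simp add: a(1) b(1) add_smult V.M.a_ac)
      then show "a \<oplus> b \<in> ?N" using N_closed(3)[OF a(2) b(2)] by blast
    qed
    moreover have "N \<subseteq> ?N"
    proof
      fix y assume "y \<in> N"
      moreover from this have "y = y \<oplus> 0 \<odot> x" using N_closed(1) x by auto
      ultimately show "y \<in> ?N" by blast
    qed
    moreover have "?N \<noteq> N"
    proof -
      have "x = \<zero> \<oplus> 1 \<odot> x" using x by simp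
      then have "x \<in> ?N" using N_closed(2) by blast
      then show ?thesis using False by blast
    qed
    \<comment> \<open>Enlarging \<open>N\<close> by \<open>x\<close> must capture \<open>v\<close>,
      say \<open>v = y \<oplus> c \<odot> x\<close>. Here \<open>c\<close> is nonzero because
      \<open>v\<close> is not in \<open>N\<close>, so the equation can be solved for
      \<open>x\<close> modulo \<open>N\<close>.\<close>
    ultimately have "v \<in> ?N" using max[of ?N] N by blast
    then obtain y c where y: "v = y \<oplus> c \<odot> x" "y \<in> N" by blast
    have yc: "y \<in> carrier M" using y N_closed(1) by auto
    have "c \<noteq> 0" using y N x yc by auto
    have "x \<ominus> inverse c \<odot> v = (- inverse c) \<odot> y"
      using yc x \<open>c \<noteq> 0\<close>
      by (simp add: y(1) smult_add smult_smult V.M.minus_eq V.M.minus_add smult_minus V.M.a_lcomm[of x] V.M.r_neg)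
    then show ?thesis using N_closed(4)[OF y(2)] by metis
  qed
  have uniq: "c = d" if x: "x \<in> carrier M" "x \<ominus> c \<odot> v \<in> N" "x \<ominus> d \<odot> v \<in> N" for x c d
  proof (rule ccontr)
    assume "c \<noteq> d"
    have "(x \<ominus> c \<odot> v) \<ominus> (x \<ominus> d \<odot> v) = (d - c) \<odot> v"
    proof -
      have "x \<ominus> c \<odot> v = (x \<ominus> d \<odot> v) \<oplus> (d - c) \<odot> v"
        using x v by (simp add: diff_eq_smult smult_smult V.M.a_assoc flip: add_smult)
      then show ?thesis using x v by simp
    qed
    then have "(d - c) \<odot> v \<in> N" using N_closed(5)[OF x(2,3)] by simp
    then have "inverse (d - c) \<odot> ((d - c) \<odot> v) \<in> N" by (rule N_closed(4))
    then show False using v N \<open>c \<noteq> d\<close> by (simp add: smult_smult)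
  qed
  define l where "l x = (THE c. x \<ominus> c \<odot> v \<in> N)" for x
  have l: "l x = c" if "x \<in> carrier M" "x \<ominus> c \<odot> v \<in> N" for x c
    unfolding l_def using that uniq by (intro the_equality) auto
  have l_in: "x \<ominus> l x \<odot> v \<in> N" if "x \<in> carrier M" for x
    using ex[OF that] l[OF that] by auto
  show ?thesis
  proof
    show "l (x \<oplus> y) = l x + l y" if "x \<in> carrier M" "y \<in> carrier M" for x y
    proof (rule l)
      have "(x \<oplus> y) \<ominus> (l x + l y) \<odot> v = (x \<ominus> l x \<odot> v) \<oplus> (y \<ominus> l y \<odot> v)"
        using that v by (simp add: V.M.minus_eq add_smult V.M.minus_add V.M.a_ac)
      then show "(x \<oplus> y) \<ominus> (l x + l y) \<odot> v \<in> N" using N_closed(3) l_in that by simp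
    qed (use that in simp)
    show "l (c \<odot> x) = c * l x" if "x \<in> carrier M" for c x
    proof (rule l)
      have "c \<odot> x \<ominus> (c * l x) \<odot> v = c \<odot> (x \<ominus> l x \<odot> v)"
        using that v by (simp add: smult_diff smult_smult)
      then show "c \<odot> x \<ominus> (c * l x) \<odot> v \<in> N" using N_closed(4) l_in that by simp
    qed (use that in simp)
    show "l x = 0" if "x \<in> U" for x
    proof (rule l)
      have "x \<in> N" using that N by blast
      then show "x \<ominus> 0 \<odot> v \<in> N" "x \<in> carrier M" using v N_closed(1) by (auto simp: diff_eq_smult)
    qed
    show "l v = 1" using v N_closed(2) by (intro l) simp_all
  qed
qed

text \<open>A map of rank one, from a homogeneous \<open>v\<close> to a homogeneous
  \<open>w\<close>. If their parities differ, then \<open>K\<close> is replaced by its parity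
  change. The empty set of operators means that no equivariance is demanded yet.\<close>

lemma nonzero_linear_map_exists:
  fixes H :: "(('a::comm_complex_algebra_1, 'n::finite) queer, 'h) supermodule"
    and K :: "(('a, 'n) queer, 'k) supermodule"
  assumes H: "supermodule S H" "carrier H \<noteq> {\<zero>\<^bsub>H\<^esub>}" and K: "supermodule S' K" "carrier K \<noteq> {\<zero>\<^bsub>K\<^esub>}"
  shows "\<exists>K'\<in>{K, parity_change K}. \<exists>T\<in>hom_super {} H K'. \<exists>v\<in>carrier H. T v \<noteq> \<zero>\<^bsub>K\<^esub>"
proof -
  interpret H: supermodule_over S H by (rule supermodule_overI) fact
  interpret K: supermodule_over S' K by (rule supermodule_overI) fact
  have "\<exists>r. \<exists>v\<in>part H r. v \<noteq> \<zero>\<^bsub>H\<^esub>"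
  proof (rule ccontr)
    assume *: "\<not> ?thesis"
    have "v = \<zero>\<^bsub>H\<^esub>" if v: "v \<in> carrier H" for v
    proof -
      obtain v0 v1 where v: "v0 \<in> part H 0" "v1 \<in> part H 1" "v = v0 \<oplus>\<^bsub>H\<^esub> v1"
        using H.part_decomposition[OF v] by blast
      then have "v0 = \<zero>\<^bsub>H\<^esub>" "v1 = \<zero>\<^bsub>H\<^esub>" using * by blast+
      then show ?thesis using v by simp
    qed
    then show False using H(2) H.V.M.zero_closed by blast
  qed
  then obtain r v where v: "v \<in> part H r" "v \<noteq> \<zero>\<^bsub>H\<^esub>" by blast
  have "\<exists>q. \<exists>w\<in>part K q. w \<noteq> \<zero>\<^bsub>K\<^esub>"
  proof (rule ccontr)
    assume *: "\<not> ?thesis"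
    have "v = \<zero>\<^bsub>K\<^esub>" if v: "v \<in> carrier K" for v
    proof -
      obtain v0 v1 where v: "v0 \<in> part K 0" "v1 \<in> part K 1" "v = v0 \<oplus>\<^bsub>K\<^esub> v1"
        using K.part_decomposition[OF v] by blast
      then have "v0 = \<zero>\<^bsub>K\<^esub>" "v1 = \<zero>\<^bsub>K\<^esub>" using * by blast+
      then show ?thesis using v by simp
    qed
    then show False using K(2) K.V.M.zero_closed by blast
  qed
  then obtain q w where w: "w \<in> part K q" "w \<noteq> \<zero>\<^bsub>K\<^esub>" by blast
  have vc: "v \<in> carrier H" and wc: "w \<in> carrier K"
    using v w H.part_carrier K.part_carrier by auto
  \<comment> \<open>The functional is taken to vanish on the part opposite to \<open>v\<close>; this
    makes the map of rank one even.\<close>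
  have "v \<notin> part H (r + 1)" using H.part_int[OF v(1), of "r + 1"] v(2) by auto
  then obtain l :: "'h \<Rightarrow> complex" where
      l: "\<And>x y. x \<in> carrier H \<Longrightarrow> y \<in> carrier H \<Longrightarrow> l (x \<oplus>\<^bsub>H\<^esub> y) = l x + l y"
        "\<And>c x. x \<in> carrier H \<Longrightarrow> l (c \<odot>\<^bsub>H\<^esub> x) = c * l x"
        "\<And>x. x \<in> part H (r + 1) \<Longrightarrow> l x = 0" "l v = 1"
    using H.functional_exists[OF H.part_subspace vc, of "r + 1"] by blast
  obtain K' where K': "K' \<in> {K, parity_change K}" "w \<in> part K' r"
  proof (cases "q = r")
    case True
    then show ?thesis using that[of K] w by simp
  next
    case False
    then have "r + 1 = q" by (cases r; cases q) simp_all
    then show ?thesis using that[of "parity_change K"] w by simp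
  qed
  have K's: "carrier K' = carrier K" "\<And>x y. x \<oplus>\<^bsub>K'\<^esub> y = x \<oplus>\<^bsub>K\<^esub> y" "\<And>c x. c \<odot>\<^bsub>K'\<^esub> x = c \<odot>\<^bsub>K\<^esub> x"
    using K'(1) by auto
  have sub: "c \<odot>\<^bsub>K\<^esub> x \<in> part K' p" "\<zero>\<^bsub>K\<^esub> \<in> part K' p" if "x \<in> part K' p" for c x p
    using that K'(1) K.part_closed by auto
  have zero: "\<zero>\<^bsub>K\<^esub> \<in> part K' p" for p
    using K'(1) K.part_closed(2) by auto
  have "(\<lambda>x. l x \<odot>\<^bsub>K\<^esub> w) \<in> hom_super {} H K'"
  proof (rule hom_superI)
    fix p x assume x: "x \<in> part H p"
    show "l x \<odot>\<^bsub>K\<^esub> w \<in> part K' p"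
    proof (cases "p = r")
      case True
      then show ?thesis using sub K'(2) by simp
    next
      case False
      then have "p = r + 1" by (cases r; cases p) simp_all
      then have "l x = 0" using x l(3) by blast
      then show ?thesis using zero wc by simp
    qed
  qed (auto simp: K's l wc K.add_smult K.smult_smult)
  moreover have "l v \<odot>\<^bsub>K\<^esub> w \<noteq> \<zero>\<^bsub>K\<^esub>" using l w wc by simp
  ultimately show ?thesis using K'(1) vc by (intro bexI[of _ K']) auto
qed

text \<open>
  Averaging a linear map over \<open>g\<close> makes it commute with \<open>g\<close>. If the average vanishes, then the map
  anticommutes with \<open>g\<close>, and multiplying it by \<open>g\<close> and by the parity involution does the same
  at the cost of changing its parity.
\<close>

lemma commuting_map_step:
  fixes H :: "(('a::comm_complex_algebra_1, 'n::finite) queer, 'h) supermodule"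
    and K :: "(('a, 'n) queer, 'k) supermodule"
  assumes H: "supermodule hA H" and K: "supermodule hA K"
    and F: "F \<subseteq> hA \<inter> q_part 1" and g: "g \<in> hA \<inter> q_part 1"
    and ggH: "\<And>v. v \<in> carrier H \<Longrightarrow> act H g (act H g v) = v"
    and ggK: "\<And>v. v \<in> carrier K \<Longrightarrow> act K g (act K g v) = v"
    and gxH: "\<And>x v. x \<in> F \<Longrightarrow> v \<in> carrier H \<Longrightarrow> act H g (act H x v) = (-1) \<odot>\<^bsub>H\<^esub> act H x (act H g v)"
    and gxK: "\<And>x v. x \<in> F \<Longrightarrow> v \<in> carrier K \<Longrightarrow> act K g (act K x v) = (-1) \<odot>\<^bsub>K\<^esub> act K x (act K g v)"
    and T: "T \<in> hom_super F H K" and u: "u \<in> carrier H" "T u \<noteq> \<zero>\<^bsub>K\<^esub>"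
  shows "\<exists>K'\<in>{K, parity_change K}. \<exists>T'\<in>hom_super (insert g F) H K'. \<exists>v\<in>carrier H. T' v \<noteq> \<zero>\<^bsub>K\<^esub>"
proof -
  interpret H: supermodule_over hA H by (rule supermodule_overI) fact
  interpret K: supermodule_over hA K by (rule supermodule_overI) fact
  note D = hom_superD[OF T]
  have gh: "g \<in> hA" and FhA: "\<And>x. x \<in> F \<Longrightarrow> x \<in> hA" using g F by auto
  have gpH: "act H g v \<in> part H (1 + p)" if "v \<in> part H p" for v p
    using H.act_part[of g 1 v p] g that by auto
  have gpK: "act K g v \<in> part K (1 + p)" if "v \<in> part K p" for v p
    using K.act_part[of g 1 v p] g that by auto
  define T1 where "T1 v = T v \<oplus>\<^bsub>K\<^esub> act K g (T (act H g v))" for v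
  show ?thesis
  proof (cases "\<exists>v\<in>carrier H. T1 v \<noteq> \<zero>\<^bsub>K\<^esub>")
    case True
    have "T1 \<in> hom_super (insert g F) H K"
    proof (rule hom_superI)
      fix p v assume v: "v \<in> part H p"
      have "act K g (T (act H g v)) \<in> part K (1 + (1 + p))"
        by (intro gpK D(4) gpH v)
      then have "act K g (T (act H g v)) \<in> part K p"
        by (simp only: add.assoc[symmetric] bit_add_self add_0)
      then show "T1 v \<in> part K p" using D(4)[OF v] by (simp add: T1_def K.part_closed)
    next
      fix x v assume x: "x \<in> insert g F" and v: "v \<in> carrier H"
      show "T1 (act H x v) = act K x (T1 v)"
      proof (cases "x = g")
        case True
        then show ?thesis using v gh by (simp add: T1_def D ggH ggK K.act_add K.V.M.a_comm)
      next
        case False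
        then have x: "x \<in> F" using x by simp
        \<comment> \<open>Moving \<open>x\<close> past \<open>g\<close> once in \<open>H\<close> and
          once in \<open>K\<close> produces two signs, which cancel. So averaging keeps the
          commutation with \<open>F\<close>.\<close>
        have "act K g (T (act H g (act H x v))) = act K x (act K g (T (act H g v)))"
          using x v gh FhA[OF x]
          by (simp add: gxH gxK D D(5)[OF x] K.act_smult K.smult_smult)
        then show ?thesis using x v gh FhA[OF x] by (simp add: T1_def D(1) D(5)[OF x] K.act_add)
      qed
    qed (auto simp: T1_def D gh H.act_add H.act_smult K.act_add K.act_smult K.smult_add K.V.M.a_ac)
    then show ?thesis using True by blast
  next
    case False
    then have zero: "T v \<oplus>\<^bsub>K\<^esub> act K g (T (act H g v)) = \<zero>\<^bsub>K\<^esub>" if "v \<in> carrier H" for v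
      using that by (auto simp: T1_def)
    \<comment> \<open>Since \<open>g\<close> squares to the identity, this says that
      \<open>T\<close> anticommutes with \<open>g\<close>.\<close>
    have anti: "(-1) \<odot>\<^bsub>K\<^esub> act K g (T (act H g v)) = T v" if v: "v \<in> carrier H" for v
      using K.V.M.minus_equality[OF zero[OF v]] v gh D by (simp add: K.minus_eq_smult[symmetric])
    obtain s where s:
      "\<And>w. w \<in> carrier H \<Longrightarrow> s w \<in> carrier H"
      "\<And>w w'. w \<in> carrier H \<Longrightarrow> w' \<in> carrier H \<Longrightarrow> s (w \<oplus>\<^bsub>H\<^esub> w') = s w \<oplus>\<^bsub>H\<^esub> s w'"
      "\<And>c w. w \<in> carrier H \<Longrightarrow> s (c \<odot>\<^bsub>H\<^esub> w) = c \<odot>\<^bsub>H\<^esub> s w"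
      "\<And>x w. x \<in> hA \<Longrightarrow> w \<in> carrier H \<Longrightarrow> s (act H x w) = act H (q_inv x) (s w)"
      and sp: "\<And>w r. w \<in> part H r \<Longrightarrow> s w = (if r = 0 then 1 else -1) \<odot>\<^bsub>H\<^esub> w"
      by (rule supermodule_involution[OF H]) (rule that, assumption+)
    have sx: "s (act H x w) = (-1) \<odot>\<^bsub>H\<^esub> act H x (s w)" if "x \<in> insert g F" "w \<in> carrier H" for x w
    proof -
      have x: "x \<in> hA" "x \<in> q_part 1" using that F g by auto
      then show ?thesis using s(4)[OF x(1) that(2)] q_inv_part[OF x(2)] s(1)[OF that(2)]
        by (simp add: H.scale_act)
    qed
    \<comment> \<open>The involution \<open>s\<close> anticommutes with every odd element. For
      \<open>g\<close>, its sign cancels the one from \<open>anti\<close>; for \<open>x\<close> in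
      \<open>F\<close>, it cancels the sign from moving \<open>x\<close> past the outer
      \<open>g\<close>.\<close>
    define T2 where "T2 v = act K g (T (s v))" for v
    have "T2 \<in> hom_super (insert g F) H (parity_change K)"
    proof (rule hom_superI)
      fix p v assume v: "v \<in> part H p"
      have "s v \<in> part H p" using sp[OF v] H.part_closed(4)[OF v] by simp
      then have "T2 v \<in> part K (1 + p)" unfolding T2_def by (intro gpK D(4))
      then show "T2 v \<in> part (parity_change K) p" by (simp only: parity_change_simps add.commute)
    next
      fix x v assume x: "x \<in> insert g F" and v: "v \<in> carrier H"
      show "T2 (act H x v) = act (parity_change K) x (T2 v)"
      proof (cases "x = g")
        case True
        have "T2 (act H g v) = (-1) \<odot>\<^bsub>K\<^esub> act K g (T (act H g (s v)))"
          using v gh by (simp add: T2_def sx s D K.act_smult)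
        also have "\<dots> = T (s v)" using anti s(1)[OF v] by blast
        finally show ?thesis using True v by (simp add: T2_def ggK D s)
      next
        case False
        then have x: "x \<in> F" using x by simp
        then show ?thesis using v gh FhA[OF x]
          by (simp add: T2_def sx s D D(5)[OF x] gxK K.act_smult K.smult_smult)
      qed
    qed (auto simp: T2_def s D gh K.act_add K.act_smult)
    moreover have "\<exists>v\<in>carrier H. T2 v \<noteq> \<zero>\<^bsub>K\<^esub>"
    proof -
      obtain u0 u1 where u01: "u0 \<in> part H 0" "u1 \<in> part H 1" "u = u0 \<oplus>\<^bsub>H\<^esub> u1"
        using H.part_decomposition[OF u(1)] by blast
      have c: "u0 \<in> carrier H" "u1 \<in> carrier H" using u01 H.part_carrier by auto
      have "T u0 \<noteq> \<zero>\<^bsub>K\<^esub> \<or> T u1 \<noteq> \<zero>\<^bsub>K\<^esub>"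
        using u(2) c by (auto simp: u01(3) D)
      \<comment> \<open>A homogeneous vector is needed here, because on it \<open>s\<close> is
        multiplication by a sign.\<close>
      then obtain r v where v: "v \<in> part H r" "T v \<noteq> \<zero>\<^bsub>K\<^esub>" using u01 by blast
      have vc: "v \<in> carrier H" using v H.part_carrier by auto
      have "T (s v) = (if r = 0 then 1 else -1) \<odot>\<^bsub>K\<^esub> T v" using sp[OF v(1)] D(3)[OF vc] by simp
      then have Tsv: "T (s v) \<noteq> \<zero>\<^bsub>K\<^esub>"
        using v(2) D(1)[OF vc] by (auto simp: K.smult_eq_zero_iff)
      have "T2 v \<noteq> \<zero>\<^bsub>K\<^esub>"
      proof
        assume "T2 v = \<zero>\<^bsub>K\<^esub>"
        then have "act K g (act K g (T (s v))) = \<zero>\<^bsub>K\<^esub>" using gh by (simp add: T2_def)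
        then show False using Tsv ggK D(1)[OF s(1)[OF vc]] by simp
      qed
      then show ?thesis using vc by blast
    qed
    ultimately show ?thesis by blast
  qed
qed

section \<open>The Clifford action of the odd part of h (x) A, identified with vectors over
  A\<close>

definition odd_diag :: "'a::comm_complex_algebra_1^'n::finite \<Rightarrow> ('a, 'n) queer" where
  "odd_diag d = (0, \<chi> i j. if i = j then d $ i else 0)"

lemma odd_diag_in: "odd_diag d \<in> hA" "odd_diag d \<in> q_part 1"
  by (simp_all add: odd_diag_def hA_def q_part_def)

lemma odd_diag_add: "odd_diag (d + e) = odd_diag d + odd_diag e"
  by (simp add: odd_diag_def vec_eq_iff)

lemma odd_diag_scale: "odd_diag (\<chi> i. c *\<^sub>C d $ i) = q_scale c (odd_diag d)"
  by (simp add: odd_diag_def q_scale_def map_matrix_def vec_eq_iff scaleC_zero_right)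

lemma odd_diag_snd: "x \<in> hA \<Longrightarrow> odd_diag (\<chi> i. snd x $ i $ i) = (0, snd x)"
  by (auto simp: odd_diag_def hA_def vec_eq_iff)

lemma q_bracket_odd_diag:
  "q_bracket (odd_diag d) (odd_diag e) = (\<chi> i j. if i = j then 2 * (d $ i * e $ i) else 0, 0)"
proof -
  have *: "(\<chi> i j. if i = j then d $ i else 0) ** (\<chi> i j. if i = j then e $ i else 0)
      = (\<chi> i j. if i = j then d $ i * e $ i else 0)" for d e :: "'a^'n"
  proof -
    have "(\<Sum>k\<in>UNIV. (if i = k then d $ i else 0) * (if k = j then e $ k else 0))
        = (\<Sum>k\<in>UNIV. if k = i then (if i = j then d $ i * e $ i else 0) else 0)" for i j
      by (rule sum.cong) auto
    then show ?thesis by (simp add: vec_eq_iff matrix_matrix_mult_def)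
  qed
  show ?thesis
    by (simp add: q_bracket_def odd_diag_def *) (simp add: vec_eq_iff algebra_simps)
qed

lemma q_bracket_odd_diag_in_h0A: "q_bracket (odd_diag d) (odd_diag e) \<in> h0A"
  by (simp add: q_bracket_odd_diag h0A_def hA_def q_part_def)

text \<open>The Clifford relation. The superbracket of two odd elements is their anticommutator, and
  here it lies in \<open>h0A\<close>, which acts through \<psi>.\<close>

lemma odd_diag_anticommute:
  fixes M (structure)
  assumes M: "supermodule hA M" and h: "\<forall>x\<in>h0A. \<forall>v\<in>carrier M. act M x v = \<psi> x \<odot> v"
    and v: "v \<in> carrier M"
  shows "act M (odd_diag d) (act M (odd_diag e) v)
    = \<psi> (q_bracket (odd_diag d) (odd_diag e)) \<odot> v \<oplus> (-1) \<odot> act M (odd_diag e) (act M (odd_diag d) v)"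
proof -
  interpret supermodule_over hA M by (rule supermodule_overI) fact
  let ?a = "act M (odd_diag d) (act M (odd_diag e) v)" and ?b = "act M (odd_diag e) (act M (odd_diag d) v)"
  have c: "?a \<in> carrier M" "?b \<in> carrier M" using v by (simp_all add: odd_diag_in)
  have "\<psi> (q_bracket (odd_diag d) (odd_diag e)) \<odot> v = act M (q_bracket (odd_diag d) (odd_diag e)) v"
    using h q_bracket_odd_diag_in_h0A v by metis
  also have "\<dots> = ?a \<ominus> (-1) \<odot> ?b"
    using act_bracket[of "odd_diag d" "odd_diag e" 1 1 v] v by (simp add: odd_diag_in super_sign_def)
  also have "\<dots> = ?a \<oplus> ?b" using c by (simp add: diff_eq_smult smult_smult)
  finally show ?thesis using c by (simp add: V.M.a_assoc smult_minus V.M.r_neg)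
qed

text \<open>A radical element anticommutes with the odd diagonal action and commutes with the even
  one, which is scalar; so its image is a graded submodule. Its square is zero. If the image were
  everything, every vector would have the form \<open>d u\<close> and be killed by \<open>d\<close>;
  otherwise simplicity makes the image zero.\<close>

lemma odd_diag_radical:
  fixes M (structure)
  assumes M: "supermodule hA M" and simple: "simple_module hA M"
    and h: "\<forall>x\<in>h0A. \<forall>v\<in>carrier M. act M x v = \<psi> x \<odot> v"
    and d: "\<And>e. \<psi> (q_bracket (odd_diag d) (odd_diag e)) = 0" and v: "v \<in> carrier M"
  shows "act M (odd_diag d) v = \<zero>"
proof -
  interpret supermodule_over hA M by (rule supermodule_overI) fact
  note anti = odd_diag_anticommute[OF M h]
  let ?N = "act M (odd_diag d) ` carrier M"
  have sq: "act M (odd_diag d) (act M (odd_diag d) u) = \<zero>" if u: "u \<in> carrier M" for u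
  proof -
    let ?a = "act M (odd_diag d) (act M (odd_diag d) u)"
    have a: "?a \<in> carrier M" using u by (simp add: odd_diag_in)
    have e: "?a = (-1) \<odot> ?a" using anti[OF u, of d d] a u by (simp add: d)
    have "(1 + 1) \<odot> ?a = ?a \<oplus> ?a" using a by (simp only: add_smult one_smult)
    also have "\<dots> = ?a \<oplus> (-1) \<odot> ?a" using e by simp
    also have "\<dots> = \<zero>" using a by (simp add: smult_minus V.M.r_neg)
    finally show ?thesis using a by (simp add: smult_eq_zero_iff)
  qed
  have "graded_submodule hA ?N M"
    unfolding graded_submodule_def
  proof (intro conjI ballI)
    show "VectorSpace.subspace complex_field ?N M"
    proof (rule subspaceI)
      show "\<zero> \<in> ?N"
        using act_zero[OF odd_diag_in(1), of d] V.M.zero_closed by (metis image_eqI)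
    qed (auto simp: odd_diag_in simp flip: act_add act_smult)
    fix n assume "n \<in> ?N"
    then obtain u where u: "u \<in> carrier M" "n = act M (odd_diag d) u" by blast
    obtain u0 u1 where u01: "u0 \<in> part M 0" "u1 \<in> part M 1" "u = u0 \<oplus> u1"
      using part_decomposition[OF u(1)] by blast
    have c: "u0 \<in> carrier M" "u1 \<in> carrier M" using u01 part_carrier by auto
    have p: "act M (odd_diag d) u1 \<in> part M 0" "act M (odd_diag d) u0 \<in> part M 1"
      using act_part[OF odd_diag_in u01(1), of d] act_part[OF odd_diag_in u01(2), of d] by simp_all
    have "n = act M (odd_diag d) u1 \<oplus> act M (odd_diag d) u0"
      using c by (simp add: u u01(3) odd_diag_in act_add V.M.a_comm)
    then show "\<exists>v0\<in>?N \<inter> part M 0. \<exists>v1\<in>?N \<inter> part M 1. n = v0 \<oplus> v1"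
      using p c by blast
    \<comment> \<open>An element of \<open>hA\<close> is an even diagonal part, acting by a scalar,
      plus an \<open>odd_diag\<close>; both preserve the image of the radical element.\<close>
    fix x :: "('a, 'b) queer" assume x: "x \<in> hA"
    define x0 where "x0 = (fst x, 0 :: 'a^'b^'b)"
    let ?e = "\<chi> i. snd x $ i $ i"
    have x0: "x0 \<in> h0A" "x0 \<in> hA" using x by (auto simp: x0_def h0A_def hA_def q_part_def)
    have x_eq: "x0 + odd_diag ?e = x" using odd_diag_snd[OF x] by (simp add: x0_def prod_eq_iff)
    have n: "n \<in> carrier M" using u by (simp add: odd_diag_in)
    then have "act M x n = \<psi> x0 \<odot> n \<oplus> act M (odd_diag ?e) n"
      using add_act[OF x0(2) odd_diag_in(1) n, of ?e] h x0(1) unfolding x_eq by simp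
    also have "act M (odd_diag ?e) n = (-1) \<odot> act M (odd_diag d) (act M (odd_diag ?e) u)"
      using anti[OF u(1), of d ?e] u(1) by (simp add: d u(2) odd_diag_in smult_smult)
    also have "\<psi> x0 \<odot> n \<oplus> \<dots> = act M (odd_diag d) (\<psi> x0 \<odot> u \<oplus> (-1) \<odot> act M (odd_diag ?e) u)"
      using u by (simp add: act_add act_smult odd_diag_in)
    finally show "act M x n \<in> ?N" using u(1) by (auto simp: odd_diag_in)
  qed
  then have "?N = {\<zero>} \<or> ?N = carrier M"
    using simple by (simp add: simple_module_def)
  then show ?thesis
  proof
    assume "?N = {\<zero>}"
    then show ?thesis using v by blast
  next
    assume "?N = carrier M"
    then obtain u where "u \<in> carrier M" "v = act M (odd_diag d) u" using v by blast
    then show ?thesis using sq by simp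
  qed
qed

text \<open>Twice the square of an odd operator is the action of its bracket with itself, here
  multiplication by 2.\<close>

lemma odd_diag_square:
  fixes M (structure)
  assumes M: "supermodule hA M" and h: "\<forall>x\<in>h0A. \<forall>v\<in>carrier M. act M x v = \<psi> x \<odot> v"
    and d: "\<psi> (q_bracket (odd_diag d) (odd_diag d)) = 2" and v: "v \<in> carrier M"
  shows "act M (odd_diag d) (act M (odd_diag d) v) = v"
proof -
  interpret supermodule_over hA M by (rule supermodule_overI) fact
  let ?a = "act M (odd_diag d) (act M (odd_diag d) v)"
  have a: "?a \<in> carrier M" using v by (simp add: odd_diag_in)
  have e: "?a = 2 \<odot> v \<oplus> (-1) \<odot> ?a"
    using odd_diag_anticommute[OF M h v, of d d] d by simp
  have "(1 + 1) \<odot> ?a = ?a \<oplus> ?a" using a by (simp only: add_smult one_smult)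
  also have "\<dots> = (2 \<odot> v \<oplus> (-1) \<odot> ?a) \<oplus> ?a" using e by simp
  also have "\<dots> = 2 \<odot> v" using a v by (simp add: V.M.a_assoc smult_minus V.M.l_neg)
  finally have "inverse 2 \<odot> (2 \<odot> ?a) = inverse 2 \<odot> (2 \<odot> v)" by simp
  then show ?thesis using a v by (simp add: smult_smult)
qed

lemma parity_change_twice [simp]: "parity_change (parity_change M) = M"
proof -
  have "(p + 1) + 1 = p" for p :: bit by (simp only: add.assoc bit_add_self add_0_right)
  then show ?thesis by (simp add: parity_change_def)
qed

theorem is_H_unique:
  fixes \<psi> :: "('a::comm_complex_algebra_1, 'n::finite) queer \<Rightarrow> complex"
    and H :: "(('a, 'n) queer, 'h) supermodule" and K :: "(('a, 'n) queer, 'k) supermodule"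
  assumes \<psi>: "\<psi> \<in> map_weights" and H: "is_H \<psi> H" and K: "is_H \<psi> K"
  shows "iso_super hA H K \<or> iso_super hA H (parity_change K)"
proof -
  have H': "supermodule hA H" "simple_module hA H" "\<forall>x\<in>h0A. \<forall>v\<in>carrier H. act H x v = \<psi> x \<odot>\<^bsub>H\<^esub> v"
    and K': "supermodule hA K" "simple_module hA K" "\<forall>x\<in>h0A. \<forall>v\<in>carrier K. act K x v = \<psi> x \<odot>\<^bsub>K\<^esub> v"
    using H K by (simp_all add: is_H_def)
  interpret H: supermodule_over hA H by (rule supermodule_overI) fact
  interpret K: supermodule_over hA K by (rule supermodule_overI) fact
  \<comment> \<open>The symmetric form of the Clifford algebra, on vectors over A; with the scalar
    multiplication \<open>sc\<close> below it has the shape required by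
    \<open>orthogonal_system_exists\<close>.\<close>
  define B where "B d e = \<psi> (q_bracket (odd_diag d) (odd_diag e))" for d e :: "'a^'n"
  define sc where "sc c d = (\<chi> i. c *\<^sub>C d $ i)" for c and d :: "'a^'n"
  interpret A: vector_space "scaleC :: complex \<Rightarrow> 'a \<Rightarrow> 'a"
    by standard (simp_all add: scaleC_add_right scaleC_add_left scaleC_scaleC scaleC_one)
  have vs: "vector_space sc"
    by standard (simp_all add: sc_def vec_eq_iff scaleC_add_right scaleC_add_left scaleC_scaleC scaleC_one)
  interpret E: vector_space sc by (rule vs)
  have lin: "\<And>x y. x \<in> h0A \<Longrightarrow> y \<in> h0A \<Longrightarrow> \<psi> (x + y) = \<psi> x + \<psi> y"
      "\<And>c x. x \<in> h0A \<Longrightarrow> \<psi> (q_scale c x) = c * \<psi> x"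
    using \<psi> by (auto simp: map_weights_def linear_on_h0A_def)
  have sym: "B d e = B e d" for d e
  proof -
    have "q_bracket (odd_diag d) (odd_diag e) = q_bracket (odd_diag e) (odd_diag d)"
      by (simp add: q_bracket_odd_diag vec_eq_iff mult.commute)
    then show ?thesis by (simp add: B_def)
  qed
  have B_add: "B (d + d') e = B d e + B d' e" for d d' e
  proof -
    have "q_bracket (odd_diag (d + d')) (odd_diag e)
        = q_bracket (odd_diag d) (odd_diag e) + q_bracket (odd_diag d') (odd_diag e)"
      by (simp add: q_bracket_odd_diag vec_eq_iff algebra_simps)
    then show ?thesis by (simp add: B_def lin q_bracket_odd_diag_in_h0A)
  qed
  have B_scale: "B (sc c d) e = c * B d e" for c d e
  proof -
    have "q_bracket (odd_diag (sc c d)) (odd_diag e) = q_scale c (q_bracket (odd_diag d) (odd_diag e))"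
    proof -
      have "2 * ((c *\<^sub>C d $ i) * e $ i) = c *\<^sub>C (2 * (d $ i * e $ i))" for i
        by (simp only: mult_scaleC_left mult.commute[of 2])
      then show ?thesis
        by (simp add: q_bracket_odd_diag sc_def q_scale_def)
           (simp add: vec_eq_iff map_matrix_def scaleC_zero_right)
    qed
    then show ?thesis by (simp add: B_def lin q_bracket_odd_diag_in_h0A)
  qed
  obtain J where J: "algebra_ideal J" "finite_codimension J"
      and \<psi>J: "\<And>x. x \<in> h0A \<Longrightarrow> (\<And>i j. fst x $ i $ j \<in> J) \<Longrightarrow> \<psi> x = 0"
    using \<psi> by (auto simp: map_weights_def)
  have J_closed: "0 \<in> J" "\<And>a b. a \<in> J \<Longrightarrow> b \<in> J \<Longrightarrow> a + b \<in> J" "\<And>r a. a \<in> J \<Longrightarrow> r * a \<in> J"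
    using J(1) by (auto simp: algebra_ideal_def)
  have "A.span J = J"
  proof (rule A.span_unique)
    show "A.subspace J"
      unfolding A.subspace_def using J_closed mult_scaleC_left[of _ 1] by (metis mult_1)
  qed auto
  obtain Bs where Bs: "finite Bs" "A.span (Bs \<union> J) = UNIV"
    using J(2) by (auto simp: finite_codimension_def)
  have mod_J: "\<exists>b\<in>A.span Bs. a - b \<in> J" for a
  proof -
    have "a \<in> A.span (Bs \<union> J)" unfolding Bs(2) by (rule UNIV_I)
    then obtain b c where "a = b + c" "b \<in> A.span Bs" "c \<in> J"
      unfolding A.span_Un \<open>A.span J = J\<close> by (elim CollectE exE conjE)
    then show ?thesis by (intro bexI[of _ b]) simp_all
  qed
  \<comment> \<open>Finitely many representatives spanning A modulo \<open>J\<close>, placed in each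
    coordinate: they span the vectors over A modulo vectors with entries in
    \<open>J\<close>.\<close>
  define X where "X = (\<lambda>(k, b). axis k b :: 'a^'n) ` (UNIV \<times> Bs)"
  have X: "finite X" by (simp add: X_def Bs)
  have axis_span: "axis k b \<in> E.span X" if "b \<in> A.span Bs" for k :: 'n and b
    using that
  proof (induction rule: A.span_induct_alt)
    case base
    have "axis k 0 = (0 :: 'a^'n)" by (simp add: axis_def vec_eq_iff)
    then show ?case by (simp only: E.span_zero)
  next
    case (step c x y)
    have "axis k (c *\<^sub>C x + y) = sc c (axis k x) + axis k y"
      by (simp add: axis_def sc_def vec_eq_iff scaleC_zero_right)
    moreover have "axis k x \<in> E.span X" unfolding X_def using step(1) by (intro E.span_base) auto
    ultimately show ?case using step(2) by (simp only: E.span_add E.span_scale)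
  qed
  have X_span: "\<exists>y\<in>E.span X. \<forall>z. B (x - y) z = 0" for x
  proof -
    have "\<forall>i. \<exists>b. b \<in> A.span Bs \<and> x $ i - b \<in> J" using mod_J by blast
    from choice[OF this] obtain b where b: "\<And>i. b i \<in> A.span Bs" "\<And>i. x $ i - b i \<in> J" by blast
    have b_sum: "(\<chi> i. b i) = (\<Sum>k\<in>UNIV. axis k (b k))"
      by (simp add: vec_eq_iff axis_def)
    have "(\<chi> i. b i) \<in> E.span X"
      unfolding b_sum by (intro E.span_sum axis_span b(1))
    moreover have "B (x - (\<chi> i. b i)) z = 0" for z
      unfolding B_def
    proof (rule \<psi>J[OF q_bracket_odd_diag_in_h0A])
      \<comment> \<open>The entries of the bracket are multiples of \<open>x $ i - b i\<close>.
        Since \<open>J\<close> is an ideal they stay in \<open>J\<close>, where \<psi> vanishes;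
        thus vectors with entries in \<open>J\<close> are in the radical.\<close>
      have eq: "2 * ((x $ i - b i) * z $ i) = (2 * z $ i) * (x $ i - b i)" for i by (simp add: mult_ac)
      have "2 * ((x $ i - b i) * z $ i) \<in> J" for i unfolding eq by (rule J_closed(3)[OF b(2)])
      then show "fst (q_bracket (odd_diag (x - (\<chi> i. b i))) (odd_diag z)) $ i $ j \<in> J" for i j
        using J_closed(1) by (simp add: q_bracket_odd_diag)
    qed
    ultimately show ?thesis by blast
  qed
  obtain G where G: "finite G" "\<And>g. g \<in> G \<Longrightarrow> B g g = 2" "\<And>g h. g \<in> G \<Longrightarrow> h \<in> G \<Longrightarrow> g \<noteq> h \<Longrightarrow> B g h = 0"
      "\<And>x. \<exists>y\<in>E.span G. \<forall>z. B (x - y) z = 0"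
    by (rule orthogonal_system_exists[OF vs sym B_add B_scale X X_span]) (rule that)
  have rel: "supermodule hA N \<and> simple_module hA N \<and>
      (\<forall>x\<in>h0A. \<forall>v\<in>carrier N. act N x v = \<psi> x \<odot>\<^bsub>N\<^esub> v)" if "N \<in> {K, parity_change K}" for N
    using that K' by (auto simp: supermodule_parity_change simple_module_parity_change)
  \<comment> \<open>The target may switch between \<open>K\<close> and its parity change at each new
    vector. This pair is closed under a further shift, so one alternative is enough for all of
    \<open>G\<close>.\<close>
  have ex: "\<exists>N\<in>{K, parity_change K}. \<exists>T\<in>hom_super (odd_diag ` F) H N. \<exists>v\<in>carrier H. T v \<noteq> \<zero>\<^bsub>K\<^esub>"
    if "finite F" "F \<subseteq> G" for F
    using that
  proof (induction F rule: finite_induct)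
    case empty
    have "carrier H \<noteq> {\<zero>\<^bsub>H\<^esub>}" "carrier K \<noteq> {\<zero>\<^bsub>K\<^esub>}" using H'(2) K'(2) by (simp_all add: simple_module_def)
    then show ?case using nonzero_linear_map_exists[OF H'(1) _ K'(1)] by simp
  next
    case (insert g F)
    then obtain N T u where N: "N \<in> {K, parity_change K}" and T: "T \<in> hom_super (odd_diag ` F) H N"
        and u: "u \<in> carrier H" "T u \<noteq> \<zero>\<^bsub>K\<^esub>"
      by blast
    have NK: "\<zero>\<^bsub>N\<^esub> = \<zero>\<^bsub>K\<^esub>" "{N, parity_change N} = {K, parity_change K}" using N by auto
    have NR: "supermodule hA N" "\<forall>x\<in>h0A. \<forall>v\<in>carrier N. act N x v = \<psi> x \<odot>\<^bsub>N\<^esub> v"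
      using rel[OF N] by auto
    interpret N: supermodule_over hA N by (rule supermodule_overI) fact
    have g: "g \<in> G" and F: "\<And>h. h \<in> F \<Longrightarrow> h \<in> G \<and> g \<noteq> h" using insert by auto
    have "\<exists>N'\<in>{N, parity_change N}. \<exists>T'\<in>hom_super (insert (odd_diag g) (odd_diag ` F)) H N'.
        \<exists>v\<in>carrier H. T' v \<noteq> \<zero>\<^bsub>N\<^esub>"
    proof (rule commuting_map_step[OF H'(1) NR(1) _ _ _ _ _ _ T u(1)])
      show "act H (odd_diag g) (act H (odd_diag g) v) = v" if "v \<in> carrier H" for v
        using odd_diag_square[OF H'(1,3) _ that] G(2)[OF g] by (simp add: B_def)
      show "act N (odd_diag g) (act N (odd_diag g) v) = v" if "v \<in> carrier N" for v
        using odd_diag_square[OF NR _ that] G(2)[OF g] by (simp add: B_def)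
      show "act H (odd_diag g) (act H x v) = (-1) \<odot>\<^bsub>H\<^esub> act H x (act H (odd_diag g) v)"
        if "x \<in> odd_diag ` F" "v \<in> carrier H" for x v
        using that odd_diag_anticommute[OF H'(1,3) that(2), of g] G(3)[OF g] F
        by (auto simp: B_def odd_diag_in)
      show "act N (odd_diag g) (act N x v) = (-1) \<odot>\<^bsub>N\<^esub> act N x (act N (odd_diag g) v)"
        if "x \<in> odd_diag ` F" "v \<in> carrier N" for x v
        using that odd_diag_anticommute[OF NR that(2), of g] G(3)[OF g] F
        by (auto simp: B_def odd_diag_in)
    qed (use u NK odd_diag_in in auto)
    then show ?case unfolding NK image_insert .
  qed
  obtain N T u where N: "N \<in> {K, parity_change K}" and T: "T \<in> hom_super (odd_diag ` G) H N"
      and u: "u \<in> carrier H" "T u \<noteq> \<zero>\<^bsub>K\<^esub>"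
    using ex[OF G(1) subset_refl] by blast
  have NR: "supermodule hA N" "simple_module hA N" "\<forall>x\<in>h0A. \<forall>v\<in>carrier N. act N x v = \<psi> x \<odot>\<^bsub>N\<^esub> v"
    using rel[OF N] by auto
  interpret N: supermodule_over hA N by (rule supermodule_overI) fact
  note D = hom_superD[OF T]
  have Nz: "\<zero>\<^bsub>N\<^esub> = \<zero>\<^bsub>K\<^esub>" using N by auto
  have T0: "T \<zero>\<^bsub>H\<^esub> = \<zero>\<^bsub>N\<^esub>" using D(3)[of "\<zero>\<^bsub>H\<^esub>" 0] D(1)[of "\<zero>\<^bsub>H\<^esub>"] by simp
  \<comment> \<open>On radical elements both sides of the intertwining identity are zero, so
    commutation with the span of \<open>G\<close> extends to all odd diagonal elements.\<close>
  have rad: "act H (odd_diag d) v = \<zero>\<^bsub>H\<^esub>" "act N (odd_diag d) (T v) = \<zero>\<^bsub>N\<^esub>"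
    if "\<And>e. B d e = 0" "v \<in> carrier H" for d v
    using that odd_diag_radical[OF H'] odd_diag_radical[OF NR] D(1) by (simp_all add: B_def)
  have T_span: "T (act H (odd_diag d) v) = act N (odd_diag d) (T v)" if "d \<in> E.span G" "v \<in> carrier H" for d v
    using that(1)
  proof (induction rule: E.span_induct_alt)
    case base
    have "B 0 e = 0" for e using B_scale[of 0 0 e] by simp
    then show ?case using rad that(2) T0 by simp
  next
    case (step c g y)
    have "odd_diag (sc c g + y) = q_scale c (odd_diag g) + odd_diag y"
      by (simp add: odd_diag_add odd_diag_scale sc_def)
    moreover have "q_scale c (odd_diag g) \<in> hA"
      by (metis odd_diag_scale odd_diag_in(1))
    ultimately show ?case
      using step that(2)
      by (simp add: H.add_act N.add_act H.scale_act N.scale_act odd_diag_in D)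
  qed
  have T_odd: "T (act H (odd_diag d) v) = act N (odd_diag d) (T v)" if v: "v \<in> carrier H" for d v
  proof -
    obtain y where y: "y \<in> E.span G" "\<And>z. B (d - y) z = 0" using G(4) by blast
    have "odd_diag d = odd_diag (d - y) + odd_diag y" by (simp flip: odd_diag_add)
    then show ?thesis
      using T_span[OF y(1) v] rad[OF y(2) v] v
      by (simp add: H.add_act N.add_act odd_diag_in D)
  qed
  have "T \<in> hom_super hA H N"
  proof (rule hom_superI)
    fix x :: "('a, 'n) queer" and v assume x: "x \<in> hA" and v: "v \<in> carrier H"
    define x0 where "x0 = (fst x, 0 :: 'a^'n^'n)"
    let ?e = "\<chi> i. snd x $ i $ i"
    have x0: "x0 \<in> h0A" "x0 \<in> hA" using x by (auto simp: x0_def h0A_def hA_def q_part_def)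
    have x_eq: "x0 + odd_diag ?e = x" using odd_diag_snd[OF x] by (simp add: x0_def prod_eq_iff)
    have "act H x v = \<psi> x0 \<odot>\<^bsub>H\<^esub> v \<oplus>\<^bsub>H\<^esub> act H (odd_diag ?e) v"
      using H.add_act[OF x0(2) odd_diag_in(1) v, of ?e] H'(3) x0(1) v unfolding x_eq by simp
    moreover have "act N x (T v) = \<psi> x0 \<odot>\<^bsub>N\<^esub> T v \<oplus>\<^bsub>N\<^esub> act N (odd_diag ?e) (T v)"
      using N.add_act[OF x0(2) odd_diag_in(1) D(1)[OF v], of ?e] NR(3) x0(1) D(1)[OF v] unfolding x_eq by simp
    ultimately show "T (act H x v) = act N x (T v)"
      using v by (simp add: D odd_diag_in T_odd)
  qed (simp_all add: D)
  then have "iso_super hA H N"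
    using Schur_iso_super[OF H'(1,2) NR(1,2) _ u(1)] u(2) Nz by simp
  then show ?thesis using N by auto
qed

section \<open>Local Weyl modules as universal highest map-weight modules\<close>

lemma foldr_act_local_weyl:
  "foldr (act (local_weyl \<psi> H)) u (weyl_class \<psi> H (word [] w)) = weyl_class \<psi> H (word u w)"
  by (induction u) (simp_all add: local_weyl_act)

text \<open>The canonical map of generators itself satisfies the hypotheses of
  \<open>local_weyl_universal\<close>; precomposing it with a map of generators gives
  functoriality.\<close>

lemma local_weyl_generators:
  fixes H :: "(('a::comm_complex_algebra_1, 'n::{finite,linorder}) queer, 'h) supermodule"
    and \<psi> :: "('a, 'n) queer \<Rightarrow> complex"
  defines "\<iota> \<equiv> \<lambda>w. weyl_class \<psi> H (word [] w)"
  assumes H: "supermodule hA H"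
  shows "\<iota> \<in> hom_super hA H (local_weyl \<psi> H)"
    and "x \<in> nA \<Longrightarrow> w \<in> carrier H \<Longrightarrow> act (local_weyl \<psi> H) x (\<iota> w) = \<zero>\<^bsub>local_weyl \<psi> H\<^esub>"
    and "x \<in> h0A \<Longrightarrow> w \<in> carrier H \<Longrightarrow> act (local_weyl \<psi> H) x (\<iota> w) = \<psi> x \<odot>\<^bsub>local_weyl \<psi> H\<^esub> \<iota> w"
    and "next_index i j \<Longrightarrow> of_nat m = \<psi> (h_elem i j) \<Longrightarrow> w \<in> carrier H \<Longrightarrow>
      (act (local_weyl \<psi> H) (f_elem i j) ^^ (m + 1)) (\<iota> w) = \<zero>\<^bsub>local_weyl \<psi> H\<^esub>"
proof -
  interpret H: supermodule_over hA H by (rule supermodule_overI) fact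
  let ?W = "local_weyl \<psi> H"
  have W: "carrier ?W = weyl_class \<psi> H ` Modules.module.span free_scale {word u w | u w. w \<in> carrier H}"
    "\<And>p. part ?W p = weyl_class \<psi> H ` Modules.module.span free_scale (homogeneous_words H p)"
    "\<zero>\<^bsub>?W\<^esub> = weyl_class \<psi> H 0"
    by (simp_all add: local_weyl_def)
  note rel = weyl_relations_relator[of _ \<psi> H]
  show "\<iota> \<in> hom_super hA H ?W"
  proof (rule hom_superI)
    show "\<iota> w \<in> carrier ?W" if "w \<in> carrier H" for w
      using that by (auto simp: \<iota>_def W intro!: imageI free.span_base)
    show "\<iota> w \<in> part ?W p" if "w \<in> part H p" for w p
    proof -
      have "p = sum_list [] + p" by (simp only: sum_list.Nil add_0)
      then have "word [] w \<in> homogeneous_words H p"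
        unfolding homogeneous_words_def using that by blast
      then show ?thesis by (auto simp: \<iota>_def W intro!: imageI free.span_base)
    qed
    show "\<iota> (v \<oplus>\<^bsub>H\<^esub> w) = \<iota> v \<oplus>\<^bsub>?W\<^esub> \<iota> w" if "v \<in> carrier H" "w \<in> carrier H" for v w
      using rel[OF weyl_relators.gen_add[OF that, of "[]"]]
      by (simp add: \<iota>_def local_weyl_add weyl_class_eq_iff diff_diff_eq)
    show "\<iota> (c \<odot>\<^bsub>H\<^esub> w) = c \<odot>\<^bsub>?W\<^esub> \<iota> w" if "w \<in> carrier H" for c w
      using rel[OF weyl_relators.gen_scale[OF that, of "[]"]]
      by (simp add: \<iota>_def local_weyl_smult weyl_class_eq_iff)
    show "\<iota> (act H x w) = act ?W x (\<iota> w)" if "x \<in> hA" "w \<in> carrier H" for x w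
    proof -
      have "weyl_class \<psi> H (word [x] w) = weyl_class \<psi> H (word [] (act H x w))"
        using rel[OF weyl_relators.gen_act[OF that(2,1), of "[]"]] by (simp add: weyl_class_eq_iff)
      then show ?thesis by (simp add: \<iota>_def local_weyl_act)
    qed
  qed
  show "act ?W x (\<iota> w) = \<zero>\<^bsub>?W\<^esub>" if "x \<in> nA" "w \<in> carrier H"
    using rel[OF weyl_relators.rel_n[OF that(2,1), of "[]"]]
    by (simp add: \<iota>_def W local_weyl_act weyl_class_eq_iff)
  show "act ?W x (\<iota> w) = \<psi> x \<odot>\<^bsub>?W\<^esub> \<iota> w" if "x \<in> h0A" "w \<in> carrier H"
    using rel[OF weyl_relators.rel_h[OF that(2,1), of "[]"]]
    by (simp add: \<iota>_def local_weyl_act local_weyl_smult weyl_class_eq_iff)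
  show "(act ?W (f_elem i j) ^^ (m + 1)) (\<iota> w) = \<zero>\<^bsub>?W\<^esub>"
    if "next_index i j" "of_nat m = \<psi> (h_elem i j)" "w \<in> carrier H"
  proof -
    have "(act ?W (f_elem i j) ^^ (m + 1)) (\<iota> w) = weyl_class \<psi> H (word (replicate (m + 1) (f_elem i j)) w)"
      unfolding \<iota>_def foldr_replicate[symmetric] by (rule foldr_act_local_weyl)
    then show ?thesis
      using rel[OF weyl_relators.rel_f[of w H i j m \<psi> "[]", OF that(3,1,2)]] by (simp only: W weyl_class_eq_iff append_Nil diff_zero)
  qed
qed

text \<open>Functoriality from the universal property. The formula on words is kept in the
  conclusion so that composites can be computed.\<close>

lemma local_weyl_hom:
  fixes H :: "(('a::comm_complex_algebra_1, 'n::{finite,linorder}) queer, 'h) supermodule"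
    and K :: "(('a, 'n) queer, 'k) supermodule"
  assumes H: "supermodule hA H" and K: "supermodule hA K" and \<phi>: "\<phi> \<in> hom_super hA H K"
  obtains \<Phi> where "\<Phi> \<in> hom_super UNIV (local_weyl \<psi> H) (local_weyl \<psi> K)"
    "\<And>u w. w \<in> carrier H \<Longrightarrow> \<Phi> (weyl_class \<psi> H (word u w)) = weyl_class \<psi> K (word u (\<phi> w))"
proof -
  let ?\<iota> = "\<lambda>w. weyl_class \<psi> K (word [] w)"
  note gen = local_weyl_generators[where \<psi> = \<psi>, OF K]
  note D = hom_superD[OF \<phi>]
  have "?\<iota> \<circ> \<phi> \<in> hom_super hA H (local_weyl \<psi> K)"
    by (rule hom_super_comp[OF \<phi> gen(1)])
  then obtain \<Phi> where \<Phi>: "\<Phi> \<in> hom_super UNIV (local_weyl \<psi> H) (local_weyl \<psi> K)"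
      "\<And>u w. w \<in> carrier H \<Longrightarrow> \<Phi> (weyl_class \<psi> H (word u w)) = foldr (act (local_weyl \<psi> K)) u ((?\<iota> \<circ> \<phi>) w)"
  proof (rule local_weyl_universal[OF H supermodule_local_weyl[OF K], of _ \<psi>])
    show "(act (local_weyl \<psi> K) (f_elem i j) ^^ (m + 1)) ((?\<iota> \<circ> \<phi>) w) = \<zero>\<^bsub>local_weyl \<psi> K\<^esub>"
      if "next_index i j" "of_nat m = \<psi> (h_elem i j)" "w \<in> carrier H" for i j m w
      unfolding comp_apply by (rule gen(4)[OF that(1,2) D(1)[OF that(3)]])
    show "act (local_weyl \<psi> K) x ((?\<iota> \<circ> \<phi>) w) = \<zero>\<^bsub>local_weyl \<psi> K\<^esub>"
      if "x \<in> nA" "w \<in> carrier H" for x w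
      unfolding comp_apply by (rule gen(2)[OF that(1) D(1)[OF that(2)]])
    show "act (local_weyl \<psi> K) x ((?\<iota> \<circ> \<phi>) w) = \<psi> x \<odot>\<^bsub>local_weyl \<psi> K\<^esub> (?\<iota> \<circ> \<phi>) w"
      if "x \<in> h0A" "w \<in> carrier H" for x w
      unfolding comp_apply by (rule gen(3)[OF that(1) D(1)[OF that(2)]])
  qed (rule that)
  show thesis
    by (rule that[OF \<Phi>(1)]) (simp add: \<Phi>(2) foldr_act_local_weyl)
qed

text \<open>The uniqueness half of the universal property: classes of words span the module. It
  shows that the maps induced by mutually inverse isomorphisms are mutually inverse.\<close>

lemma local_weyl_endomorphism_id:
  fixes H :: "(('a::comm_complex_algebra_1, 'n::{finite,linorder}) queer, 'h) supermodule"
  assumes H: "supermodule hA H" and \<Omega>: "\<Omega> \<in> hom_super UNIV (local_weyl \<psi> H) (local_weyl \<psi> H)"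
    and words: "\<And>u w. w \<in> carrier H \<Longrightarrow> \<Omega> (weyl_class \<psi> H (word u w)) = weyl_class \<psi> H (word u w)"
    and X: "X \<in> carrier (local_weyl \<psi> H)"
  shows "\<Omega> X = X"
proof -
  let ?F = "Modules.module.span free_scale {word u w | u w. w \<in> carrier H} :: ('a, 'n, 'h) free_module set"
  have car: "carrier (local_weyl \<psi> H) = weyl_class \<psi> H ` ?F" and zero: "\<zero>\<^bsub>local_weyl \<psi> H\<^esub> = weyl_class \<psi> H 0"
    by (simp_all add: local_weyl_def)
  note D = hom_superD[OF \<Omega>]
  have sm: "supermodule UNIV (local_weyl \<psi> H)" by (rule supermodule_local_weyl[OF H])
  obtain f where f: "f \<in> ?F" "X = weyl_class \<psi> H f" using X by (auto simp: car)
  from f(1) have "f \<in> ?F \<and> \<Omega> (weyl_class \<psi> H f) = weyl_class \<psi> H f"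
  proof (induction rule: free.span_induct_alt)
    case base
    then show ?case using hom_super_zero[OF sm sm \<Omega>] by (simp add: zero free.span_zero)
  next
    case (step c s y)
    then obtain u w where s: "s = word u w" "w \<in> carrier H" by blast
    have F: "s \<in> ?F" "free_scale c s \<in> ?F" "y \<in> ?F"
      using step by (auto intro: free.span_base free.span_scale)
    then have in_W: "weyl_class \<psi> H s \<in> carrier (local_weyl \<psi> H)"
        "weyl_class \<psi> H (free_scale c s) \<in> carrier (local_weyl \<psi> H)"
        "weyl_class \<psi> H y \<in> carrier (local_weyl \<psi> H)"
      by (auto simp: car)
    have "\<Omega> (weyl_class \<psi> H s) = weyl_class \<psi> H s" using words s by simp
    then have "\<Omega> (weyl_class \<psi> H (free_scale c s)) = weyl_class \<psi> H (free_scale c s)"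
      using D(3)[OF in_W(1), of c] by (simp add: local_weyl_smult)
    then show ?case using D(2)[OF in_W(2,3)] step(2) F
      by (simp add: local_weyl_add free.span_add)
  qed
  then show ?thesis by (simp add: f)
qed

lemma local_weyl_iso:
  fixes H :: "(('a::comm_complex_algebra_1, 'n::{finite,linorder}) queer, 'h) supermodule"
    and K :: "(('a, 'n) queer, 'k) supermodule"
  assumes H: "supermodule hA H" and K: "supermodule hA K" and iso: "iso_super hA H K"
  shows "iso_super UNIV (local_weyl \<psi> H) (local_weyl \<psi> K)"
proof -
  obtain \<phi> where \<phi>: "\<phi> \<in> hom_super hA H K" "bij_betw \<phi> (carrier H) (carrier K)"
    using iso by (auto simp: iso_super_def)
  define \<theta> where "\<theta> = inv_into (carrier H) \<phi>"
  have \<theta>: "\<theta> \<in> hom_super hA K H" unfolding \<theta>_def by (rule hom_super_inv_into[OF H K \<phi>])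
  have inv: "\<And>v. v \<in> carrier H \<Longrightarrow> \<theta> (\<phi> v) = v" "\<And>w. w \<in> carrier K \<Longrightarrow> \<phi> (\<theta> w) = w"
    using bij_betw_inv_into_left[OF \<phi>(2)] bij_betw_inv_into_right[OF \<phi>(2)] by (simp_all add: \<theta>_def)
  obtain \<Phi> where \<Phi>: "\<Phi> \<in> hom_super UNIV (local_weyl \<psi> H) (local_weyl \<psi> K)"
      "\<And>u w. w \<in> carrier H \<Longrightarrow> \<Phi> (weyl_class \<psi> H (word u w)) = weyl_class \<psi> K (word u (\<phi> w))"
    using local_weyl_hom[OF H K \<phi>(1)] by blast
  obtain \<Theta> where \<Theta>: "\<Theta> \<in> hom_super UNIV (local_weyl \<psi> K) (local_weyl \<psi> H)"
      "\<And>u w. w \<in> carrier K \<Longrightarrow> \<Theta> (weyl_class \<psi> K (word u w)) = weyl_class \<psi> H (word u (\<theta> w))"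
    using local_weyl_hom[OF K H \<theta>] by blast
  have "\<Theta> (\<Phi> X) = X" if "X \<in> carrier (local_weyl \<psi> H)" for X
    using local_weyl_endomorphism_id[OF H hom_super_comp[OF \<Phi>(1) \<Theta>(1)] _ that] hom_superD(1)[OF \<phi>(1)]
    by (simp add: \<Phi>(2) \<Theta>(2) inv)
  moreover have "\<Phi> (\<Theta> X) = X" if "X \<in> carrier (local_weyl \<psi> K)" for X
    using local_weyl_endomorphism_id[OF K hom_super_comp[OF \<Theta>(1) \<Phi>(1)] _ that] hom_superD(1)[OF \<theta>]
    by (simp add: \<Phi>(2) \<Theta>(2) inv)
  ultimately have "bij_betw \<Phi> (carrier (local_weyl \<psi> H)) (carrier (local_weyl \<psi> K))"
    using hom_superD(1)[OF \<Phi>(1)] hom_superD(1)[OF \<Theta>(1)]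
    by (intro bij_betw_byWitness[of _ \<Theta>]) auto
  then show ?thesis using \<Phi>(1) by (auto simp: iso_super_def)
qed

text \<open>Finite dimension of \<open>V\<close> supplies the relation on powers of the lowering
  elements through \<open>f_elem_power_eq_zero\<close>; the other relations are part of being a
  highest map-weight module. Surjectivity holds because the image contains the generating subspace
  \<open>N\<close>.\<close>

lemma local_weyl_surjects_onto:
  fixes H :: "(('a::comm_complex_algebra_1, 'n::{finite,linorder}) queer, 'h) supermodule"
    and V :: "(('a, 'n) queer, 'v) supermodule"
  assumes H: "supermodule hA H" and iso: "iso_super hA H (restrict_to V N)"
    and fd: "fin_dim V" and V: "highest_map_weight_module \<psi> V N"
  shows "surjects_onto UNIV (local_weyl \<psi> H) V"
proof -
  have sm: "supermodule UNIV V" and gen: "generated_by UNIV V N" and "is_H \<psi> (restrict_to V N)"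
    and n: "\<And>x w. x \<in> nA \<Longrightarrow> w \<in> N \<Longrightarrow> act V x w = \<zero>\<^bsub>V\<^esub>"
    using V by (auto simp: highest_map_weight_module_def)
  have NV: "N \<subseteq> carrier V" using gen by (simp add: generated_by_def)
  have res [simp]: "carrier (restrict_to V N) = N" "part (restrict_to V N) p = part V p \<inter> N"
    "act (restrict_to V N) = act V" "v \<oplus>\<^bsub>restrict_to V N\<^esub> w = v \<oplus>\<^bsub>V\<^esub> w"
    "c \<odot>\<^bsub>restrict_to V N\<^esub> v = c \<odot>\<^bsub>V\<^esub> v" for p v w c
    by (simp_all add: restrict_to_def)
  have h: "act V x w = \<psi> x \<odot>\<^bsub>V\<^esub> w" if "x \<in> h0A" "w \<in> N" for x w
    using \<open>is_H \<psi> (restrict_to V N)\<close> that by (simp add: is_H_def)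
  obtain \<phi> where \<phi>: "\<phi> \<in> hom_super hA H (restrict_to V N)" "\<phi> ` carrier H = N"
    using iso by (auto simp: iso_super_def bij_betw_def)
  note D = hom_superD[OF \<phi>(1), simplified]
  have \<phi>V: "\<phi> \<in> hom_super hA H V"
    using NV D by (intro hom_superI) auto
  obtain \<Phi> where \<Phi>: "\<Phi> \<in> hom_super UNIV (local_weyl \<psi> H) V"
      "\<And>u w. w \<in> carrier H \<Longrightarrow> \<Phi> (weyl_class \<psi> H (word u w)) = foldr (act V) u (\<phi> w)"
  proof (rule local_weyl_universal[OF H sm \<phi>V, of \<psi>])
    show "act V x (\<phi> w) = \<zero>\<^bsub>V\<^esub>" if "x \<in> nA" "w \<in> carrier H" for x w
      using n that D(1) by simp
    show "act V x (\<phi> w) = \<psi> x \<odot>\<^bsub>V\<^esub> \<phi> w" if "x \<in> h0A" "w \<in> carrier H" for x w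
      using h that D(1) by simp
    show "(act V (f_elem i j) ^^ (m + 1)) (\<phi> w) = \<zero>\<^bsub>V\<^esub>"
      if "next_index i j" "of_nat m = \<psi> (h_elem i j)" "w \<in> carrier H" for i j m w
    proof (rule f_elem_power_eq_zero[OF sm fd])
      have ij: "i < j" using that(1) by (simp add: next_index_def)
      then show "i \<noteq> j" by simp
      have w: "\<phi> w \<in> N" using D(1) that(3) by simp
      then show "\<phi> w \<in> carrier V" using NV by auto
      show "act V (f_elem j i) (\<phi> w) = \<zero>\<^bsub>V\<^esub>" by (rule n[OF f_elem_in_nA[OF ij] w])
      show "act V (h_elem i j) (\<phi> w) = of_nat m \<odot>\<^bsub>V\<^esub> \<phi> w"
        using h[OF h_elem_in_h0A w] that(2) by simp
    qed
  qed (rule that)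
  have "N \<subseteq> \<Phi> ` carrier (local_weyl \<psi> H)"
  proof
    fix v assume "v \<in> N"
    then obtain w where w: "w \<in> carrier H" "v = \<phi> w" using \<phi>(2) by blast
    then have "v = \<Phi> (weyl_class \<psi> H (word [] w))" by (simp add: \<Phi>(2))
    then show "v \<in> \<Phi> ` carrier (local_weyl \<psi> H)"
      using hom_superD(1)[OF local_weyl_generators(1)[OF H] w(1)] by blast
  qed
  then have "\<Phi> ` carrier (local_weyl \<psi> H) = carrier V"
    by (rule hom_super_surj_generated[OF supermodule_local_weyl[OF H] sm \<Phi>(1) gen])
  then show ?thesis using \<Phi>(1) by (auto simp: surjects_onto_def)
qed

theorem theorem4p11:
  fixes \<psi> :: "('a::comm_complex_algebra_1, 'n::{finite,linorder}) queer \<Rightarrow> complex"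
    and H :: "(('a, 'n) queer, 'h) supermodule"
  assumes "CARD('n) \<ge> 2"
    and "finitely_generated_algebra TYPE('a)"
    and "\<psi> \<in> map_weights"
    and "restrict_h0 \<psi> \<in> dominant_weights"
    and "is_H \<psi> H"
  shows "(\<forall>(H' :: (('a, 'n) queer, 'k) supermodule) (W :: (('a, 'n) queer, 'w) supermodule).
            is_local_weyl_module \<psi> H' W \<and> fin_dim W \<and> in_category_I W \<longrightarrow>
              iso_super UNIV W (local_weyl \<psi> H) \<or>
              iso_super UNIV W (parity_change (local_weyl \<psi> H))) \<and>
         (\<forall>(V :: (('a, 'n) queer, 'v) supermodule) N.
            fin_dim V \<and> in_category_I V \<and> highest_map_weight_module \<psi> V N \<longrightarrow>
              surjects_onto UNIV (local_weyl \<psi> H) V \<or>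
              surjects_onto UNIV (parity_change (local_weyl \<psi> H)) V)"
proof (intro conjI allI impI; elim conjE)
  have H: "supermodule hA H" using assms(5) by (simp add: is_H_def)
  note \<Pi>H = supermodule_parity_change[OF H]
  {
    fix H' :: "(('a, 'n) queer, 'k) supermodule" and W :: "(('a, 'n) queer, 'w) supermodule"
    assume "is_local_weyl_module \<psi> H' W"
    then have H': "is_H \<psi> H'" "supermodule hA H'" and W: "iso_super UNIV W (local_weyl \<psi> H')"
      by (auto simp: is_local_weyl_module_def is_H_def)
    \<comment> \<open>\<open>H'\<close> is isomorphic to \<open>H\<close> or to its parity change.
      Functoriality carries this to the Weyl modules, and the shift then comes out of the
      construction.\<close>
    show "iso_super UNIV W (local_weyl \<psi> H) \<or> iso_super UNIV W (parity_change (local_weyl \<psi> H))"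
      using is_H_unique[OF assms(3) H'(1) assms(5)]
        local_weyl_iso[OF H'(2) H, THEN iso_super_trans[OF W]]
        local_weyl_iso[OF H'(2) \<Pi>H, THEN iso_super_trans[OF W], unfolded local_weyl_parity_change]
      by blast
  next
    fix V :: "(('a, 'n) queer, 'v) supermodule" and N
    assume fd: "fin_dim V" and V: "highest_map_weight_module \<psi> V N"
    then have K: "is_H \<psi> (restrict_to V N)" by (simp add: highest_map_weight_module_def)
    \<comment> \<open>Uniqueness may place the shift on the generating subspace of \<open>V\<close>.
      It is moved to \<open>H\<close>, so that \<open>V\<close> itself keeps its grading and the
      Weyl module is shifted instead.\<close>
    show "surjects_onto UNIV (local_weyl \<psi> H) V \<or> surjects_onto UNIV (parity_change (local_weyl \<psi> H)) V"
      using is_H_unique[OF assms(3,5) K] local_weyl_surjects_onto[OF H _ fd V]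
        local_weyl_surjects_onto[OF \<Pi>H _ fd V] local_weyl_parity_change[of \<psi> H]
      by (auto simp: iso_super_parity_change)
  }
qed

end
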